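(* Let $0\le\alpha<2$ and let $u:\mathbb{R}^n\to\mathbb{R}^m$ be a minimizer of $J(u)=\int\left(\tfrac12|\nabla u|^2+W(u)\right)dx$ with $|u(x)|<M$, where $W$ satisfies hypothesis (H1) (see context) if $0<\alpha<2$, and $W=\chi_{A^c}$ if $\alpha=0$. Then there are a constant $C_0=C_0(W,M)$, independent of $x_0$, and $r_0>0$ such that for every $x_0\in\mathbb{R}^n$ $$J_{B_r(x_0)}(u)\le C_0r^{n-1},\quad r>r_0 .$$
   Context: $A=\{a_1,\dots,a_N\}\subset\mathbb{R}^m$, $N\ge2$, is a set of distinct points, $A^c=\mathbb{R}^m\setminus A$, $\chi_{A^c}$ its characteristic function, and $J_\Omega$ denotes the integral defining $J$ taken over $\Omega$. Hypothesis (H1) (for $0<\alpha<2$): $W\in C(\mathbb{R}^m;[0,+\infty))$ with $\{W=0\}=A$. There are constants $\rho_0>0$, $C^*>0$ independent of $\alpha$ such that for every $a\in A$, $W$ is differentiable in a deleted neighborhood of $a$ and $\frac{d}{d\rho}W(a+\rho\xi)\ge\alpha C^*\rho^{\alpha-1}$ for all $\rho\in(0,\rho_0]$ and all $\xi\in\mathbb{R}^m$ with $|\xi|=1$. Standing assumption: $\liminf_{|z|\to\infty}W(z)>0$. Minimizer: a map $u\in W^{1,2}_{loc}(\mathbb{R}^n,\mathbb{R}^m)\cap L^\infty(\mathbb{R}^n;\mathbb{R}^m)$ such that $J_\Omega(u+v)\ge J_\Omega(u)$ for every $v\in W^{1,2}_0(\Omega,\mathbb{R}^m)\cap L^\infty(\Omega;\mathbb{R}^m)$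 and every open bounded Lipschitz set $\Omega\subset\mathbb{R}^n$. *)

theory Defs
  imports "HOL-Analysis.Analysis"
begin

section \<open>Test functions\<close>

definition partial_deriv :: "'n::finite \<Rightarrow> (real^'n \<Rightarrow> 'b::real_normed_vector) \<Rightarrow> real^'n \<Rightarrow> 'b"
  where "partial_deriv j f x = frechet_derivative f (at x) (axis j 1)"

primrec C_k :: "nat \<Rightarrow> (real^'n::finite \<Rightarrow> 'b::real_normed_vector) \<Rightarrow> bool" where
  "C_k 0 f \<longleftrightarrow> continuous_on UNIV f"
| "C_k (Suc k) f \<longleftrightarrow> (\<forall>x. f differentiable (at x)) \<and> (\<forall>j. C_k k (partial_deriv j f))"

text \<open>The space \<open>C\<^sub>c\<^sup>\<infinity>(\<Omega>)\<close>; its elements are regarded as functions on the whole space.\<close>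

definition test_function :: "(real^'n::finite) set \<Rightarrow> (real^'n \<Rightarrow> 'b::real_normed_vector) \<Rightarrow> bool"
  where "test_function \<Omega> \<phi> \<longleftrightarrow>
    (\<forall>k. C_k k \<phi>) \<and> compact (closure {x. \<phi> x \<noteq> 0}) \<and> closure {x. \<phi> x \<noteq> 0} \<subseteq> \<Omega>"


section \<open>Lebesgue and Sobolev spaces\<close>

text \<open>Functions are defined on the whole space, but all notions relative to an open set \<open>\<Omega>\<close>
  depend only on the values in \<open>\<Omega>\<close>.\<close>

definition L1_loc :: "(real^'n::finite) set \<Rightarrow> (real^'n \<Rightarrow> 'b::euclidean_space) \<Rightarrow> bool"
  where "L1_loc \<Omega> f \<longleftrightarrow> (\<forall>K. compact K \<and> K \<subseteq> \<Omega> \<longrightarrow> f absolutely_integrable_on K)"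

definition L2 :: "(real^'n::finite) set \<Rightarrow> (real^'n \<Rightarrow> 'b::euclidean_space) \<Rightarrow> bool"
  where "L2 \<Omega> f \<longleftrightarrow> set_borel_measurable lebesgue \<Omega> f \<and>
    set_integrable lebesgue \<Omega> (\<lambda>x. (norm (f x))\<^sup>2)"

definition L_infinity :: "(real^'n::finite) set \<Rightarrow> (real^'n \<Rightarrow> 'b::euclidean_space) \<Rightarrow> bool"
  where "L_infinity \<Omega> f \<longleftrightarrow> set_borel_measurable lebesgue \<Omega> f \<and>
    (\<exists>K. AE x in lebesgue. x \<in> \<Omega> \<longrightarrow> norm (f x) \<le> K)"

text \<open>The gradient of a map into \<open>\<real>\<^sup>m\<close> is an \<open>m \<times> n\<close> matrix with rows indexed by the components
  of the map. The norm of the type \<open>real^'n^'m\<close> is the Frobenius norm, i.e. the Euclidean norm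
  \<open>|\<nabla>u|\<close>.\<close>

definition has_weak_gradient ::
    "(real^'n::finite) set \<Rightarrow> (real^'n \<Rightarrow> real^'m::finite) \<Rightarrow> (real^'n \<Rightarrow> real^'n^'m) \<Rightarrow> bool"
  where "has_weak_gradient \<Omega> u G \<longleftrightarrow> L1_loc \<Omega> u \<and> L1_loc \<Omega> G \<and>
    (\<forall>\<phi> :: real^'n \<Rightarrow> real. test_function \<Omega> \<phi> \<longrightarrow>
      (\<forall>i j. (LINT x:\<Omega>|lebesgue. u x $ i * partial_deriv j \<phi> x)
            = - (LINT x:\<Omega>|lebesgue. G x $ i $ j * \<phi> x)))"

text \<open>The weak gradient is unique up to null sets; a representative is chosen.\<close>

definition weak_gradient ::
    "(real^'n::finite) set \<Rightarrow> (real^'n \<Rightarrow> real^'m::finite) \<Rightarrow> real^'n \<Rightarrow> real^'n^'m"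
  where "weak_gradient \<Omega> u = (SOME G. has_weak_gradient \<Omega> u G)"

definition W12 :: "(real^'n::finite) set \<Rightarrow> (real^'n \<Rightarrow> real^'m::finite) \<Rightarrow> bool"
  where "W12 \<Omega> u \<longleftrightarrow> L2 \<Omega> u \<and> (\<exists>G. has_weak_gradient \<Omega> u G \<and> L2 \<Omega> G)"

definition W12_norm :: "(real^'n::finite) set \<Rightarrow> (real^'n \<Rightarrow> real^'m::finite) \<Rightarrow> real"
  where "W12_norm \<Omega> u = sqrt ((LINT x:\<Omega>|lebesgue. (norm (u x))\<^sup>2)
    + (LINT x:\<Omega>|lebesgue. (norm (weak_gradient \<Omega> u x))\<^sup>2))"

definition W12_loc :: "(real^'n::finite \<Rightarrow> real^'m::finite) \<Rightarrow> bool"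
  where "W12_loc u \<longleftrightarrow> (\<forall>V. open V \<and> bounded V \<longrightarrow> W12 V u)"

text \<open>The closure of \<open>C\<^sub>c\<^sup>\<infinity>(\<Omega>, \<real>\<^sup>m)\<close> in \<open>W\<^sup>1\<^sup>,\<^sup>2(\<Omega>, \<real>\<^sup>m)\<close>.\<close>

definition W12_0 :: "(real^'n::finite) set \<Rightarrow> (real^'n \<Rightarrow> real^'m::finite) \<Rightarrow> bool"
  where "W12_0 \<Omega> v \<longleftrightarrow> W12 \<Omega> v \<and>
    (\<exists>\<phi> :: nat \<Rightarrow> real^'n \<Rightarrow> real^'m. (\<forall>k. test_function \<Omega> (\<phi> k)) \<and>
      (\<lambda>k. W12_norm \<Omega> (\<lambda>x. \<phi> k x - v x)) \<longlonglongrightarrow> 0)"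


section \<open>Energy and minimizers\<close>

text \<open>Near each boundary point the set is, in suitable orthogonal coordinates with last axis
  \<open>\<nu>\<close>, the open region above the graph of a Lipschitz function on the hyperplane orthogonal
  to \<open>\<nu>\<close>.\<close>

definition lipschitz_boundary :: "(real^'n::finite) set \<Rightarrow> bool"
  where "lipschitz_boundary \<Omega> \<longleftrightarrow>
    (\<forall>p \<in> frontier \<Omega>. \<exists>\<nu> \<gamma> L \<epsilon>. norm \<nu> = 1 \<and> L-lipschitz_on {y. y \<bullet> \<nu> = 0} \<gamma> \<and> 0 < \<epsilon> \<and>
      (\<forall>x \<in> ball p \<epsilon>. x \<in> \<Omega> \<longleftrightarrow> \<gamma> (x - (x \<bullet> \<nu>) *\<^sub>R \<nu>) < x \<bullet> \<nu>))"

definition energy ::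
    "(real^'m \<Rightarrow> real) \<Rightarrow> (real^'n::finite) set \<Rightarrow> (real^'n \<Rightarrow> real^'m::finite) \<Rightarrow> ennreal"
  where "energy W \<Omega> u =
    (\<integral>\<^sup>+ x \<in> \<Omega>. ennreal ((norm (weak_gradient \<Omega> u x))\<^sup>2 / 2 + W (u x)) \<partial>lebesgue)"

definition minimizer :: "(real^'m \<Rightarrow> real) \<Rightarrow> (real^'n::finite \<Rightarrow> real^'m::finite) \<Rightarrow> bool"
  where "minimizer W u \<longleftrightarrow> W12_loc u \<and> L_infinity UNIV u \<and>
    (\<forall>\<Omega> v. open \<Omega> \<and> bounded \<Omega> \<and> lipschitz_boundary \<Omega> \<and> W12_0 \<Omega> v \<and> L_infinity \<Omega> v \<longrightarrow>
      energy W \<Omega> u \<le> energy W \<Omega> (\<lambda>x. u x + v x))"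


section \<open>The potential\<close>

text \<open>The filter \<open>at a\<close> excludes \<open>a\<close> itself, so the first condition at \<open>a\<close> says that \<open>W\<close> is
  differentiable in a deleted neighbourhood of \<open>a\<close>.\<close>

definition H1 :: "real \<Rightarrow> (real^'m::finite) set \<Rightarrow> (real^'m \<Rightarrow> real) \<Rightarrow> bool"
  where "H1 \<alpha> A W \<longleftrightarrow>
    continuous_on UNIV W \<and> (\<forall>z. 0 \<le> W z) \<and> {z. W z = 0} = A \<and>
    (\<exists>\<rho>\<^sub>0 > 0. \<exists>C > 0. \<forall>a \<in> A.
      (\<forall>\<^sub>F z in at a. W differentiable (at z)) \<and>
      (\<forall>\<rho> \<in> {0<..\<rho>\<^sub>0}. \<forall>\<xi>. norm \<xi> = 1 \<longrightarrow>
        (\<exists>D. ((\<lambda>t. W (a + t *\<^sub>R \<xi>)) has_real_derivative D) (at \<rho>) \<and>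
             \<alpha> * C * \<rho> powr (\<alpha> - 1) \<le> D)))"

end

theory Submission
  imports Defs
begin

text \<open>
  For radii \<open>s < t\<close> compare \<open>u\<close> with the competitor \<open>(1 - \<phi>) u + \<phi> a\<close>, where \<open>W a = 0\<close> and
  \<open>\<phi>\<close> is a cutoff function equal to 1 on the ball of radius \<open>s\<close> and supported in the ball of
  radius \<open>t\<close>. The competitor has no energy in the inner ball, so minimality and hole filling give
  \<open>2 J(s) \<le> J(t) + K (t - s)\<^sup>-\<^sup>2 V\<close>, where \<open>J(t)\<close> is the energy of \<open>u\<close> in the ball of radius \<open>t\<close>
  and \<open>V\<close> is the volume of the shell. Taking radii between \<open>r\<close> and \<open>r + 1\<close> with geometrically
  decreasing gaps, the term \<open>J(t)\<close> is absorbed and \<open>J(r) \<le> C V \<le> C' r\<^sup>n\<^sup>-\<^sup>1\<close>. No regularity of \<open>u\<close>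
  beyond local finiteness of the energy is needed. The difference of the competitor and \<open>u\<close> is
  admissible because a compactly supported \<open>W\<^sup>1\<^sup>,\<^sup>2\<close> map is approximated by its mollifications.
\<close>

subsection \<open>Smooth functions and test functions\<close>

text \<open>The factor 2 of the iteration comes from \<open>(p + q)^2 <= 2 p^2 + 2 q^2\<close>,
  applied to the gradient of the competitor on the shell: its energy there is at most twice that of
  \<open>u\<close> plus a multiple of the volume, and the shell energy of \<open>u\<close> is
  \<open>J(t) - J(s)\<close>. Absorption works as long as the inverse squared gaps grow by a ratio
  below 2; gaps shrinking by 3/4 give 16/9. The exponent n - 1 comes from keeping all radii in one
  shell of unit width. Two features of the definitions account for the length. The weak gradient is
  a chosen representative, so the energy of an explicit competitor can be computed only after
  uniqueness almost everywhere is known; this calls for the fundamental lemma. And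
  \<open>W12_0\<close> is a closure of smooth maps, so a smooth bump, its mollifiers and their L2
  convergence have to be built. The same mollifiers supply the cutoffs, with a gradient bound
  uniform in the centre. This uniformity, and a bound for \<open>W\<close> on a ball containing both
  \<open>a\<close> and the essential range of \<open>u\<close>, make the constant independent of
  \<open>u\<close> and of the centre.\<close>

lemma C_k_continuous: "C_k k f \<Longrightarrow> continuous_on UNIV f"
  by (cases k) (auto simp: continuous_on_eq_continuous_at differentiable_imp_continuous_within)

lemma C_k_SucD: "C_k (Suc k) f \<Longrightarrow> C_k k f"
proof (induction k arbitrary: f)
  case 0
  then show ?case by (metis C_k.simps(1) C_k_continuous)
next
  case (Suc k)
  then show ?case by (metis C_k.simps(2))
qed

lemma partial_deriv_eq:
  assumes "(f has_derivative f') (at x)"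
  shows "partial_deriv j f x = f' (axis j 1)"
  using frechet_derivative_at[OF assms] by (simp add: partial_deriv_def)

lemma C_k_const: "C_k k (\<lambda>_::real^'n::finite. c)"
proof (induction k arbitrary: c)
  case (Suc k)
  have "partial_deriv j (\<lambda>_::real^'n. c) = (\<lambda>_. 0)" for j
    by (rule ext, subst partial_deriv_eq[OF has_derivative_const]) simp
  with Suc[of 0] show ?case by simp
qed simp

lemma has_derivative_frechet: "f differentiable (at x) \<Longrightarrow> (f has_derivative frechet_derivative f (at x)) (at x)"
  by (simp add: frechet_derivative_works)

lemma C_k_add:
  assumes "C_k k f" "C_k k g" shows "C_k k (\<lambda>x. f x + g x)"
  using assms
proof (induction k arbitrary: f g)
  case (Suc k)
  then have f: "\<And>x. (f has_derivative frechet_derivative f (at x)) (at x)"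
    and g: "\<And>x. (g has_derivative frechet_derivative g (at x)) (at x)"
    by (auto simp: has_derivative_frechet)
  have D: "\<And>x. ((\<lambda>x. f x + g x) has_derivative
      (\<lambda>h. frechet_derivative f (at x) h + frechet_derivative g (at x) h)) (at x)"
    by (rule has_derivative_add[OF f g])
  have "partial_deriv j (\<lambda>x. f x + g x) = (\<lambda>x. partial_deriv j f x + partial_deriv j g x)" for j
    by (rule ext, subst partial_deriv_eq[OF D]) (simp add: partial_deriv_def)
  moreover have "(\<lambda>x. f x + g x) differentiable (at x)" for x
    by (rule differentiableI[OF D])
  ultimately show ?case using Suc by simp
qed (simp add: continuous_on_add)

lemma partial_deriv_mult:
  fixes f g :: "real^'n::finite \<Rightarrow> real"
  assumes "f differentiable (at x)" "g differentiable (at x)"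
  shows "partial_deriv j (\<lambda>x. f x * g x) x = f x * partial_deriv j g x + partial_deriv j f x * g x"
  using partial_deriv_eq[OF has_derivative_mult[OF assms[THEN has_derivative_frechet]], of j]
  by (simp add: partial_deriv_def)

lemma C_k_mult:
  fixes f g :: "real^'n::finite \<Rightarrow> real"
  assumes "C_k k f" "C_k k g" shows "C_k k (\<lambda>x. f x * g x)"
  using assms
proof (induction k arbitrary: f g)
  case (Suc k)
  have d: "\<And>x. f differentiable (at x)" "\<And>x. g differentiable (at x)" using Suc.prems by auto
  have "partial_deriv j (\<lambda>x. f x * g x) = (\<lambda>x. f x * partial_deriv j g x + partial_deriv j f x * g x)" for j
    using partial_deriv_mult[OF d] by blast
  moreover have "(\<lambda>x. f x * g x) differentiable (at x)" for x
    using d by (rule differentiable_mult)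
  ultimately show ?case using Suc C_k_SucD[OF Suc.prems(1)] C_k_SucD[OF Suc.prems(2)]
    by (auto intro!: C_k_add)
qed (simp add: continuous_on_mult)

lemma C_k_component: "C_k k (\<lambda>x::real^'n::finite. x $ i)"
proof (cases k)
  case (Suc m)
  have D: "((\<lambda>x::real^'n. x $ i) has_derivative (\<lambda>h. h $ i)) (at x)" for x
    by (simp add: bounded_linear_vec_nth has_derivative_bounded_linear
        bounded_linear_imp_has_derivative)
  have "partial_deriv j (\<lambda>x::real^'n. x $ i) = (\<lambda>_. axis j 1 $ i)" for j
    by (rule ext, subst partial_deriv_eq[OF D]) simp
  moreover have "(\<lambda>x::real^'n. x $ i) differentiable (at x)" for x
    by (rule differentiableI[OF D])
  ultimately show ?thesis using Suc by (auto simp: C_k_const)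
qed (auto intro!: continuous_intros)

lemma partial_deriv_scale:
  assumes "\<And>x. f differentiable (at x)"
  shows "partial_deriv j (\<lambda>x. f (c *\<^sub>R x)) x = c *\<^sub>R partial_deriv j f (c *\<^sub>R x)"
    and "(\<lambda>x. f (c *\<^sub>R x)) differentiable (at x)"
proof -
  have D: "((\<lambda>x. f (c *\<^sub>R x)) has_derivative (\<lambda>h. frechet_derivative f (at (c *\<^sub>R x)) (c *\<^sub>R h))) (at x)"
    by (rule has_derivative_compose[OF _ has_derivative_frechet[OF assms]])
       (auto intro!: derivative_eq_intros)
  show "(\<lambda>x. f (c *\<^sub>R x)) differentiable (at x)" by (rule differentiableI[OF D])
  show "partial_deriv j (\<lambda>x. f (c *\<^sub>R x)) x = c *\<^sub>R partial_deriv j f (c *\<^sub>R x)"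
    using partial_deriv_eq[OF D, of j] linear_frechet_derivative[OF assms[of "c *\<^sub>R x"]]
    by (simp add: partial_deriv_def linear_cmul)
qed

lemma C_k_cmult:
  fixes f :: "real^'n::finite \<Rightarrow> real"
  shows "C_k k f \<Longrightarrow> C_k k (\<lambda>x. c * f x)"
  by (rule C_k_mult[OF C_k_const])

lemma C_k_scale:
  fixes f :: "real^'n::finite \<Rightarrow> real"
  assumes "C_k k f" shows "C_k k (\<lambda>x. f (c *\<^sub>R x))"
  using assms
proof (induction k arbitrary: f)
  case 0
  then show ?case
    by (auto intro!: continuous_on_compose2[where g=f and t=UNIV] continuous_intros)
next
  case (Suc k)
  then have d: "\<And>x. f differentiable (at x)" by auto
  have "partial_deriv j (\<lambda>x. f (c *\<^sub>R x)) = (\<lambda>x. c * partial_deriv j f (c *\<^sub>R x))" for j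
    using partial_deriv_scale(1)[OF d] by auto
  then show ?case using Suc partial_deriv_scale(2)[OF d] by (auto intro!: C_k_cmult)
qed

section \<open>The flat exponential and the smooth bump\<close>

definition flat_exp :: "nat \<Rightarrow> real \<Rightarrow> real"
  where "flat_exp m t = (if t \<le> 0 then 0 else exp (- inverse t) * inverse t ^ m)"

lemma exp_ge_power_fact:
  fixes x :: real assumes "0 \<le> x" shows "x ^ n / fact n \<le> exp x"
proof -
  have "(\<Sum>k\<in>{n}. x ^ k /\<^sub>R fact k) \<le> (\<Sum>k. x ^ k /\<^sub>R fact k)"
    by (rule sum_le_suminf) (use assms summable_exp_generic[of x] in auto)
  then show ?thesis by (simp add: exp_def divide_inverse mult.commute)
qed

text \<open>The term of order \<open>m + 2\<close> of the exponential series at \<open>1 / t\<close>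
  beats the factor \<open>inverse t ^ m\<close> and leaves \<open>t^2\<close> over. A quadratic rate
  is what makes the difference quotient at 0 vanish in \<open>flat_exp_deriv\<close>.\<close>

lemma flat_exp_bound: "\<bar>flat_exp m t\<bar> \<le> fact (m + 2) * t\<^sup>2"
proof (cases "t \<le> 0")
  case False
  then have t: "t > 0" by simp
  define F :: real where "F = fact (m + 2)"
  have F: "F > 0" by (simp add: F_def)
  have "inverse t ^ (m + 2) / F \<le> exp (inverse t)"
    unfolding F_def using t by (intro exp_ge_power_fact) simp
  then have "inverse t ^ (m + 2) \<le> F * exp (inverse t)"
    using F by (simp add: pos_divide_le_eq mult.commute)
  then have "(exp (- inverse t) * t\<^sup>2) * inverse t ^ (m + 2)
      \<le> (exp (- inverse t) * t\<^sup>2) * (F * exp (inverse t))"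
    by (intro mult_left_mono) auto
  also have "\<dots> = F * t\<^sup>2 * (exp (- inverse t) * exp (inverse t))"
    by (simp only: mult_ac)
  also have "exp (- inverse t) * exp (inverse t) = 1"
    by (simp add: exp_add[symmetric])
  also have "(exp (- inverse t) * t\<^sup>2) * inverse t ^ (m + 2) = exp (- inverse t) * inverse t ^ m"
    using t by (simp add: power_add power2_eq_square field_simps)
  finally show ?thesis using t by (simp add: flat_exp_def F_def)
qed (simp add: flat_exp_def)

text \<open>The index \<open>m\<close> exists for this recursion: differentiation stays inside the
  family, so smoothness of every order follows from a single induction. The only delicate point is t
  = 0, where the two formulas meet.\<close>

lemma flat_exp_deriv:
  "(flat_exp m has_real_derivative flat_exp (m + 2) t - m * flat_exp (m + 1) t) (at t)"
proof -
  consider "t < 0" | "t = 0" | "t > 0" by linarith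
  then show ?thesis
  proof cases
    case 1
    have "((\<lambda>_. 0) has_real_derivative 0) (at t)" by simp
    then have "(flat_exp m has_real_derivative 0) (at t)"
      by (rule has_field_derivative_transform_within_open[of _ _ _ "{..<0}"])
         (use 1 in \<open>auto simp: flat_exp_def\<close>)
    then show ?thesis using 1 by (simp add: flat_exp_def)
  next
    case 2
    have "((\<lambda>h. flat_exp m h / h) \<longlongrightarrow> 0) (at 0)"
    proof (rule Lim_null_comparison)
      show "((\<lambda>h::real. fact (m + 2) * \<bar>h\<bar>) \<longlongrightarrow> 0) (at 0)"
        by (auto intro!: tendsto_eq_intros)
      have "norm (flat_exp m h / h) \<le> fact (m + 2) * \<bar>h\<bar>" for h
      proof (cases "h = 0")
        case False
        have "fact (m + 2) * h\<^sup>2 = fact (m + 2) * \<bar>h\<bar> * \<bar>h\<bar>"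
          by (simp add: power2_eq_square)
        then show ?thesis using flat_exp_bound[of m h] False
          by (simp add: pos_divide_le_eq del: fact_Suc)
      qed simp
      then show "\<forall>\<^sub>F h in at 0. norm (flat_exp m h / h) \<le> fact (m + 2) * \<bar>h\<bar>" by simp
    qed
    then show ?thesis using 2 by (simp add: DERIV_def flat_exp_def)
  next
    case 3
    have a: "((\<lambda>t. inverse t ^ m) has_real_derivative - m * inverse t ^ (m + 1)) (at t)"
    proof (cases m)
      case (Suc k)
      have "((\<lambda>t. inverse t ^ Suc k) has_real_derivative
          of_nat (Suc k) * (- (inverse t ^ Suc (Suc 0)) * inverse t ^ (Suc k - Suc 0))) (at t)"
        using DERIV_power[OF DERIV_inverse, of t "Suc k" UNIV] 3 by (simp del: power_Suc)
      moreover have "of_nat (Suc k) * (- (inverse t ^ Suc (Suc 0)) * inverse t ^ (Suc k - Suc 0))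
          = - m * inverse t ^ (m + 1)"
        by (simp add: Suc algebra_simps)
      ultimately show ?thesis by (simp only: Suc)
    qed simp
    have b: "((\<lambda>t. exp (- inverse t)) has_real_derivative exp (- inverse t) * inverse t ^ 2) (at t)"
      using DERIV_chain2[OF DERIV_exp DERIV_minus[OF DERIV_inverse], of t] 3
      by (simp add: power2_eq_square)
    have "((\<lambda>t. exp (- inverse t) * inverse t ^ m) has_real_derivative
        exp (- inverse t) * inverse t ^ 2 * inverse t ^ m
        + - m * inverse t ^ (m + 1) * exp (- inverse t)) (at t)"
      by (rule DERIV_mult[OF b a])
    also have "exp (- inverse t) * inverse t ^ 2 * inverse t ^ m
        + - m * inverse t ^ (m + 1) * exp (- inverse t)
      = exp (- inverse t) * inverse t ^ (m + 2) - m * (exp (- inverse t) * inverse t ^ (m + 1))"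
      by (simp add: power_add mult_ac power2_eq_square)
    finally have "((\<lambda>t. exp (- inverse t) * inverse t ^ m) has_real_derivative
      exp (- inverse t) * inverse t ^ (m + 2) - m * (exp (- inverse t) * inverse t ^ (m + 1))) (at t)" .
    then have "(flat_exp m has_real_derivative
        exp (- inverse t) * inverse t ^ (m + 2) - m * (exp (- inverse t) * inverse t ^ (m + 1))) (at t)"
      by (rule has_field_derivative_transform_within_open[of _ _ _ "{0<..}"])
         (use 3 in \<open>simp_all add: flat_exp_def\<close>)
    then show ?thesis using 3 by (simp add: flat_exp_def)
  qed
qed

definition bump :: "nat \<Rightarrow> real^'n::finite \<Rightarrow> real"
  where "bump m x = flat_exp m (1 - x \<bullet> x)"

text \<open>The chain rule through \<open>1 - |x|^2\<close> produces a linear factor times bumps of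
  index \<open>m + 1\<close> and \<open>m + 2\<close>, hence the induction on \<open>k\<close> has
  to leave \<open>m\<close> free.\<close>

lemma C_k_bump: "C_k k (bump m :: real^'n::finite \<Rightarrow> real)"
proof (induction k arbitrary: m)
  case 0
  have "continuous_on UNIV (flat_exp m)"
    by (rule DERIV_continuous_on[OF has_field_derivative_at_within[OF flat_exp_deriv]])
  then have "continuous_on UNIV (\<lambda>x::real^'n. flat_exp m (1 - x \<bullet> x))"
    by (rule continuous_on_compose2) (auto intro!: continuous_intros)
  then show ?case by (simp add: bump_def[abs_def])
next
  case (Suc k)
  let ?c = "\<lambda>x::real^'n. flat_exp (m + 2) (1 - x \<bullet> x) - m * flat_exp (m + 1) (1 - x \<bullet> x)"
  have D: "((bump m :: real^'n \<Rightarrow> real) has_derivative (\<lambda>h. - 2 * (x \<bullet> h) * ?c x)) (at x)" for x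
  proof -
    have "((\<lambda>x::real^'n. 1 - x \<bullet> x) has_derivative (\<lambda>h. - 2 * (x \<bullet> h))) (at x)"
      by (auto intro!: derivative_eq_intros simp: inner_commute)
    from has_derivative_compose[OF this flat_exp_deriv[THEN has_field_derivative_imp_has_derivative]]
    show ?thesis by (simp add: bump_def[abs_def] mult.commute)
  qed
  have "partial_deriv j (bump m) =
      (\<lambda>x::real^'n. (-2 * x $ j) * (bump (m + 2) x + (- real m) * bump (m + 1) x))" for j
    by (rule ext, subst partial_deriv_eq[OF D]) (simp add: bump_def inner_axis)
  moreover have "(bump m :: real^'n \<Rightarrow> real) differentiable (at x)" for x
    by (rule differentiableI[OF D])
  moreover have "C_k k (\<lambda>x::real^'n. (-2 * x $ j) * (bump (m + 2) x + (- real m) * bump (m + 1) x))" for j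
    by (intro C_k_mult C_k_add C_k_cmult C_k_component Suc)
  ultimately show ?case
    by simp
qed

section \<open>Supports, bounds and derivatives of test functions\<close>

lemma test_function_mono: "test_function S f \<Longrightarrow> S \<subseteq> T \<Longrightarrow> test_function T f"
  by (auto simp: test_function_def)

lemma test_functionI:
  assumes "\<And>k. C_k k f" "compact K" "K \<subseteq> S" "\<And>x. x \<notin> K \<Longrightarrow> f x = 0"
  shows "test_function S f"
proof -
  have "closure {x. f x \<noteq> 0} \<subseteq> K"
    using assms by (intro closure_minimal) (auto simp: compact_imp_closed)
  then show ?thesis using assms
    by (auto simp: test_function_def compact_eq_bounded_closed intro: bounded_subset)
qed

lemma test_function_support:
  assumes "test_function S f"
  shows "\<exists>K. compact K \<and> K \<subseteq> S \<and> (\<forall>x. x \<notin> K \<longrightarrow> f x = 0)"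
  using assms closure_subset[of "{x. f x \<noteq> 0}"] unfolding test_function_def by blast

lemma test_function_differentiable: "test_function S f \<Longrightarrow> f differentiable (at x)"
  by (metis C_k.simps(2) test_function_def)

lemma test_function_continuous: "test_function S f \<Longrightarrow> continuous_on UNIV f"
  by (metis C_k.simps(1) test_function_def)

lemma test_function_has_derivative:
  assumes "test_function S f"
  shows "(f has_derivative (\<lambda>h. \<Sum>j\<in>UNIV. h $ j *\<^sub>R partial_deriv j f x)) (at x)"
proof -
  have d: "f differentiable (at x)" using assms by (rule test_function_differentiable)
  interpret linear "frechet_derivative f (at x)" using d by (rule linear_frechet_derivative)
  have "frechet_derivative f (at x) h = (\<Sum>j\<in>UNIV. h $ j *\<^sub>R partial_deriv j f x)" for h
  proof -
    have "h = (\<Sum>j\<in>UNIV. h $ j *\<^sub>R axis j 1)"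
      by (simp add: basis_expansion vec_eq_iff axis_def if_distrib cong: if_cong)
    then have "frechet_derivative f (at x) h = frechet_derivative f (at x) (\<Sum>j\<in>UNIV. h $ j *\<^sub>R axis j 1)"
      by simp
    also have "\<dots> = (\<Sum>j\<in>UNIV. h $ j *\<^sub>R frechet_derivative f (at x) (axis j 1))"
      by (simp add: sum scale)
    finally show ?thesis by (simp add: partial_deriv_def)
  qed
  then show ?thesis using has_derivative_frechet[OF d] by presburger
qed

lemma partial_deriv_locally_constant:
  assumes "open U" "x \<in> U" "\<And>y. y \<in> U \<Longrightarrow> f y = c"
  shows "partial_deriv j f x = 0"
proof -
  have "(f has_derivative (\<lambda>_. 0)) (at x)"
    by (rule has_derivative_transform_within_open[OF has_derivative_const[of c] assms(1,2)])
       (use assms in auto)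
  from partial_deriv_eq[OF this] show ?thesis .
qed

lemma test_function_partial:
  assumes "test_function S f" shows "test_function S (partial_deriv j f)"
proof -
  obtain K where K: "compact K" "K \<subseteq> S" "\<And>x. x \<notin> K \<Longrightarrow> f x = 0"
    using test_function_support[OF assms] by blast
  show ?thesis
  proof (rule test_functionI[OF _ K(1,2)])
    show "C_k k (partial_deriv j f)" for k
      using assms by (metis C_k.simps(2) test_function_def)
    show "partial_deriv j f x = 0" if "x \<notin> K" for x
      using K that by (intro partial_deriv_locally_constant[of "-K" x f 0])
        (auto simp: compact_imp_closed open_Compl)
  qed
qed

lemma test_function_mult:
  fixes f g :: "real^'n::finite \<Rightarrow> real"
  assumes "test_function S f" "\<And>k. C_k k g"
  shows "test_function S (\<lambda>x. f x * g x)"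
proof -
  obtain K where K: "compact K" "K \<subseteq> S" "\<And>x. x \<notin> K \<Longrightarrow> f x = 0"
    using test_function_support[OF assms(1)] by blast
  show ?thesis
    by (rule test_functionI[OF _ K(1,2)]) (use assms K(3) in \<open>auto simp: test_function_def C_k_mult\<close>)
qed

lemma test_function_bounded:
  assumes "test_function S f" obtains B where "B > 0" "\<And>x. norm (f x) \<le> B"
proof -
  obtain K where K: "compact K" "K \<subseteq> S" "\<And>x. x \<notin> K \<Longrightarrow> f x = 0"
    using test_function_support[OF assms] by blast
  have "compact (f ` K)"
    using K(1) test_function_continuous[OF assms]
    by (meson compact_continuous_image continuous_on_subset subset_UNIV)
  then obtain B where B: "B > 0" "\<And>y. y \<in> f ` K \<Longrightarrow> norm y \<le> B"
    by (meson bounded_pos compact_imp_bounded)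
  then show ?thesis using that[of B] K(3) by (metis image_eqI norm_zero less_eq_real_def)
qed

lemma test_function_uniformly_continuous:
  assumes "test_function S f" "e > 0"
  obtains d where "d > 0" "\<And>x y. dist x y < d \<Longrightarrow> dist (f x) (f y) < e"
proof -
  obtain K where K: "compact K" "K \<subseteq> S" "\<And>x. x \<notin> K \<Longrightarrow> f x = 0"
    using test_function_support[OF assms(1)] by blast
  \<comment> \<open>The closed unit neighbourhood of \<open>K\<close> contains both points as soon
    as one of them lies in \<open>K\<close> and their distance is below 1; this is why the final
    radius is \<open>min d 1\<close>. If neither lies in \<open>K\<close>, both values are
    0.\<close>
  define K' where "K' = {x + y |x y. x \<in> K \<and> y \<in> cball 0 1}"
  have "compact K'" unfolding K'_def by (intro compact_sums K compact_cball)
  then have "uniformly_continuous_on K' f"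
    using test_function_continuous[OF assms(1)]
    by (meson compact_uniformly_continuous continuous_on_subset subset_UNIV)
  then obtain d where d: "d > 0" "\<And>x y. x \<in> K' \<Longrightarrow> y \<in> K' \<Longrightarrow> dist y x < d \<Longrightarrow> dist (f y) (f x) < e"
    using assms(2) unfolding uniformly_continuous_on_def by metis
  show ?thesis
  proof (rule that[of "min d 1"])
    show "dist (f x) (f y) < e" if "dist x y < min d 1" for x y
    proof (cases "x \<in> K \<or> y \<in> K")
      case True
      have "a \<in> K'" if "b \<in> K" "dist a b < 1" for a b
      proof -
        have "a = b + (a - b)" "a - b \<in> cball 0 1" using that by (auto simp: dist_norm norm_minus_commute)
        then show ?thesis using that unfolding K'_def by blast
      qed
      from this[of x x] this[of x y] this[of y y] this[of y x]
      have "x \<in> K'" "y \<in> K'" using True that by (auto simp: dist_commute)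
      then show ?thesis using that d(2)[of y x] by simp
    next
      case False
      then show ?thesis using K(3) assms(2) by simp
    qed
  qed (use d in simp)
qed

section \<open>Lebesgue measure: sigma-finiteness for Fubini, changes of variables,
  integrability\<close>

lemma sigma_finite_lebesgue: "sigma_finite_measure (lebesgue :: 'a::euclidean_space measure)"
proof
  \<comment> \<open>The completion agrees with \<open>lborel\<close> on Borel sets, so the same
    countable cover has finite measures.\<close>
  obtain A :: "'a set set" where A: "countable A" "A \<subseteq> sets lborel" "\<Union>A = space lborel"
      "\<forall>a\<in>A. emeasure lborel a \<noteq> \<infinity>"
    using lborel.sigma_finite_countable by blast
  then show "\<exists>A::'a set set. countable A \<and> A \<subseteq> sets lebesgue \<and> \<Union> A = space lebesgue \<and>
      (\<forall>a\<in>A. emeasure lebesgue a \<noteq> \<infinity>)"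
    by (intro exI[of _ A]) auto
qed

interpretation lebesgue: sigma_finite_measure "lebesgue :: 'a::euclidean_space measure"
  by (rule sigma_finite_lebesgue)

interpretation lebesgue_pair: pair_sigma_finite "lebesgue :: 'a::euclidean_space measure"
    "lebesgue :: 'b::euclidean_space measure" ..

text \<open>Continuity makes \<open>f\<close> Borel, so both sides can be computed in
  \<open>lborel\<close>, where the affine image measure is known. It serves to rescale the bump and
  to reflect convolution kernels.\<close>

lemma integral_lebesgue_affine:
  fixes f :: "'a::euclidean_space \<Rightarrow> real"
  assumes "continuous_on UNIV f" "c \<noteq> 0"
  shows "(LINT x|lebesgue. f x) = \<bar>c\<bar> ^ DIM('a) * (LINT x|lebesgue. f (t + c *\<^sub>R x))"
proof -
  have m[measurable]: "f \<in> borel_measurable borel" by (rule borel_measurable_continuous_onI[OF assms(1)])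
  have "(LINT x|lborel. f x) = (LINT x|density (distr lborel borel (\<lambda>x. t + c *\<^sub>R x)) (\<lambda>_. \<bar>c\<bar>^DIM('a)). f x)"
    using lborel_affine[OF assms(2), of t] by simp
  also have "\<dots> = \<bar>c\<bar> ^ DIM('a) * (LINT x|lborel. f (t + c *\<^sub>R x))"
    by (subst integral_density) (auto simp: integral_distr)
  finally show ?thesis by (simp add: integral_completion)
qed

lemma continuous_imp_lebesgue_measurable:
  "continuous_on UNIV f \<Longrightarrow> f \<in> borel_measurable lebesgue"
  for f :: "'a::euclidean_space \<Rightarrow> 'b::euclidean_space"
  using borel_measurable_continuous_onI measurable_completion by (metis measurable_lborel2)

lemma test_function_measurable:
  fixes f :: "real^'n::finite \<Rightarrow> 'b::euclidean_space"
  shows "test_function S f \<Longrightarrow> f \<in> borel_measurable lebesgue"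
  by (intro continuous_imp_lebesgue_measurable test_function_continuous)

lemma integrable_bounded_scaleR:
  fixes g :: "'a::euclidean_space \<Rightarrow> 'b::euclidean_space"
  assumes "integrable lebesgue g" "h \<in> borel_measurable lebesgue" "\<And>x. \<bar>h x\<bar> \<le> (B::real)"
  shows "integrable lebesgue (\<lambda>x. h x *\<^sub>R g x)"
proof (rule Bochner_Integration.integrable_bound[of _ "\<lambda>x. B *\<^sub>R g x"])
  show "(\<lambda>x. h x *\<^sub>R g x) \<in> borel_measurable lebesgue" using assms by measurable
  have "\<bar>h x\<bar> \<le> \<bar>B\<bar>" for x using assms(3)[of x] by linarith
  then show "AE x in lebesgue. norm (h x *\<^sub>R g x) \<le> norm (B *\<^sub>R g x)" by (simp add: mult_right_mono)
qed (use assms in simp)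

lemma integrable_compact_support:
  fixes f :: "'a::euclidean_space \<Rightarrow> 'b::euclidean_space"
  assumes "f \<in> borel_measurable lebesgue" "bounded K" "\<And>x. x \<notin> K \<Longrightarrow> f x = 0" "\<And>x. norm (f x) \<le> B"
  shows "integrable lebesgue f"
proof -
  obtain r where r: "K \<subseteq> cball 0 r" using assms(2) by (meson bounded_iff mem_cball_0 subsetI)
  show ?thesis
  proof (rule Bochner_Integration.integrable_bound[of _ "\<lambda>x. indicator (cball 0 r) x * B"])
    show "integrable lebesgue (\<lambda>x. indicator (cball 0 r) x * B)"
      using emeasure_bounded_finite[OF bounded_cball, of 0 r]
      by (intro integrable_mult_left integrable_real_indicator) auto
    show "AE x in lebesgue. norm (f x) \<le> norm (indicator (cball 0 r) x * B)"
    proof (rule AE_I2)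
      fix x show "norm (f x) \<le> norm (indicator (cball 0 r) x * B)"
        using assms(3)[of x] assms(4)[of x] r by (cases "x \<in> K") (auto simp: abs_if)
    qed
  qed fact
qed

lemma integrable_test_function:
  fixes f :: "real^'n::finite \<Rightarrow> 'b::euclidean_space"
  assumes "test_function S f" shows "integrable lebesgue f"
proof -
  obtain K where K: "compact K" "\<And>x. x \<notin> K \<Longrightarrow> f x = 0"
    using test_function_support[OF assms] by blast
  obtain B where "\<And>x. norm (f x) \<le> B" using test_function_bounded[OF assms] by blast
  with K show ?thesis
    by (intro integrable_compact_support[of f K B] test_function_measurable[OF assms] compact_imp_bounded)
qed

subsection \<open>Convolution and mollifiers\<close>

definition conv :: "(real^'n::finite \<Rightarrow> real) \<Rightarrow> (real^'n \<Rightarrow> 'b::euclidean_space) \<Rightarrow> real^'n \<Rightarrow> 'b"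
  where "conv \<rho> g x = (LINT y|lebesgue. \<rho> (x - y) *\<^sub>R g y)"

lemma lebesgue_measurable_shift:
  fixes \<rho> :: "real^'n::finite \<Rightarrow> real"
  assumes "test_function S \<rho>"
  shows "(\<lambda>y. \<rho> (x - y)) \<in> borel_measurable lebesgue"
  by (intro continuous_imp_lebesgue_measurable
      continuous_on_compose2[OF test_function_continuous[OF assms]] continuous_intros) auto

lemma integrable_conv:
  fixes g :: "real^'n::finite \<Rightarrow> 'b::euclidean_space"
  assumes "test_function S \<rho>" "integrable lebesgue g"
  shows "integrable lebesgue (\<lambda>y. \<rho> (x - y) *\<^sub>R g y)"
proof -
  obtain B where "\<And>x. norm (\<rho> x) \<le> B" using test_function_bounded[OF assms(1)] by blast
  then have "\<bar>\<rho> (x - y)\<bar> \<le> B" for y by (metis real_norm_def)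
  then show ?thesis
    by (rule integrable_bounded_scaleR[OF assms(2) lebesgue_measurable_shift[OF assms(1)]])
qed

text \<open>The point is that \<open>d\<close> does not depend on \<open>z\<close>: in a convolution
  the first-order expansion is needed at all points \<open>x - w\<close> simultaneously. Uniformity
  comes from the uniform continuity of the partial derivatives.\<close>

lemma test_function_remainder:
  fixes \<rho> :: "real^'n::finite \<Rightarrow> real"
  assumes "test_function S \<rho>" "e > 0"
  shows "\<exists>d>0. \<forall>z h. norm h < d \<longrightarrow>
    \<bar>\<rho> (z + h) - \<rho> z - (\<Sum>j\<in>UNIV. h $ j * partial_deriv j \<rho> z)\<bar> \<le> e * norm h"
proof -
  \<comment> \<open>Each of the \<open>N\<close> partial derivatives is allowed to vary by
    \<open>e / N\<close>, so that their sum against the components of a vector costs at most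
    \<open>e\<close> times its norm.\<close>
  define N where "N = real CARD('n)"
  have N: "N > 0" by (simp add: N_def)
  have "\<exists>d>0. \<forall>x y. dist x y < d \<longrightarrow> dist (partial_deriv j \<rho> x) (partial_deriv j \<rho> y) < e / N" for j
    using test_function_uniformly_continuous[OF test_function_partial[OF assms(1), of j], of "e / N"] assms(2) N
    by (metis divide_pos_pos)
  then obtain D where D: "\<And>j. D j > 0" "\<And>j x y. dist x y < D j \<Longrightarrow>
      \<bar>partial_deriv j \<rho> x - partial_deriv j \<rho> y\<bar> < e / N"
    unfolding dist_real_def by metis
  define d where "d = Min (range D)"
  have d: "d > 0" "\<And>j. d \<le> D j" using D(1) by (auto simp: d_def)
  have "\<bar>\<rho> (z + h) - \<rho> z - (\<Sum>j\<in>UNIV. h $ j * partial_deriv j \<rho> z)\<bar> \<le> e * norm h"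
    if h: "norm h < d" for z h
  proof -
    have "norm (\<rho> (z + h) - \<rho> z - (\<lambda>h. \<Sum>j\<in>UNIV. h $ j *\<^sub>R partial_deriv j \<rho> z) (z + h - z)) \<le> norm (z + h - z) * e"
    proof (rule differentiable_bound_linearization[where S="ball z d" and f=\<rho>
          and f'="\<lambda>x h. \<Sum>j\<in>UNIV. h $ j *\<^sub>R partial_deriv j \<rho> x"])
      show "z + t *\<^sub>R (z + h - z) \<in> ball z d" if "t \<in> {0..1}" for t
      proof -
        have "\<bar>t\<bar> * norm h \<le> 1 * norm h" using that by (intro mult_right_mono) auto
        then show ?thesis using h by (simp add: dist_norm)
      qed
      show "(\<rho> has_derivative (\<lambda>h. \<Sum>j\<in>UNIV. h $ j *\<^sub>R partial_deriv j \<rho> x)) (at x within ball z d)" for x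
        by (rule has_derivative_at_withinI[OF test_function_has_derivative[OF assms(1)]])
      show "z \<in> ball z d" using d by simp
      fix x assume "x \<in> ball z d"
      then have *: "\<bar>partial_deriv j \<rho> x - partial_deriv j \<rho> z\<bar> \<le> e / N" for j
        using D(2)[of x z j] d(2)[of j] by (simp add: dist_commute less_imp_le)
      show "onorm ((\<lambda>h. \<Sum>j\<in>UNIV. h $ j *\<^sub>R partial_deriv j \<rho> x) - (\<lambda>h. \<Sum>j\<in>UNIV. h $ j *\<^sub>R partial_deriv j \<rho> z)) \<le> e"
      proof (rule onorm_le)
        fix k :: "real^'n"
        have "norm (((\<lambda>h. \<Sum>j\<in>UNIV. h $ j *\<^sub>R partial_deriv j \<rho> x) - (\<lambda>h. \<Sum>j\<in>UNIV. h $ j *\<^sub>R partial_deriv j \<rho> z)) k)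
          = \<bar>\<Sum>j\<in>UNIV. k $ j * (partial_deriv j \<rho> x - partial_deriv j \<rho> z)\<bar>"
          by (simp add: sum_subtractf algebra_simps)
        also have "\<dots> \<le> (\<Sum>j\<in>(UNIV::'n set). norm k * (e / N))"
          by (rule order_trans[OF sum_abs], rule sum_mono, unfold abs_mult)
             (intro mult_mono component_le_norm_cart * abs_ge_zero norm_ge_zero)
        also have "\<dots> = e * norm k" using N by (simp add: N_def)
        finally show "norm (((\<lambda>h. \<Sum>j\<in>UNIV. h $ j *\<^sub>R partial_deriv j \<rho> x) - (\<lambda>h. \<Sum>j\<in>UNIV. h $ j *\<^sub>R partial_deriv j \<rho> z)) k) \<le> e * norm k" .
      qed
    qed
    then show ?thesis by (simp add: mult.commute)
  qed
  with d(1) show ?thesis by blast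
qed

text \<open>Differentiation under the integral sign: the remainder of the kernel, being uniform in
  the base point, comes out of the integral and leaves the L1 norm of \<open>g\<close>.\<close>

lemma conv_has_derivative:
  assumes "test_function S \<rho>" "integrable lebesgue g"
  shows "(conv \<rho> g has_derivative (\<lambda>h. \<Sum>j\<in>UNIV. h $ j *\<^sub>R conv (partial_deriv j \<rho>) g x)) (at x)"
  unfolding has_derivative_at_alt
proof (intro conjI allI impI)
  show "bounded_linear (\<lambda>h. \<Sum>j\<in>UNIV. h $ j *\<^sub>R conv (partial_deriv j \<rho>) g x)"
    by (intro bounded_linear_sum bounded_linear_scaleR_const bounded_linear_vec_nth)
  fix e :: real assume e: "e > 0"
  define I where "I = (LINT y|lebesgue. norm (g y))"
  have I: "I \<ge> 0" unfolding I_def by simp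
  \<comment> \<open>The divisor is \<open>I + 1\<close> because the L1 norm \<open>I\<close> may be
    0.\<close>
  obtain d where d: "d > 0" "\<And>z h. norm h < d \<Longrightarrow>
    \<bar>\<rho> (z + h) - \<rho> z - (\<Sum>j\<in>UNIV. h $ j * partial_deriv j \<rho> z)\<bar> \<le> e / (I + 1) * norm h"
    using test_function_remainder[OF assms(1), of "e / (I + 1)"] e I by auto
  note ci = integrable_conv[OF assms] integrable_conv[OF test_function_partial[OF assms(1)] assms(2)]
  show "\<exists>d>0. \<forall>y. norm (y - x) < d \<longrightarrow>
      norm (conv \<rho> g y - conv \<rho> g x - (\<Sum>j\<in>UNIV. (y - x) $ j *\<^sub>R conv (partial_deriv j \<rho>) g x)) \<le> e * norm (y - x)"
  proof (intro exI[of _ d] conjI allI impI)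
    fix y assume y: "norm (y - x) < d"
    let ?h = "y - x"
    let ?R = "\<lambda>w. \<rho> (y - w) - \<rho> (x - w) - (\<Sum>j\<in>UNIV. ?h $ j * partial_deriv j \<rho> (x - w))"
    have R: "\<bar>?R w\<bar> \<le> e / (I + 1) * norm ?h" for w
      using d(2)[OF y, of "x - w"] by (simp add: algebra_simps)
    have eq: "?R w *\<^sub>R g w = \<rho> (y - w) *\<^sub>R g w - \<rho> (x - w) *\<^sub>R g w
        - (\<Sum>j\<in>UNIV. ?h $ j *\<^sub>R (partial_deriv j \<rho> (x - w) *\<^sub>R g w))" for w
      by (simp add: scaleR_diff_left scaleR_sum_left)
    have int: "integrable lebesgue (\<lambda>w. ?R w *\<^sub>R g w)"
      unfolding eq by (intro Bochner_Integration.integrable_diff Bochner_Integration.integrable_sum integrable_scaleR_right ci)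
    have "conv \<rho> g y - conv \<rho> g x - (\<Sum>j\<in>UNIV. ?h $ j *\<^sub>R conv (partial_deriv j \<rho>) g x)
      = (LINT w|lebesgue. ?R w *\<^sub>R g w)"
      unfolding eq conv_def
      by (simp add: Bochner_Integration.integral_diff Bochner_Integration.integral_sum ci
          Bochner_Integration.integrable_diff Bochner_Integration.integrable_sum integrable_scaleR_right
          del: scaleR_scaleR vector_minus_component)
    also have "norm \<dots> \<le> (LINT w|lebesgue. (e / (I + 1) * norm ?h) * norm (g w))"
      by (rule Bochner_Integration.integral_norm_bound_integral[OF int])
         (use assms R in \<open>simp_all add: mult_right_mono del: times_divide_eq_left\<close>)
    also have "\<dots> = e / (I + 1) * norm ?h * I" by (simp add: I_def)
    also have "\<dots> = e * norm ?h * (I / (I + 1))" by simp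
    also have "\<dots> \<le> e * norm ?h * 1" using e I by (intro mult_left_mono) auto
    finally show "norm (conv \<rho> g y - conv \<rho> g x - (\<Sum>j\<in>UNIV. ?h $ j *\<^sub>R conv (partial_deriv j \<rho>) g x)) \<le> e * norm ?h" by simp
  qed (use d in simp)
qed

lemma partial_deriv_conv:
  assumes "test_function S \<rho>" "integrable lebesgue g"
  shows "partial_deriv j (conv \<rho> g) = conv (partial_deriv j \<rho>) g"
  by (rule ext, subst partial_deriv_eq[OF conv_has_derivative[OF assms]])
     (simp add: axis_def if_distrib[of "\<lambda>c. c *\<^sub>R _"] cong: if_cong)

lemma C_k_conv:
  assumes "test_function S \<rho>" "integrable lebesgue g"
  shows "C_k k (conv \<rho> g)"
  using assms(1)
proof (induction k arbitrary: \<rho>)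
  case 0
  then show ?case
    using conv_has_derivative[OF 0 assms(2)]
    by (auto simp: continuous_on_eq_continuous_at intro: has_derivative_continuous)
next
  case (Suc k)
  then show ?case
    using differentiableI[OF conv_has_derivative[OF Suc.prems assms(2)]]
    by (simp add: partial_deriv_conv[OF Suc.prems assms(2)] test_function_partial)
qed

lemma conv_support:
  assumes "\<And>x. d \<le> norm x \<Longrightarrow> \<rho> x = 0" "\<And>y. y \<in> ball x d \<Longrightarrow> g y = 0"
  shows "conv \<rho> g x = 0"
proof -
  have "\<rho> (x - y) *\<^sub>R g y = 0" for y
    using assms(1)[of "x - y"] assms(2)[of y] by (cases "y \<in> ball x d") (auto simp: dist_norm)
  then have "(\<lambda>y. \<rho> (x - y) *\<^sub>R g y) = (\<lambda>_. 0)" by blast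
  then show ?thesis by (simp add: conv_def)
qed

lemma lebesgue_pair_measurable_diff:
  fixes f :: "real^'n::finite \<Rightarrow> real"
  assumes "continuous_on UNIV f"
  shows "(\<lambda>p. f (fst p - snd p)) \<in> borel_measurable (lebesgue \<Otimes>\<^sub>M lebesgue)"
proof -
  have [measurable]: "f \<in> borel_measurable borel" by (rule borel_measurable_continuous_onI[OF assms])
  have i: "(\<lambda>x::real^'n. x) \<in> borel_measurable lebesgue"
    by (rule continuous_imp_lebesgue_measurable) (rule continuous_on_id)
  have [measurable]: "(fst :: (real^'n) \<times> (real^'n) \<Rightarrow> _) \<in> borel_measurable (lebesgue \<Otimes>\<^sub>M lebesgue)"
    using measurable_comp[OF measurable_fst i] by (simp add: o_def)
  have [measurable]: "(snd :: (real^'n) \<times> (real^'n) \<Rightarrow> _) \<in> borel_measurable (lebesgue \<Otimes>\<^sub>M lebesgue)"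
    using measurable_comp[OF measurable_snd i] by (simp add: o_def)
  show ?thesis by measurable
qed

text \<open>Convolution with an even kernel is self-adjoint. Boundedness of the kernel gives the
  integrable majorant \<open>B * (\<psi> x * g y)\<close> on the product, which Fubini
  requires.\<close>

lemma conv_Fubini:
  fixes g \<psi> :: "real^'n::finite \<Rightarrow> real"
  assumes "test_function S \<rho>" "integrable lebesgue g" "test_function T \<psi>" and even: "\<And>x. \<rho> (- x) = \<rho> x"
  shows "(LINT x|lebesgue. conv \<rho> g x * \<psi> x) = (LINT y|lebesgue. g y * conv \<rho> \<psi> y)"
proof -
  obtain B where B: "\<And>x. \<bar>\<rho> x\<bar> \<le> B" using test_function_bounded[OF assms(1)] by (metis real_norm_def)
  have g[measurable]: "g \<in> borel_measurable lebesgue" using assms(2) by simp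
  have \<psi>[measurable]: "\<psi> \<in> borel_measurable lebesgue" using assms(3) by (rule test_function_measurable)
  have \<rho>m[measurable]: "(\<lambda>p. \<rho> (fst p - snd p)) \<in> borel_measurable (lebesgue \<Otimes>\<^sub>M lebesgue)"
    by (rule lebesgue_pair_measurable_diff[OF test_function_continuous[OF assms(1)]])
  have m: "(\<lambda>(x, y). \<rho> (x - y) * g y * \<psi> x) \<in> borel_measurable (lebesgue \<Otimes>\<^sub>M lebesgue)"
    unfolding case_prod_beta using \<rho>m by (intro borel_measurable_times) measurable
  have i\<psi>: "integrable lebesgue \<psi>" by (rule integrable_test_function[OF assms(3)])
  have "integrable (lebesgue \<Otimes>\<^sub>M lebesgue) (\<lambda>(x, y). \<psi> x * g y)"
    using i\<psi> assms(2)
    by (intro lebesgue_pair.Fubini_integrable) (auto simp: abs_mult)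
  then have "integrable (lebesgue \<Otimes>\<^sub>M lebesgue) (\<lambda>(x, y). \<rho> (x - y) * g y * \<psi> x)"
  proof (rule Bochner_Integration.integrable_bound[OF integrable_mult_right[where c=B] m])
    have "\<bar>\<rho> (x - y) * g y * \<psi> x\<bar> \<le> \<bar>B * (\<psi> x * g y)\<bar>" for x y
    proof -
      have "\<bar>\<rho> (x - y)\<bar> * \<bar>g y * \<psi> x\<bar> \<le> \<bar>B\<bar> * \<bar>g y * \<psi> x\<bar>"
        using B[of "x - y"] by (intro mult_right_mono) auto
      then show ?thesis by (simp add: abs_mult mult_ac)
    qed
    then show "AE x in lebesgue \<Otimes>\<^sub>M lebesgue. norm (case x of (x, y) \<Rightarrow> \<rho> (x - y) * g y * \<psi> x)
        \<le> norm (B * (case x of (x, y) \<Rightarrow> \<psi> x * g y))"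
      by auto
  qed
  from lebesgue_pair.Fubini_integral[OF this]
  have "(LINT y|lebesgue. LINT x|lebesgue. \<rho> (x - y) * g y * \<psi> x)
      = (LINT x|lebesgue. LINT y|lebesgue. \<rho> (x - y) * g y * \<psi> x)" .
  moreover have "(\<lambda>x. LINT y|lebesgue. \<rho> (x - y) * g y * \<psi> x) = (\<lambda>x. conv \<rho> g x * \<psi> x)"
    by (rule ext) (simp add: conv_def)
  moreover have "(\<lambda>y. LINT x|lebesgue. \<rho> (x - y) * g y * \<psi> x) = (\<lambda>y. g y * conv \<rho> \<psi> y)"
  proof
    fix y
    have "(\<lambda>x. \<rho> (x - y) * g y * \<psi> x) = (\<lambda>x. g y * (\<rho> (y - x) * \<psi> x))"
      using even[of "_ - y"] by (auto simp: mult_ac)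
    then show "(LINT x|lebesgue. \<rho> (x - y) * g y * \<psi> x) = g y * conv \<rho> \<psi> y"
      by (simp add: conv_def)
  qed
  ultimately show ?thesis by metis
qed

lemma conv_bounded_linear:
  assumes "bounded_linear T" "test_function S \<rho>" "integrable lebesgue g"
  shows "T (conv \<rho> g x) = conv \<rho> (\<lambda>y. T (g y)) x"
proof -
  interpret bounded_linear T by fact
  show ?thesis unfolding conv_def
    by (subst integral_bounded_linear[OF assms(1) integrable_conv[OF assms(2,3)], symmetric]) (simp add: scaleR)
qed


lemma integral_lebesgue_reflect:
  fixes f :: "'a::euclidean_space \<Rightarrow> real"
  assumes "continuous_on UNIV f"
  shows "(LINT y|lebesgue. f (x - y)) = (LINT y|lebesgue. f y)"
  using integral_lebesgue_affine[OF assms, of "-1" x] by simp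

lemma conv_bound:
  fixes g :: "real^'n::finite \<Rightarrow> 'b::euclidean_space"
  assumes "test_function S \<rho>" "integrable lebesgue g" "\<And>x. norm (g x) \<le> B"
  shows "norm (conv \<rho> g x) \<le> B * (LINT y|lebesgue. \<bar>\<rho> y\<bar>)"
proof -
  have c: "continuous_on UNIV (\<lambda>x. \<bar>\<rho> x\<bar>)"
    using test_function_continuous[OF assms(1)] by (intro continuous_intros)
  obtain K where K: "compact K" "\<And>x. x \<notin> K \<Longrightarrow> \<rho> x = 0"
    using test_function_support[OF assms(1)] by blast
  obtain C where C: "\<And>x. norm (\<rho> x) \<le> C" using test_function_bounded[OF assms(1)] by blast
  have "compact ((\<lambda>y. x - y) ` K)" using K(1) by (intro compact_continuous_image continuous_intros)
  then have i: "integrable lebesgue (\<lambda>y. \<rho> (x - y))"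
  proof (intro integrable_compact_support[of _ "(\<lambda>y. x - y) ` K" C] compact_imp_bounded)
    show "\<rho> (x - y) = 0" if "y \<notin> (\<lambda>y. x - y) ` K" for y
      using that by (intro K(2)) (metis diff_diff_eq2 add_diff_cancel_left' image_eqI)
  qed (use C lebesgue_measurable_shift[OF assms(1)] in auto)
  have "norm (conv \<rho> g x) \<le> (LINT y|lebesgue. \<bar>\<rho> (x - y)\<bar> * B)"
    unfolding conv_def using i assms(3)
    by (intro Bochner_Integration.integral_norm_bound_integral integrable_conv[OF assms(1,2)])
       (auto intro!: mult_left_mono)
  also have "\<dots> = B * (LINT y|lebesgue. \<bar>\<rho> y\<bar>)"
    using integral_lebesgue_reflect[OF c, of x] by simp
  finally show ?thesis .
qed

section \<open>Normalized rescaled bumps as mollifiers\<close>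

lemma bump_eq_0: "1 \<le> norm x \<Longrightarrow> bump m x = 0"
  using mult_mono[of 1 "norm x" 1 "norm x"]
  by (simp add: bump_def flat_exp_def dot_square_norm power2_eq_square)

lemma test_function_bump: "test_function UNIV (bump m)"
  by (rule test_functionI[OF C_k_bump compact_cball[of 0 1] subset_UNIV]) (simp add: bump_eq_0)

lemma bump_nonneg: "0 \<le> bump m x"
  by (simp add: bump_def flat_exp_def)

text \<open>A nonnegative function with integral 0 vanishes almost everywhere, whereas the bump is
  positive on the open unit ball, which is not negligible.\<close>

lemma bump_integral_pos: "0 < (LINT x|lebesgue. bump 0 (x::real^'n::finite))"
proof -
  have i: "integrable lebesgue (bump 0 :: real^'n \<Rightarrow> real)"
    by (rule integrable_test_function[OF test_function_bump])
  have "(LINT x|lebesgue. bump 0 (x::real^'n)) \<noteq> 0"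
  proof
    assume "(LINT x|lebesgue. bump 0 (x::real^'n)) = 0"
    then have "AE x::real^'n in lebesgue. bump 0 x = 0"
      using integral_nonneg_eq_0_iff_AE[OF i] bump_nonneg by blast
    then have "AE x::real^'n in lebesgue. x \<notin> ball 0 1"
    proof (rule AE_mp, intro AE_I2 impI)
      fix x :: "real^'n" assume "bump 0 x = 0"
      then have "1 \<le> norm x * norm x" by (auto simp: bump_def flat_exp_def dot_square_norm power2_eq_square split: if_splits)
      then show "x \<notin> ball 0 1" using mult_strict_mono[of "norm x" 1 "norm x" 1] by auto
    qed
    then have "negligible (ball (0::real^'n) 1)"
      by (simp add: AE_iff_null negligible_iff_null_sets ball_def)
    then show False using open_not_negligible[of "ball (0::real^'n) 1"] by simp
  qed
  moreover have "(LINT x|lebesgue. bump 0 (x::real^'n)) \<ge> 0"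
    by (simp add: bump_nonneg)
  ultimately show ?thesis by simp
qed

definition mollifier :: "real \<Rightarrow> real^'n::finite \<Rightarrow> real"
  where "mollifier d x = (inverse d ^ CARD('n) / (LINT y|lebesgue. bump 0 (y::real^'n))) * bump 0 (inverse d *\<^sub>R x)"

text \<open>Rescaling keeps the mass at 1 while the L1 norm of each partial derivative becomes a
  dimensional constant divided by \<open>d\<close>. The latter is the source of the bound
  \<open>C / (t - s)\<close> for the gradients of cutoffs.\<close>

lemma
  fixes d :: real
  assumes d: "d > 0"
  shows mollifier_nonneg: "0 \<le> mollifier d (x::real^'n::finite)"
    and mollifier_even: "mollifier d (- x) = mollifier d x"
    and mollifier_support: "d \<le> norm x \<Longrightarrow> mollifier d x = 0"
    and test_function_mollifier: "test_function UNIV (mollifier d :: real^'n \<Rightarrow> real)"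
    and mollifier_integral: "(LINT x|lebesgue. mollifier d (x::real^'n)) = 1"
    and mollifier_partial_integral: "(LINT x|lebesgue. \<bar>partial_deriv j (mollifier d) (x::real^'n)\<bar>)
      = (LINT x|lebesgue. \<bar>partial_deriv j (bump 0) (x::real^'n)\<bar>) / (LINT x|lebesgue. bump 0 (x::real^'n)) / d"
proof -
  note c = bump_integral_pos[where 'n='n]
  show "0 \<le> mollifier d x" unfolding mollifier_def
    using d c bump_nonneg by (intro mult_nonneg_nonneg divide_nonneg_pos zero_le_power) auto
  show "mollifier d (- x) = mollifier d x" by (simp add: mollifier_def bump_def)
  show sup: "mollifier d x = 0" if "d \<le> norm x" for x :: "real^'n"
  proof -
    have "1 \<le> norm (inverse d *\<^sub>R x)" using that d by (simp add: field_simps)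
    then show ?thesis by (simp add: mollifier_def bump_eq_0)
  qed
  show "test_function UNIV (mollifier d :: real^'n \<Rightarrow> real)"
  proof (rule test_functionI[OF _ compact_cball[of 0 d] subset_UNIV])
    show "C_k k (mollifier d :: real^'n \<Rightarrow> real)" for k
      unfolding mollifier_def[abs_def] by (rule C_k_cmult[OF C_k_scale[OF C_k_bump]])
  qed (simp add: sup)
  show "(LINT x|lebesgue. mollifier d (x::real^'n)) = 1"
    using integral_lebesgue_affine[OF test_function_continuous[OF test_function_bump], of "inverse d" 0 0] c d
    by (simp add: mollifier_def)
  let ?k = "inverse d ^ CARD('n) / (LINT y|lebesgue. bump 0 (y::real^'n))"
  have "partial_deriv j (mollifier d) x = ?k * (inverse d * partial_deriv j (bump 0) (inverse d *\<^sub>R x))" for x :: "real^'n"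
  proof -
    have "partial_deriv j (\<lambda>x. ?k * bump 0 (inverse d *\<^sub>R x)) x
      = ?k * partial_deriv j (\<lambda>x. bump 0 (inverse d *\<^sub>R x)) x + partial_deriv j (\<lambda>_. ?k) x * bump 0 (inverse d *\<^sub>R x)"
      by (rule partial_deriv_mult)
         (auto intro!: partial_deriv_scale(2) test_function_differentiable[OF test_function_bump])
    also have "partial_deriv j (\<lambda>_. ?k) x = 0"
      by (subst partial_deriv_eq[OF has_derivative_const]) simp
    also have "partial_deriv j (\<lambda>x. bump 0 (inverse d *\<^sub>R x)) x = inverse d * partial_deriv j (bump 0) (inverse d *\<^sub>R x)"
      by (subst partial_deriv_scale(1)) (auto intro: test_function_differentiable[OF test_function_bump])
    finally show ?thesis by (simp add: mollifier_def[abs_def])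
  qed
  then have "(LINT x|lebesgue. \<bar>partial_deriv j (mollifier d) (x::real^'n)\<bar>)
    = ?k * inverse d * (LINT x|lebesgue. \<bar>partial_deriv j (bump 0) (inverse d *\<^sub>R (x::real^'n))\<bar>)"
    using c d by (simp add: abs_mult mult_ac)
  moreover have "continuous_on UNIV (\<lambda>x::real^'n. \<bar>partial_deriv j (bump 0) x\<bar>)"
    using test_function_continuous[OF test_function_partial[OF test_function_bump]] by (intro continuous_intros)
  ultimately show "(LINT x|lebesgue. \<bar>partial_deriv j (mollifier d) (x::real^'n)\<bar>)
      = (LINT x|lebesgue. \<bar>partial_deriv j (bump 0) (x::real^'n)\<bar>) / (LINT x|lebesgue. bump 0 (x::real^'n)) / d"
    using integral_lebesgue_affine[of "\<lambda>x::real^'n. \<bar>partial_deriv j (bump 0) x\<bar>" "inverse d" 0] c d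
    by (simp add: divide_inverse mult_ac)
qed

subsection \<open>Convergence of mollifications in \<open>L\<^sup>2\<close>\<close>

text \<open>The radial retraction onto the closed ball of radius \<open>N\<close>; writing it with
  \<open>max\<close> instead of a case distinction makes continuity immediate.\<close>

definition radial_trunc :: "real \<Rightarrow> 'a::real_normed_vector \<Rightarrow> 'a"
  where "radial_trunc N v = (N / max N (norm v)) *\<^sub>R v"

lemma
  fixes v :: "'a::real_normed_vector"
  assumes N: "N > 0"
  shows radial_trunc_id: "norm v \<le> N \<Longrightarrow> radial_trunc N v = v"
    and norm_radial_trunc: "norm (radial_trunc N v) \<le> N"
    and norm_radial_trunc_diff: "norm (v - radial_trunc N v) \<le> norm v"
    and continuous_radial_trunc: "continuous_on UNIV (radial_trunc N :: 'a \<Rightarrow> 'a)"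
proof -
  show "norm v \<le> N \<Longrightarrow> radial_trunc N v = v" using N by (simp add: radial_trunc_def max_def)
  show "norm (radial_trunc N v) \<le> N"
    using N by (cases "norm v \<le> N") (auto simp: radial_trunc_def max_def)
  have "v - radial_trunc N v = (1 - N / max N (norm v)) *\<^sub>R v"
    by (simp add: radial_trunc_def scaleR_diff_left)
  moreover have "0 \<le> N / max N (norm v)" "N / max N (norm v) \<le> 1"
    using N by (auto simp: max_def divide_le_eq_1)
  then have "\<bar>1 - N / max N (norm v)\<bar> \<le> 1" by linarith
  ultimately show "norm (v - radial_trunc N v) \<le> norm v" by (simp add: mult_left_le_one_le)
  have "max N (norm v) \<noteq> 0" for v :: 'a using N by (metis less_max_iff_disj less_irrefl)
  then show "continuous_on UNIV (radial_trunc N :: 'a \<Rightarrow> 'a)"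
    unfolding radial_trunc_def by (intro continuous_intros) auto
qed

lemma norm_add_sq_le: "(norm (a + b))\<^sup>2 \<le> 2 * (norm a)\<^sup>2 + 2 * (norm (b::'a::real_inner))\<^sup>2"
proof -
  have "(norm (a + b))\<^sup>2 + (norm (a - b))\<^sup>2 = 2 * (norm a)\<^sup>2 + 2 * (norm b)\<^sup>2"
    by (simp add: power2_norm_eq_inner inner_simps inner_commute)
  then show ?thesis by (smt (verit) zero_le_power2)
qed

lemma norm_add3_sq_le: "(norm (a + b + c))\<^sup>2 \<le> 3 * ((norm a)\<^sup>2 + (norm b)\<^sup>2 + (norm (c::'a::real_inner))\<^sup>2)"
proof -
  have "(norm (a + b + c))\<^sup>2 + (norm (a - b))\<^sup>2 + (norm (a - c))\<^sup>2 + (norm (b - c))\<^sup>2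
      = 3 * ((norm a)\<^sup>2 + (norm b)\<^sup>2 + (norm c)\<^sup>2)"
    by (simp add: power2_norm_eq_inner inner_simps inner_commute)
  then show ?thesis by (smt (verit) zero_le_power2)
qed

text \<open>Continuous functions converging to \<open>g\<close> almost everywhere exist but carry no
  bound. Truncating both them and \<open>g\<close> at a fixed level supplies a constant majorant,
  integrable on the ball, for dominated convergence. The truncation of \<open>g\<close> and the
  approximation of the truncated \<open>g\<close> cost \<open>e / 4\<close> each, and the square of
  the sum doubles both.\<close>

lemma L2_approx_continuous:
  fixes g :: "'a::euclidean_space \<Rightarrow> 'b::euclidean_space"
  assumes g[measurable]: "g \<in> borel_measurable lebesgue"
    and g2: "integrable lebesgue (\<lambda>x. (norm (g x))\<^sup>2)" and e: "e > 0"
  shows "\<exists>h. continuous_on UNIV h \<and> (\<integral>\<^sup>+x\<in>ball 0 R. ennreal ((norm (g x - h x))\<^sup>2) \<partial>lebesgue) \<le> ennreal e"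
proof -
  let ?T = "\<lambda>N. radial_trunc (real (Suc N)) :: 'b \<Rightarrow> 'b"
  have Tb[measurable]: "?T N \<in> borel_measurable borel" for N
    by (intro borel_measurable_continuous_onI continuous_radial_trunc) simp
  have "(\<lambda>N. LINT x|lebesgue. (norm (g x - ?T N (g x)))\<^sup>2) \<longlonglongrightarrow> (LINT x|(lebesgue::'a measure). 0)"
  proof (rule integral_dominated_convergence[OF _ _ g2])
    show "AE x in lebesgue. (\<lambda>N. (norm (g x - ?T N (g x)))\<^sup>2) \<longlonglongrightarrow> 0"
    proof (rule AE_I2)
      fix x
      obtain N0 where N0: "norm (g x) \<le> real N0" using real_arch_simple by blast
      have "\<forall>\<^sub>F N in sequentially. (norm (g x - ?T N (g x)))\<^sup>2 = 0"
        using eventually_ge_at_top[of N0]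
      proof eventually_elim
        case (elim N)
        then have "norm (g x) \<le> real (Suc N)" using N0 by simp
        then show ?case by (subst radial_trunc_id) auto
      qed
      then show "(\<lambda>N. (norm (g x - ?T N (g x)))\<^sup>2) \<longlonglongrightarrow> 0" by (rule tendsto_eventually)
    qed
    show "AE x in lebesgue. norm ((norm (g x - ?T N (g x)))\<^sup>2) \<le> (norm (g x))\<^sup>2" for N
      by (auto intro!: AE_I2 power_mono norm_radial_trunc_diff)
  qed measurable
  then have "\<forall>\<^sub>F N in sequentially. (LINT x|lebesgue. (norm (g x - ?T N (g x)))\<^sup>2) < e / 4"
    using e by (intro order_tendstoD) auto
  from eventually_happens'[OF sequentially_bot this] obtain N where N: "(LINT x|lebesgue. (norm (g x - ?T N (g x)))\<^sup>2) < e / 4"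
    by blast
  let ?B = "ball (0::'a) R"
  obtain Z G where Z: "negligible Z" and G: "\<And>n. continuous_on UNIV (G n)"
    and lim: "\<And>x. x \<notin> Z \<Longrightarrow> (\<lambda>n. G n x) \<longlonglongrightarrow> g x"
    using lebesgue_measurable_imp_measurable_on[of g UNIV] by (auto simp: measurable_on_def)
  have Gm[measurable]: "G n \<in> borel_measurable lebesgue" for n
    by (rule continuous_imp_lebesgue_measurable[OF G])
  have [measurable]: "?B \<in> sets lebesgue" by simp
  have [measurable]: "(\<lambda>x. ?T N (g x)) \<in> borel_measurable lebesgue"
    by (rule measurable_compose[OF g Tb])
  have [measurable]: "(\<lambda>x. ?T N (G n x)) \<in> borel_measurable lebesgue" for n
    by (rule measurable_compose[OF Gm Tb])
  have iB: "integrable lebesgue (\<lambda>x. indicator ?B x * (2 * real (Suc N))\<^sup>2)"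
    using emeasure_bounded_finite[OF bounded_ball, of 0 R]
    by (intro integrable_mult_left integrable_real_indicator) auto
  have bd: "indicator ?B x * (norm (?T N (g x) - ?T N (G n x)))\<^sup>2 \<le> indicator ?B x * (2 * real (Suc N))\<^sup>2" for n x
  proof -
    have "norm (?T N (g x) - ?T N (G n x)) \<le> 2 * real (Suc N)"
      using norm_triangle_ineq4[of "?T N (g x)" "?T N (G n x)"]
        norm_radial_trunc[of "real (Suc N)" "g x"] norm_radial_trunc[of "real (Suc N)" "G n x"] by simp
    then have "(norm (?T N (g x) - ?T N (G n x)))\<^sup>2 \<le> (2 * real (Suc N))\<^sup>2" by (intro power_mono) auto
    then show ?thesis by (simp add: indicator_def)
  qed
  have "(\<lambda>n. LINT x|lebesgue. indicator ?B x * (norm (?T N (g x) - ?T N (G n x)))\<^sup>2) \<longlonglongrightarrow> (LINT x|(lebesgue::'a measure). 0)"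
  proof (rule integral_dominated_convergence[OF _ _ iB])
    have "AE x in lebesgue. x \<notin> Z" using Z by (simp add: negligible_iff_null_sets AE_not_in)
    then show "AE x in lebesgue. (\<lambda>n. indicator ?B x * (norm (?T N (g x) - ?T N (G n x)))\<^sup>2) \<longlonglongrightarrow> 0"
    proof eventually_elim
      case (elim x)
      have "isCont (?T N) (g x)"
        using continuous_radial_trunc[of "real (Suc N)", where 'a='b]
        by (simp add: continuous_on_eq_continuous_at del: of_nat_Suc)
      then have "(\<lambda>n. ?T N (G n x)) \<longlonglongrightarrow> ?T N (g x)"
        using lim[OF elim] by (rule isCont_tendsto_compose)
      then show ?case by (auto intro!: tendsto_eq_intros)
    qed
    show "AE x in lebesgue. norm (indicator ?B x * (norm (?T N (g x) - ?T N (G n x)))\<^sup>2)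
        \<le> indicator ?B x * (2 * real (Suc N))\<^sup>2" for n
      using bd by auto
  qed measurable
  then have "\<forall>\<^sub>F n in sequentially. (LINT x|lebesgue. indicator ?B x * (norm (?T N (g x) - ?T N (G n x)))\<^sup>2) < e / 4"
    using e by (intro order_tendstoD) auto
  from eventually_happens'[OF sequentially_bot this] obtain n where n: "(LINT x|lebesgue. indicator ?B x * (norm (?T N (g x) - ?T N (G n x)))\<^sup>2) < e / 4"
    by blast
  let ?h = "\<lambda>x. ?T N (G n x)"
  have ch: "continuous_on UNIV ?h"
    by (intro continuous_on_compose2[OF continuous_radial_trunc G]) auto
  have i1: "integrable lebesgue (\<lambda>x. (norm (g x - ?T N (g x)))\<^sup>2)"
  proof (rule Bochner_Integration.integrable_bound[OF g2])
    show "AE x in lebesgue. norm ((norm (g x - ?T N (g x)))\<^sup>2) \<le> norm ((norm (g x))\<^sup>2)"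
      by (auto intro!: AE_I2 power_mono norm_radial_trunc_diff)
  qed measurable
  have i2: "integrable lebesgue (\<lambda>x. indicator ?B x * (norm (?T N (g x) - ?h x))\<^sup>2)"
  proof (rule Bochner_Integration.integrable_bound[OF iB])
    show "AE x in lebesgue. norm (indicator ?B x * (norm (?T N (g x) - ?h x))\<^sup>2)
        \<le> norm (indicator ?B x * (2 * real (Suc N))\<^sup>2)"
      using bd by auto
  qed measurable
  let ?F = "\<lambda>x. 2 * (norm (g x - ?T N (g x)))\<^sup>2 + 2 * (indicator ?B x * (norm (?T N (g x) - ?h x))\<^sup>2)"
  have iF: "integrable lebesgue ?F" using i1 i2 by simp
  have "(\<integral>\<^sup>+x\<in>?B. ennreal ((norm (g x - ?h x))\<^sup>2) \<partial>lebesgue) \<le> (\<integral>\<^sup>+x. ennreal (?F x) \<partial>lebesgue)"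
  proof (rule nn_integral_mono)
    fix x
    show "ennreal ((norm (g x - ?h x))\<^sup>2) * indicator ?B x \<le> ennreal (?F x)"
      using norm_add_sq_le[of "g x - ?T N (g x)" "?T N (g x) - ?h x"]
      by (cases "x \<in> ?B") (auto intro!: ennreal_leI simp del: of_nat_Suc ennreal_plus)
  qed
  also have "\<dots> = ennreal (LINT x|lebesgue. ?F x)" by (rule nn_integral_eq_integral[OF iF]) simp
  also have "(LINT x|lebesgue. ?F x) = 2 * (LINT x|lebesgue. (norm (g x - ?T N (g x)))\<^sup>2)
      + 2 * (LINT x|lebesgue. indicator ?B x * (norm (?T N (g x) - ?h x))\<^sup>2)"
    using i1 i2 by simp
  also have "ennreal \<dots> \<le> ennreal e" using N n by (intro ennreal_leI) linarith
  finally show ?thesis using ch by blast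
qed

lemma integrable_mollifier_shift:
  assumes "d > 0" shows "integrable lebesgue (\<lambda>y::real^'n::finite. mollifier d (x - y))"
    and "(LINT y|lebesgue. mollifier d (x - (y::real^'n))) = 1"
proof -
  show *: "(LINT y|lebesgue. mollifier d (x - (y::real^'n))) = 1"
    using integral_lebesgue_reflect[OF test_function_continuous[OF test_function_mollifier[OF assms]], of x]
      mollifier_integral[OF assms, where 'n='n] by simp
  \<comment> \<open>The Bochner integral of a non-integrable function is 0 by convention, so the
    value 1 already forces integrability.\<close>
  then show "integrable lebesgue (\<lambda>y::real^'n. mollifier d (x - y))"
    using not_integrable_integral_eq by fastforce
qed

lemma mollifier_abs_integral:
  assumes "d > 0" shows "(LINT x|lebesgue. \<bar>mollifier d (x::real^'n::finite)\<bar>) = 1"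
  by (simp only: abs_of_nonneg[OF mollifier_nonneg[OF assms]] mollifier_integral[OF assms])

lemma nn_integral_mollifier:
  fixes x :: "real^'n::finite"
  assumes "d > 0"
  shows "(\<integral>\<^sup>+y. ennreal (mollifier d (x - y)) \<partial>lebesgue) = 1"
    and "(\<integral>\<^sup>+y. ennreal (mollifier d (y - x)) \<partial>lebesgue) = 1"
proof -
  show *: "(\<integral>\<^sup>+y. ennreal (mollifier d (x - y)) \<partial>lebesgue) = 1"
    using integrable_mollifier_shift[OF assms, of x] mollifier_nonneg[OF assms]
    by (subst nn_integral_eq_integral) auto
  have "mollifier d (y - x) = mollifier d (x - y)" for y
    using mollifier_even[OF assms, of "x - y"] by simp
  then show "(\<integral>\<^sup>+y. ennreal (mollifier d (y - x)) \<partial>lebesgue) = 1" using * by simp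
qed

text \<open>Jensen's inequality by a variance argument. For the weight \<open>?\<rho>\<close> of
  mass 1 with mean \<open>m\<close>, the weighted second moment about \<open>k\<close> is
  \<open>S - 2 * (m \<bullet> k) + |k|^2\<close>. At \<open>k = m\<close> nonnegativity gives
  \<open>|m|^2 <= S\<close>, and inserting this at \<open>k = c\<close> gives the claim.\<close>

lemma conv_mollifier_Jensen:
  fixes g :: "real^'n::finite \<Rightarrow> 'b::euclidean_space"
  assumes d: "d > 0" and g: "integrable lebesgue g" and g2: "integrable lebesgue (\<lambda>y. (norm (g y))\<^sup>2)"
  shows "ennreal ((norm (conv (mollifier d) g x - c))\<^sup>2)
      \<le> (\<integral>\<^sup>+y. ennreal (mollifier d (x - y) * (norm (g y - c))\<^sup>2) \<partial>lebesgue)"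
proof -
  let ?\<rho> = "\<lambda>y. mollifier d (x - y)"
  note t = test_function_mollifier[OF d, where 'n='n]
  have i1: "integrable lebesgue (\<lambda>y. ?\<rho> y *\<^sub>R g y)" by (rule integrable_conv[OF t g])
  have i2: "integrable lebesgue (\<lambda>y. ?\<rho> y * (norm (g y))\<^sup>2)" using integrable_conv[OF t g2, of x] by simp
  note i0 = integrable_mollifier_shift[OF d, of x]
  define S where "S = (LINT y|lebesgue. ?\<rho> y * (norm (g y))\<^sup>2)"
  define m where "m = conv (mollifier d) g x"
  have eq: "?\<rho> y * (norm (g y - k))\<^sup>2 = ?\<rho> y * (norm (g y))\<^sup>2 - 2 * ((?\<rho> y *\<^sub>R g y) \<bullet> k) + (norm k)\<^sup>2 * ?\<rho> y" for y k
    by (simp add: power2_norm_eq_inner inner_simps inner_commute algebra_simps)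
  have I: "integrable lebesgue (\<lambda>y. ?\<rho> y * (norm (g y - k))\<^sup>2)" for k
    unfolding eq by (intro Bochner_Integration.integrable_add Bochner_Integration.integrable_diff
        integrable_mult_right integrable_inner_left i0(1) i1 i2)
  have Q: "(LINT y|lebesgue. ?\<rho> y * (norm (g y - k))\<^sup>2) = S - 2 * (m \<bullet> k) + (norm k)\<^sup>2" for k
    unfolding eq using i0 i1 i2 integrable_inner_left[of k, OF i1]
    by (simp add: S_def m_def conv_def del: inner_scaleR_left)
  have "0 \<le> (LINT y|lebesgue. ?\<rho> y * (norm (g y - m))\<^sup>2)"
    by (simp add: mollifier_nonneg[OF d])
  then have "(norm (m - c))\<^sup>2 \<le> (LINT y|lebesgue. ?\<rho> y * (norm (g y - c))\<^sup>2)"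
    unfolding Q by (simp add: power2_norm_eq_inner inner_simps inner_commute)
  then have "ennreal ((norm (m - c))\<^sup>2) \<le> ennreal (LINT y|lebesgue. ?\<rho> y * (norm (g y - c))\<^sup>2)"
    by (rule ennreal_leI)
  also have "\<dots> = (\<integral>\<^sup>+y. ennreal (?\<rho> y * (norm (g y - c))\<^sup>2) \<partial>lebesgue)"
    by (intro nn_integral_eq_integral[symmetric] I) (simp add: mollifier_nonneg[OF d])
  finally show ?thesis by (simp add: m_def)
qed


text \<open>After Jensen, \<open>g y - g x\<close> is split through a continuous \<open>h\<close>
  into three differences. The two between \<open>g\<close> and \<open>h\<close> integrate to L2
  distances because the kernel has mass 1 in either variable; the one between values of
  \<open>h\<close> is small by uniform continuity. Each contributes \<open>e / 9\<close>: there are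
  three terms and the square of a sum of three costs another factor 3.\<close>

lemma mollifier_L2_tendsto:
  fixes g :: "real^'n::finite \<Rightarrow> 'b::euclidean_space"
  assumes g: "integrable lebesgue g" and g2: "integrable lebesgue (\<lambda>y. (norm (g y))\<^sup>2)"
    and supp: "\<And>x. R \<le> norm x \<Longrightarrow> g x = 0" and e: "e > 0"
  shows "\<exists>d0>0. \<forall>d. 0 < d \<and> d < d0 \<longrightarrow>
    (\<integral>\<^sup>+x. ennreal ((norm (conv (mollifier d) g x - g x))\<^sup>2) \<partial>lebesgue) \<le> ennreal e"
proof -
  \<comment> \<open>For \<open>d < 1\<close> both \<open>g\<close> and its mollification vanish
    outside \<open>B1\<close>, and every \<open>y\<close> within distance \<open>d\<close> of a
    point of \<open>B1\<close> lies in \<open>B2\<close>.\<close>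
  define B1 where "B1 = ball (0::real^'n) (\<bar>R\<bar> + 1)"
  define B2 where "B2 = ball (0::real^'n) (\<bar>R\<bar> + 2)"
  have [measurable]: "B1 \<in> sets lebesgue" "B2 \<in> sets lebesgue" by (auto simp: B1_def B2_def)
  have gm[measurable]: "g \<in> borel_measurable lebesgue" using g by simp
  obtain h where h: "continuous_on UNIV h"
      "(\<integral>\<^sup>+x\<in>B2. ennreal ((norm (g x - h x))\<^sup>2) \<partial>lebesgue) \<le> ennreal (e / 9)"
    using L2_approx_continuous[OF gm g2, of "e / 9" "\<bar>R\<bar> + 2"] e unfolding B2_def by auto
  have [measurable]: "h \<in> borel_measurable lebesgue" by (rule continuous_imp_lebesgue_measurable[OF h(1)])
  define v where "v = measure lebesgue B1"
  have v: "v \<ge> 0" "emeasure lebesgue B1 = ennreal v"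
    using emeasure_bounded_finite[OF bounded_ball, of "0::real^'n" "\<bar>R\<bar> + 1"]
    by (auto simp: v_def B1_def emeasure_eq_ennreal_measure)
  define \<eta> where "\<eta> = sqrt (e / 9 / (v + 1))"
  have \<eta>: "\<eta> > 0" "\<eta>\<^sup>2 * v \<le> e / 9"
  proof -
    show "\<eta> > 0" using e v by (simp add: \<eta>_def)
    have "\<eta>\<^sup>2 * v = e / 9 * (v / (v + 1))" using e v by (simp add: \<eta>_def)
    also have "\<dots> \<le> e / 9 * 1" using e v by (intro mult_left_mono) auto
    finally show "\<eta>\<^sup>2 * v \<le> e / 9" by simp
  qed
  have "uniformly_continuous_on (cball 0 (\<bar>R\<bar> + 2)) h"
    by (rule compact_uniformly_continuous[OF continuous_on_subset[OF h(1)]]) auto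
  then obtain d1 where d1: "d1 > 0" "\<And>x y. x \<in> cball 0 (\<bar>R\<bar> + 2) \<Longrightarrow> y \<in> cball 0 (\<bar>R\<bar> + 2) \<Longrightarrow>
      dist y x < d1 \<Longrightarrow> dist (h y) (h x) < \<eta>"
    using \<eta>(1) unfolding uniformly_continuous_on_def by metis
  have main: "(\<integral>\<^sup>+x. ennreal ((norm (conv (mollifier d) g x - g x))\<^sup>2) \<partial>lebesgue) \<le> ennreal e"
    if d: "0 < d" "d < min d1 1" for d
  proof -
    let ?\<rho> = "mollifier d :: real^'n \<Rightarrow> real"
    \<comment> \<open>The three parts are kept as products in \<open>ennreal\<close>, so that
      Tonelli and additivity apply without integrability conditions.\<close>
    define E1 where "E1 x y = ennreal (?\<rho> (x - y)) * (ennreal ((norm (g y - h y))\<^sup>2) * indicator B2 y)" for x y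
    define E2 where "E2 x y = ennreal (?\<rho> (x - y)) * (ennreal (\<eta>\<^sup>2) * indicator B1 x)" for x y
    define E3 where "E3 x y = ennreal (?\<rho> (x - y)) * (ennreal ((norm (g x - h x))\<^sup>2) * indicator B1 x)" for x y
    note t = test_function_mollifier[OF d(1), where 'n='n]
    have [measurable]: "(\<lambda>y. ?\<rho> (x - y)) \<in> borel_measurable lebesgue" for x
      by (rule lebesgue_measurable_shift[OF t])
    have mp[measurable]: "(\<lambda>p. ?\<rho> (fst p - snd p)) \<in> borel_measurable (lebesgue \<Otimes>\<^sub>M lebesgue)"
      by (rule lebesgue_pair_measurable_diff[OF test_function_continuous[OF t]])
    have meas[measurable]: "E1 x \<in> borel_measurable lebesgue" "E2 x \<in> borel_measurable lebesgue"
      "E3 x \<in> borel_measurable lebesgue" for x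
      unfolding E1_def E2_def E3_def by measurable
    have pw: "ennreal (?\<rho> (x - y) * (norm (g y - g x))\<^sup>2) \<le> 3 * (E1 x y + E2 x y + E3 x y)"
      if x: "x \<in> B1" for x y
    proof (cases "norm (x - y) < d")
      case False
      then show ?thesis using mollifier_support[OF d(1), of "x - y"] by simp
    next
      case True
      have "norm y \<le> norm x + norm (x - y)" using norm_triangle_ineq4[of x "x - y"] by simp
      then have y: "y \<in> B2" using x True d by (auto simp: B1_def B2_def)
      have "dist (h y) (h x) < \<eta>"
        using x y True d by (intro d1) (auto simp: B1_def B2_def dist_norm norm_minus_commute)
      then have "(norm (h y - h x))\<^sup>2 \<le> \<eta>\<^sup>2" by (intro power_mono) (auto simp: dist_norm)
      then have "(norm (g y - g x))\<^sup>2 \<le> 3 * ((norm (g y - h y))\<^sup>2 + \<eta>\<^sup>2 + (norm (g x - h x))\<^sup>2)"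
        using norm_add3_sq_le[of "g y - h y" "h y - h x" "h x - g x"] by (simp add: norm_minus_commute)
      then have "?\<rho> (x - y) * (norm (g y - g x))\<^sup>2
          \<le> ?\<rho> (x - y) * (3 * ((norm (g y - h y))\<^sup>2 + \<eta>\<^sup>2 + (norm (g x - h x))\<^sup>2))"
        by (intro mult_left_mono mollifier_nonneg[OF d(1)])
      then have "ennreal (?\<rho> (x - y) * (norm (g y - g x))\<^sup>2)
          \<le> ennreal (?\<rho> (x - y) * (3 * ((norm (g y - h y))\<^sup>2 + \<eta>\<^sup>2 + (norm (g x - h x))\<^sup>2)))"
        by (rule ennreal_leI)
      also have "\<dots> = 3 * (E1 x y + E2 x y + E3 x y)"
        using x y mollifier_nonneg[OF d(1), of "x - y"]
        by (simp add: E1_def E2_def E3_def ennreal_mult ennreal_plus algebra_simps)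
      finally show ?thesis .
    qed
    have "ennreal ((norm (conv ?\<rho> g x - g x))\<^sup>2) \<le> (\<integral>\<^sup>+y. 3 * (E1 x y + E2 x y + E3 x y) \<partial>lebesgue)" for x
    proof (cases "x \<in> B1")
      case True
      have "ennreal ((norm (conv ?\<rho> g x - g x))\<^sup>2) \<le> (\<integral>\<^sup>+y. ennreal (?\<rho> (x - y) * (norm (g y - g x))\<^sup>2) \<partial>lebesgue)"
        by (rule conv_mollifier_Jensen[OF d(1) g g2])
      also have "\<dots> \<le> (\<integral>\<^sup>+y. 3 * (E1 x y + E2 x y + E3 x y) \<partial>lebesgue)"
        by (intro nn_integral_mono pw True)
      finally show ?thesis .
    next
      case False
      have "conv ?\<rho> g x = 0"
      proof (rule conv_support[OF mollifier_support[OF d(1)]])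
        fix y assume "y \<in> ball x d"
        moreover have "norm x \<le> norm y + norm (x - y)" using norm_triangle_ineq[of y "x - y"] by simp
        ultimately show "g y = 0" using False d by (intro supp) (auto simp: B1_def dist_norm)
      qed simp
      moreover have "g x = 0" using False by (intro supp) (auto simp: B1_def)
      ultimately show ?thesis by simp
    qed
    then have "(\<integral>\<^sup>+x. ennreal ((norm (conv ?\<rho> g x - g x))\<^sup>2) \<partial>lebesgue)
        \<le> (\<integral>\<^sup>+x. (\<integral>\<^sup>+y. 3 * (E1 x y + E2 x y + E3 x y) \<partial>lebesgue) \<partial>lebesgue)"
      by (rule nn_integral_mono)
    also have "\<dots> = (\<integral>\<^sup>+x. 3 * ((\<integral>\<^sup>+y. E1 x y \<partial>lebesgue) + (\<integral>\<^sup>+y. E2 x y \<partial>lebesgue) + (\<integral>\<^sup>+y. E3 x y \<partial>lebesgue)) \<partial>lebesgue)"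
      by (simp add: nn_integral_cmult nn_integral_add)
    also have "(\<lambda>x. \<integral>\<^sup>+y. E2 x y \<partial>lebesgue) = (\<lambda>x. ennreal (\<eta>\<^sup>2) * indicator B1 x)"
      unfolding E2_def by (simp add: nn_integral_multc nn_integral_mollifier[OF d(1)])
    also have "(\<lambda>x. \<integral>\<^sup>+y. E3 x y \<partial>lebesgue) = (\<lambda>x. ennreal ((norm (g x - h x))\<^sup>2) * indicator B1 x)"
      unfolding E3_def by (simp add: nn_integral_multc nn_integral_mollifier[OF d(1)])
    also have "(\<integral>\<^sup>+x. 3 * ((\<integral>\<^sup>+y. E1 x y \<partial>lebesgue) + ennreal (\<eta>\<^sup>2) * indicator B1 x
          + ennreal ((norm (g x - h x))\<^sup>2) * indicator B1 x) \<partial>lebesgue)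
        = 3 * ((\<integral>\<^sup>+x. (\<integral>\<^sup>+y. E1 x y \<partial>lebesgue) \<partial>lebesgue) + ennreal (\<eta>\<^sup>2) * emeasure lebesgue B1
          + (\<integral>\<^sup>+x\<in>B1. ennreal ((norm (g x - h x))\<^sup>2) \<partial>lebesgue))"
    proof -
      have "case_prod E1 \<in> borel_measurable (lebesgue \<Otimes>\<^sub>M lebesgue)"
        unfolding E1_def case_prod_beta by measurable
      then have [measurable]: "(\<lambda>x. \<integral>\<^sup>+y. E1 x y \<partial>lebesgue) \<in> borel_measurable lebesgue"
        by (rule lebesgue.borel_measurable_nn_integral)
      show ?thesis by (simp add: nn_integral_cmult nn_integral_add)
    qed
    \<comment> \<open>This is the one part whose weight depends on \<open>y\<close>; the order of
      integration is exchanged so that the mass of the kernel can be taken in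
      \<open>x\<close>.\<close>
    also have "(\<integral>\<^sup>+x. (\<integral>\<^sup>+y. E1 x y \<partial>lebesgue) \<partial>lebesgue) = (\<integral>\<^sup>+y. (\<integral>\<^sup>+x. E1 x y \<partial>lebesgue) \<partial>lebesgue)"
      by (rule lebesgue_pair.Fubini'[symmetric]) (unfold E1_def case_prod_beta, measurable)
    also have "(\<lambda>y. \<integral>\<^sup>+x. E1 x y \<partial>lebesgue) = (\<lambda>y. ennreal ((norm (g y - h y))\<^sup>2) * indicator B2 y)"
    proof
      fix y
      have [measurable]: "(\<lambda>x. ?\<rho> (x - y)) \<in> borel_measurable lebesgue"
        by (intro continuous_imp_lebesgue_measurable
            continuous_on_compose2[OF test_function_continuous[OF t]] continuous_intros) auto
      show "(\<integral>\<^sup>+x. E1 x y \<partial>lebesgue) = ennreal ((norm (g y - h y))\<^sup>2) * indicator B2 y"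
        unfolding E1_def by (simp add: nn_integral_multc nn_integral_mollifier[OF d(1)])
    qed
    also have "(\<integral>\<^sup>+x\<in>B1. ennreal ((norm (g x - h x))\<^sup>2) \<partial>lebesgue) \<le> (\<integral>\<^sup>+x\<in>B2. ennreal ((norm (g x - h x))\<^sup>2) \<partial>lebesgue)"
      by (intro nn_integral_mono mult_left_mono) (auto simp: B1_def B2_def indicator_def)
    also have "3 * ((\<integral>\<^sup>+x\<in>B2. ennreal ((norm (g x - h x))\<^sup>2) \<partial>lebesgue) + ennreal (\<eta>\<^sup>2) * emeasure lebesgue B1
          + (\<integral>\<^sup>+x\<in>B2. ennreal ((norm (g x - h x))\<^sup>2) \<partial>lebesgue))
        \<le> 3 * (ennreal (e / 9) + ennreal (e / 9) + ennreal (e / 9))"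
      using h(2) \<eta>(2) v by (intro mult_left_mono add_mono) (auto simp: ennreal_mult'[symmetric] intro: ennreal_leI)
    also have "\<dots> = ennreal e"
      using e by (simp add: ennreal_plus[symmetric] ennreal_mult'[symmetric] del: ennreal_plus flip: ennreal_numeral)
    finally show ?thesis by (simp add: add_mono mult_left_mono)
  qed
  show ?thesis
    by (rule exI[of _ "min d1 1"]) (use d1 main in auto)
qed


section \<open>Mollifications as test functions, and the fundamental lemma\<close>

lemma compact_UN_cball:
  fixes K :: "'a::euclidean_space set"
  assumes "compact K" shows "compact (\<Union>x\<in>K. cball x d)"
proof -
  have "(\<Union>x\<in>K. cball x d) = {x + y |x y. x \<in> K \<and> y \<in> cball 0 d}"
  proof (intro set_eqI iffI)
    fix z assume "z \<in> (\<Union>x\<in>K. cball x d)"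
    then obtain x where "x \<in> K" "z - x \<in> cball 0 d" by (auto simp: dist_norm norm_minus_commute)
    then show "z \<in> {x + y |x y. x \<in> K \<and> y \<in> cball 0 d}" by (intro CollectI exI[of _ x] exI[of _ "z - x"]) auto
  next
    fix z assume "z \<in> {x + y |x y. x \<in> K \<and> y \<in> cball 0 d}"
    then obtain x y where "z = x + y" "x \<in> K" "norm y \<le> d" by auto
    then show "z \<in> (\<Union>x\<in>K. cball x d)" by (intro UN_I[of x]) (auto simp: dist_norm)
  qed
  then show ?thesis by (simp only: compact_sums[OF assms compact_cball])
qed

lemma test_function_conv:
  fixes g :: "real^'n::finite \<Rightarrow> 'b::euclidean_space"
  assumes d: "d > 0" and g: "integrable lebesgue g" and K: "compact K" "\<And>x. x \<notin> K \<Longrightarrow> g x = 0"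
    and S: "(\<Union>x\<in>K. cball x d) \<subseteq> S"
  shows "test_function S (conv (mollifier d) g)"
proof (rule test_functionI)
  show "C_k k (conv (mollifier d) g)" for k
    by (rule C_k_conv[OF test_function_mollifier[OF d] g])
  show "compact (\<Union>x\<in>K. cball x d)" by (rule compact_UN_cball[OF K(1)])
  show "(\<Union>x\<in>K. cball x d) \<subseteq> S" by fact
  fix x assume x: "x \<notin> (\<Union>x\<in>K. cball x d)"
  show "conv (mollifier d) g x = 0"
  proof (rule conv_support[OF mollifier_support[OF d]])
    fix y assume "y \<in> ball x d"
    then show "g y = 0" using x by (intro K(2)) (auto simp: dist_commute)
  qed simp
qed

lemma integrable_norm_sq_test_function:
  fixes f :: "real^'n::finite \<Rightarrow> 'b::euclidean_space"
  assumes "test_function S f" shows "integrable lebesgue (\<lambda>x. (norm (f x))\<^sup>2)"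
proof -
  obtain K where K: "compact K" "\<And>x. x \<notin> K \<Longrightarrow> f x = 0"
    using test_function_support[OF assms] by blast
  obtain B where B: "\<And>x. norm (f x) \<le> B" using test_function_bounded[OF assms] by blast
  have [measurable]: "f \<in> borel_measurable lebesgue" by (rule test_function_measurable[OF assms])
  show ?thesis
  proof (rule integrable_compact_support[OF _ compact_imp_bounded[OF K(1)], of _ "B\<^sup>2"])
    show "norm ((norm (f x))\<^sup>2) \<le> B\<^sup>2" for x using B[of x] by (simp add: power_mono)
  qed (use K in auto)
qed

lemma conv_mollifier_L2:
  fixes g :: "real^'n::finite \<Rightarrow> 'b::euclidean_space"
  assumes g: "integrable lebesgue g" and g2: "integrable lebesgue (\<lambda>y. (norm (g y))\<^sup>2)"
    and K: "compact K" "\<And>x. x \<notin> K \<Longrightarrow> g x = 0"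
  shows "d > 0 \<Longrightarrow> integrable lebesgue (\<lambda>x. (norm (conv (mollifier d) g x - g x))\<^sup>2)"
    and "((\<lambda>d. LINT x|lebesgue. (norm (conv (mollifier d) g x - g x))\<^sup>2) \<longlongrightarrow> 0) (at_right 0)"
proof -
  show "integrable lebesgue (\<lambda>x. (norm (conv (mollifier d) g x - g x))\<^sup>2)" if d: "d > 0" for d
  proof -
    have t: "test_function UNIV (conv (mollifier d) g)" by (rule test_function_conv[OF d g K]) auto
    have [measurable]: "conv (mollifier d) g \<in> borel_measurable lebesgue" "g \<in> borel_measurable lebesgue"
      using test_function_measurable[OF t] g by auto
    show ?thesis
    proof (rule Bochner_Integration.integrable_bound)
      show "integrable lebesgue (\<lambda>x. 2 * (norm (conv (mollifier d) g x))\<^sup>2 + 2 * (norm (- g x))\<^sup>2)"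
        using integrable_norm_sq_test_function[OF t] g2 by simp
      show "AE x in lebesgue. norm ((norm (conv (mollifier d) g x - g x))\<^sup>2)
          \<le> norm (2 * (norm (conv (mollifier d) g x))\<^sup>2 + 2 * (norm (- g x))\<^sup>2)"
        using norm_add_sq_le[of "conv (mollifier d) g _" "- g _"] by auto
    qed measurable
  qed
  obtain R where R: "\<And>x. x \<in> K \<Longrightarrow> norm x < R"
    using compact_imp_bounded[OF K(1)] by (auto simp: bounded_pos_less)
  have supp: "g x = 0" if "R \<le> norm x" for x using R[of x] that by (intro K(2)) auto
  show "((\<lambda>d. LINT x|lebesgue. (norm (conv (mollifier d) g x - g x))\<^sup>2) \<longlongrightarrow> 0) (at_right 0)"
  proof (rule order_tendstoI)
    fix a :: real assume "a < 0"
    then show "\<forall>\<^sub>F d in at_right 0. a < (LINT x|lebesgue. (norm (conv (mollifier d) g x - g x))\<^sup>2)"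
      by (intro always_eventually allI) (rule less_le_trans[of _ 0], auto)
  next
    fix e :: real assume e: "0 < e"
    obtain d0 where d0: "d0 > 0" "\<And>d. 0 < d \<Longrightarrow> d < d0 \<Longrightarrow>
        (\<integral>\<^sup>+x. ennreal ((norm (conv (mollifier d) g x - g x))\<^sup>2) \<partial>lebesgue) \<le> ennreal (e / 2)"
      using mollifier_L2_tendsto[where R=R and e="e / 2", OF g g2 supp] e by auto
    have "(LINT x|lebesgue. (norm (conv (mollifier d) g x - g x))\<^sup>2) < e" if "0 < d" "d < d0" for d
      using integral_real_bounded[OF _ d0(2)[OF that]] e by simp
    then show "\<forall>\<^sub>F d in at_right 0. (LINT x|lebesgue. (norm (conv (mollifier d) g x - g x))\<^sup>2) < e"
      using d0(1) by (auto simp: eventually_at_right_field)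
  qed
qed

lemma absolutely_integrable_on_indicator_iff: "f absolutely_integrable_on K \<longleftrightarrow> integrable lebesgue (\<lambda>x. indicator K x *\<^sub>R f x)"
  by (simp add: set_integrable_def)

lemma tendsto_divide_Suc_Suc_at_right: "\<delta> > 0 \<Longrightarrow> filterlim (\<lambda>k. \<delta> / real (Suc (Suc k))) (at_right 0) sequentially"
proof -
  assume "\<delta> > 0"
  moreover have "(\<lambda>k. \<delta> / real (Suc (Suc k))) \<longlonglongrightarrow> 0"
    using LIMSEQ_ignore_initial_segment[OF lim_const_over_n[of \<delta>], of 2] by simp
  ultimately show ?thesis by (auto simp: filterlim_at)
qed

text \<open>Test the equation against mollifications of \<open>sgn g\<close> restricted to a compact set.\<close>

lemma fundamental_lemma:
  fixes g :: "real^'n::finite \<Rightarrow> real"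
  assumes S: "open S" and g: "L1_loc S g"
    and zero: "\<And>\<phi>. test_function S \<phi> \<Longrightarrow> (LINT x:S|lebesgue. g x * \<phi> x) = 0"
  shows "AE x in lebesgue. x \<in> S \<longrightarrow> g x = 0"
proof -
  have main: "AE x in lebesgue. x \<in> K \<longrightarrow> g x = 0" if K: "compact K" "K \<subseteq> S" for K
  proof -
    obtain \<delta> where \<delta>: "\<delta> > 0" "(\<Union>x\<in>K. cball x \<delta>) \<subseteq> S"
      using compact_subset_open_imp_cball_epsilon_subset[OF K(1) S K(2)] by blast
    \<comment> \<open>All mollified signs used below are supported in \<open>K'\<close>. As they are
      bounded by 1, the restriction of \<open>g\<close> to \<open>K'\<close>, integrable by
      compactness, dominates every product.\<close>
    define K' where "K' = (\<Union>x\<in>K. cball x \<delta>)"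
    have K': "compact K'" "K' \<subseteq> S" "K \<subseteq> K'"
      using \<delta> compact_UN_cball[OF K(1)] by (auto simp: K'_def intro: less_imp_le)
    let ?G = "\<lambda>x. indicator K' x * g x"
    have G: "integrable lebesgue ?G" using g K' by (auto simp: L1_loc_def absolutely_integrable_on_indicator_iff)
    have gK: "integrable lebesgue (\<lambda>x. indicator K x * g x)"
      using g K by (auto simp: L1_loc_def absolutely_integrable_on_indicator_iff)
    define h where "h x = sgn (indicator K x * g x)" for x
    have hm[measurable]: "h \<in> borel_measurable lebesgue"
      unfolding h_def by (rule measurable_compose[OF borel_measurable_integrable[OF gK] borel_measurable_sgn])
    have h1: "\<bar>h x\<bar> \<le> 1" "x \<notin> K \<Longrightarrow> h x = 0" for x by (auto simp: h_def abs_sgn_eq)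
    have h: "integrable lebesgue h"
      by (rule integrable_compact_support[OF hm compact_imp_bounded[OF K(1)], of 1]) (use h1 in auto)
    have h2: "integrable lebesgue (\<lambda>x. (norm (h x))\<^sup>2)"
      by (rule integrable_compact_support[OF _ compact_imp_bounded[OF K(1)], of _ 1])
         (use h1 in \<open>auto simp: abs_square_le_1\<close>)
    let ?d = "\<lambda>k. \<delta> / real (Suc (Suc k))"
    let ?\<phi> = "\<lambda>k. conv (mollifier (?d k)) h"
    have d: "?d k > 0" "?d k \<le> \<delta>" for k using \<delta>(1) by (auto simp: field_simps)
    have t: "test_function K' (?\<phi> k)" for k
    proof (rule test_function_conv[OF d(1) h K(1) h1(2)])
      show "(\<Union>x\<in>K. cball x (?d k)) \<subseteq> K'"
        unfolding K'_def by (intro UN_mono subset_refl subset_cball d(2))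
    qed
    have i: "integrable lebesgue (\<lambda>x. (norm (?\<phi> k x - h x))\<^sup>2)" for k
      by (rule conv_mollifier_L2(1)[OF h h2 K(1) h1(2) d(1)])
    have "(\<lambda>k. LINT x|lebesgue. norm ((norm (?\<phi> k x - h x))\<^sup>2)) \<longlonglongrightarrow> 0"
      using filterlim_compose[OF conv_mollifier_L2(2)[OF h h2 K(1) h1(2)] tendsto_divide_Suc_Suc_at_right[OF \<delta>(1)]]
      by simp
    \<comment> \<open>Dominated convergence needs pointwise limits, which L2 convergence supplies
      only along a subsequence.\<close>
    from tendsto_L1_AE_subseq[OF i this] obtain r where
      r: "AE x in lebesgue. (\<lambda>k. (norm (?\<phi> (r k) x - h x))\<^sup>2) \<longlonglongrightarrow> 0" by blast
    have [measurable]: "?\<phi> k \<in> borel_measurable lebesgue" for k by (rule test_function_measurable[OF t])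
    have Gm[measurable]: "?G \<in> borel_measurable lebesgue" using G by simp
    have "(\<lambda>k. LINT x|lebesgue. ?G x * ?\<phi> (r k) x) \<longlonglongrightarrow> (LINT x|lebesgue. ?G x * h x)"
    proof (rule integral_dominated_convergence[where w="\<lambda>x. norm (?G x)"])
      show "integrable lebesgue (\<lambda>x. norm (?G x))" using G by simp
      show "AE x in lebesgue. (\<lambda>k. ?G x * ?\<phi> (r k) x) \<longlonglongrightarrow> ?G x * h x"
        using r
      proof eventually_elim
        case (elim x)
        then have "(\<lambda>k. sqrt ((norm (?\<phi> (r k) x - h x))\<^sup>2)) \<longlonglongrightarrow> sqrt 0" by (rule tendsto_real_sqrt)
        then have "(\<lambda>k. ?\<phi> (r k) x) \<longlonglongrightarrow> h x" by (simp add: tendsto_rabs_zero_iff LIM_zero_iff)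
        then show ?case by (intro tendsto_mult_left)
      qed
      show "AE x in lebesgue. norm (?G x * ?\<phi> (r k) x) \<le> norm (?G x)" for k
      proof (rule AE_I2)
        fix x
        have "(LINT y|lebesgue. \<bar>mollifier (?d (r k)) (y::real^'n)\<bar>) = 1"
          by (rule mollifier_abs_integral[OF d(1)])
        then have "\<bar>?\<phi> (r k) x\<bar> \<le> 1"
          using conv_bound[OF test_function_mollifier[OF d(1)[of "r k"]] h, of 1 x] h1(1) by simp
        then have "\<bar>?G x\<bar> * \<bar>?\<phi> (r k) x\<bar> \<le> \<bar>?G x\<bar> * 1" by (intro mult_left_mono) auto
        then show "norm (?G x * ?\<phi> (r k) x) \<le> norm (?G x)" by (simp add: abs_mult)
      qed
    qed measurable
    moreover have "(LINT x|lebesgue. ?G x * ?\<phi> (r k) x) = 0" for k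
    proof -
      have "?\<phi> (r k) x = 0" if "x \<notin> K'" for x
        using test_function_support[OF t[of "r k"]] that by blast
      then have "(\<lambda>x. ?G x * ?\<phi> (r k) x) = (\<lambda>x. indicator S x *\<^sub>R (g x * ?\<phi> (r k) x))"
        using K'(2) by (intro ext) (auto simp: indicator_def)
      then show ?thesis
        using zero[OF test_function_mono[OF t[of "r k"] K'(2)]] by (simp only: set_lebesgue_integral_def)
    qed
    ultimately have "(LINT x|lebesgue. ?G x * h x) = 0" by (simp add: LIMSEQ_const_iff)
    moreover have "(\<lambda>x. ?G x * h x) = (\<lambda>x. \<bar>indicator K x * g x\<bar>)"
      using K'(3) by (intro ext) (auto simp: h_def indicator_def abs_sgn mult.commute)
    ultimately have "AE x in lebesgue. \<bar>indicator K x * g x\<bar> = 0"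
      using integral_nonneg_eq_0_iff_AE[OF integrable_abs[OF gK]] by (simp only:) simp
    then show ?thesis by eventually_elim (auto simp: indicator_def)
  qed
  have "\<exists>C::nat \<Rightarrow> _. (\<forall>n. compact (C n) \<and> C n \<subseteq> S) \<and> \<Union> (range C) = S"
  proof (rule open_Union_compact_subsets[OF S])
    fix C :: "nat \<Rightarrow> (real^'n) set"
    assume "\<And>n. compact (C n)" "\<And>n. C n \<subseteq> S" "\<Union> (range C) = S"
    then show "\<exists>C::nat \<Rightarrow> _. (\<forall>n. compact (C n) \<and> C n \<subseteq> S) \<and> \<Union> (range C) = S"
      by (intro exI[of _ C]) simp
  qed
  then obtain C :: "nat \<Rightarrow> _" where C: "\<And>n. compact (C n)" "\<And>n. C n \<subseteq> S" "\<Union> (range C) = S"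
    by metis
  have "AE x in lebesgue. \<forall>n. x \<in> C n \<longrightarrow> g x = 0"
    unfolding AE_all_countable using main[OF C(1,2)] by blast
  then show ?thesis by eventually_elim (use C(3) in blast)
qed

subsection \<open>Weak gradients\<close>

lemma L1_loc_bounded_linear:
  assumes "bounded_linear T" "L1_loc S f" shows "L1_loc S (\<lambda>x. T (f x))"
  unfolding L1_loc_def
proof (intro allI impI)
  interpret bounded_linear T by fact
  fix K assume "compact K \<and> K \<subseteq> S"
  then have "integrable lebesgue (\<lambda>x. indicator K x *\<^sub>R f x)"
    using assms(2) by (simp add: L1_loc_def absolutely_integrable_on_indicator_iff)
  from integrable_bounded_linear[OF assms(1) this]
  show "(\<lambda>x. T (f x)) absolutely_integrable_on K"
    by (simp add: absolutely_integrable_on_indicator_iff scaleR)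
qed

lemma L1_loc_diff: "L1_loc S f \<Longrightarrow> L1_loc S g \<Longrightarrow> L1_loc S (\<lambda>x. f x - g x)"
  unfolding L1_loc_def by (blast intro: set_integral_diff(1))

lemma L1_loc_add: "L1_loc S f \<Longrightarrow> L1_loc S g \<Longrightarrow> L1_loc S (\<lambda>x. f x + g x)"
  unfolding L1_loc_def by (blast intro: set_integral_add(1))

lemma L1_loc_mono: "L1_loc S f \<Longrightarrow> T \<subseteq> S \<Longrightarrow> L1_loc T f"
  by (auto simp: L1_loc_def)

lemma L1_loc_integrable:
  assumes "integrable lebesgue f" shows "L1_loc S f"
  using assms by (auto simp: L1_loc_def absolutely_integrable_on_indicator_iff compact_imp_closed
      intro!: integrable_mult_indicator)

lemma L1_loc_component:
  "L1_loc S u \<Longrightarrow> L1_loc S (\<lambda>x. u x $ i)"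
  by (rule L1_loc_bounded_linear[OF bounded_linear_vec_nth])

lemma integrable_test_mult:
  fixes f :: "real^'n::finite \<Rightarrow> 'b::euclidean_space"
  assumes f: "L1_loc S f" and t: "test_function S \<phi>"
  shows "integrable lebesgue (\<lambda>x. \<phi> x *\<^sub>R f x)"
proof -
  obtain K where K: "compact K" "K \<subseteq> S" "\<And>x. x \<notin> K \<Longrightarrow> \<phi> x = 0"
    using test_function_support[OF t] by blast
  obtain B where B: "\<And>x. norm (\<phi> x) \<le> B" using test_function_bounded[OF t] by blast
  have "integrable lebesgue (\<lambda>x. indicator K x *\<^sub>R f x)"
    using f K by (simp add: L1_loc_def absolutely_integrable_on_indicator_iff)
  from integrable_bounded_scaleR[OF this test_function_measurable[OF t], of B] B
  have "integrable lebesgue (\<lambda>x. \<phi> x *\<^sub>R indicator K x *\<^sub>R f x)" by simp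
  moreover have "(\<lambda>x. \<phi> x *\<^sub>R indicator K x *\<^sub>R f x) = (\<lambda>x. \<phi> x *\<^sub>R f x)"
    using K(3) by (intro ext) (auto simp: indicator_def)
  ultimately show ?thesis by (simp only:)
qed

lemma set_integral_test_mult:
  fixes f :: "real^'n::finite \<Rightarrow> real"
  assumes "test_function S \<phi>"
  shows "(LINT x:S|lebesgue. f x * \<phi> x) = (LINT x|lebesgue. f x * \<phi> x)"
proof -
  have "(\<lambda>x. indicator S x *\<^sub>R (f x * \<phi> x)) = (\<lambda>x. f x * \<phi> x)"
    using test_function_support[OF assms] by (intro ext) (auto simp: indicator_def)
  then show ?thesis by (simp only: set_lebesgue_integral_def)
qed

text \<open>Test functions and their derivatives vanish off \<open>S\<close>, so the integrals may
  run over the whole space. This form makes restriction to a subset, and extension by zero of a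
  product with a test function, free of indicators.\<close>

lemma has_weak_gradient_alt:
  "has_weak_gradient S u G \<longleftrightarrow> L1_loc S u \<and> L1_loc S G \<and>
    (\<forall>\<phi> :: real^'n \<Rightarrow> real. test_function S \<phi> \<longrightarrow>
      (\<forall>i j. (LINT x|lebesgue. u x $ i * partial_deriv j \<phi> x) = - (LINT x|lebesgue. G x $ i $ j * \<phi> x)))"
  for u :: "real^'n::finite \<Rightarrow> real^'m::finite"
proof -
  have "(LINT x:S|lebesgue. u x $ i * partial_deriv j \<phi> x) = (LINT x|lebesgue. u x $ i * partial_deriv j \<phi> x)"
    "(LINT x:S|lebesgue. G x $ i $ j * \<phi> x) = (LINT x|lebesgue. G x $ i $ j * \<phi> x)"
    if "test_function S \<phi>" for \<phi> :: "real^'n \<Rightarrow> real" and i j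
    using that by (auto intro!: set_integral_test_mult test_function_partial)
  then show ?thesis unfolding has_weak_gradient_def by simp
qed

lemma has_weak_gradient_mono:
  fixes u :: "real^'n::finite \<Rightarrow> real^'m::finite"
  assumes "has_weak_gradient S u G" "T \<subseteq> S" shows "has_weak_gradient T u G"
  unfolding has_weak_gradient_alt
proof (intro conjI allI impI)
  show "L1_loc T u" "L1_loc T G"
    using assms L1_loc_mono by (auto simp: has_weak_gradient_def)
  fix \<phi> :: "real^'n \<Rightarrow> real" and i j assume "test_function T \<phi>"
  then have "test_function S \<phi>" by (rule test_function_mono[OF _ assms(2)])
  then show "(LINT x|lebesgue. u x $ i * partial_deriv j \<phi> x) = - (LINT x|lebesgue. G x $ i $ j * \<phi> x)"
    using assms(1) unfolding has_weak_gradient_alt by blast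
qed

lemma integrable_weak_test:
  fixes u :: "real^'n::finite \<Rightarrow> real^'m::finite" and G :: "real^'n \<Rightarrow> real^'n^'m"
  assumes "L1_loc S u" "L1_loc S G" "test_function S \<phi>"
  shows "integrable lebesgue (\<lambda>x. u x $ i * partial_deriv j \<phi> x)"
    and "integrable lebesgue (\<lambda>x. u x $ i * \<phi> x)"
    and "integrable lebesgue (\<lambda>x. G x $ i $ j * \<phi> x)"
  using integrable_test_mult[OF L1_loc_component[OF assms(1)] test_function_partial[OF assms(3)], of j i]
    integrable_test_mult[OF L1_loc_component[OF assms(1)] assms(3), of i]
    integrable_test_mult[OF L1_loc_component[OF L1_loc_component[OF assms(2), of i], of j] assms(3)]
  by (simp_all add: mult.commute)

lemma has_weak_gradient_add:
  fixes u v :: "real^'n::finite \<Rightarrow> real^'m::finite"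
  assumes "has_weak_gradient S u G" "has_weak_gradient S v H"
  shows "has_weak_gradient S (\<lambda>x. u x + v x) (\<lambda>x. G x + H x)"
  unfolding has_weak_gradient_alt
proof (intro conjI allI impI)
  note a = assms[unfolded has_weak_gradient_alt]
  show "L1_loc S (\<lambda>x. u x + v x)" "L1_loc S (\<lambda>x. G x + H x)" using a by (auto intro: L1_loc_add)
  fix \<phi> :: "real^'n \<Rightarrow> real" and i j assume t: "test_function S \<phi>"
  have "(LINT x|lebesgue. (u x + v x) $ i * partial_deriv j \<phi> x)
      = (LINT x|lebesgue. u x $ i * partial_deriv j \<phi> x) + (LINT x|lebesgue. v x $ i * partial_deriv j \<phi> x)"
    using integrable_weak_test(1)[of S u G, OF _ _ t] integrable_weak_test(1)[of S v H, OF _ _ t] a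
    by (simp add: distrib_right)
  also have "\<dots> = - (LINT x|lebesgue. G x $ i $ j * \<phi> x) - (LINT x|lebesgue. H x $ i $ j * \<phi> x)"
    using a t by simp
  also have "\<dots> = - (LINT x|lebesgue. (G x + H x) $ i $ j * \<phi> x)"
    using integrable_weak_test(3)[of S u G, OF _ _ t] integrable_weak_test(3)[of S v H, OF _ _ t] a
    by (simp add: distrib_right)
  finally show "(LINT x|lebesgue. (u x + v x) $ i * partial_deriv j \<phi> x) = - (LINT x|lebesgue. (G x + H x) $ i $ j * \<phi> x)" .
qed

lemma has_weak_gradient_minus:
  assumes "has_weak_gradient S u G"
  shows "has_weak_gradient S (\<lambda>x. - u x) (\<lambda>x. - G x)"
  using assms L1_loc_bounded_linear[OF bounded_linear_minus[OF bounded_linear_ident], of S u]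
    L1_loc_bounded_linear[OF bounded_linear_minus[OF bounded_linear_ident], of S G]
  unfolding has_weak_gradient_alt by simp

lemma has_weak_gradient_diff:
  assumes "has_weak_gradient S u G" "has_weak_gradient S v H"
  shows "has_weak_gradient S (\<lambda>x. u x - v x) (\<lambda>x. G x - H x)"
  using has_weak_gradient_add[OF assms(1) has_weak_gradient_minus[OF assms(2)]] by simp

text \<open>Both candidates give the same integrals against every test function, so the fundamental
  lemma kills each entry of their difference; finitely many entries leave one common null
  set.\<close>

lemma weak_gradient_unique:
  fixes u :: "real^'n::finite \<Rightarrow> real^'m::finite"
  assumes S: "open S" and G: "has_weak_gradient S u G" and H: "has_weak_gradient S u H"
  shows "AE x in lebesgue. x \<in> S \<longrightarrow> G x = H x"
proof -
  have "AE x in lebesgue. x \<in> S \<longrightarrow> G x $ i $ j - H x $ i $ j = 0" for i j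
  proof (rule fundamental_lemma[OF S])
    have l: "L1_loc S G" "L1_loc S H" "L1_loc S u" using G H by (auto simp: has_weak_gradient_def)
    then show "L1_loc S (\<lambda>x. G x $ i $ j - H x $ i $ j)" by (intro L1_loc_diff L1_loc_component)
    fix \<phi> :: "real^'n \<Rightarrow> real" assume t: "test_function S \<phi>"
    have "(LINT x|lebesgue. G x $ i $ j * \<phi> x) = (LINT x|lebesgue. H x $ i $ j * \<phi> x)"
    proof -
      have "(LINT x|lebesgue. u x $ i * partial_deriv j \<phi> x) = - (LINT x|lebesgue. G x $ i $ j * \<phi> x)"
        "(LINT x|lebesgue. u x $ i * partial_deriv j \<phi> x) = - (LINT x|lebesgue. H x $ i $ j * \<phi> x)"
        using G H t unfolding has_weak_gradient_alt by blast+
      then show ?thesis by simp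
    qed
    then show "(LINT x:S|lebesgue. (G x $ i $ j - H x $ i $ j) * \<phi> x) = 0"
      using integrable_weak_test(3)[OF l(3) l(1) t] integrable_weak_test(3)[OF l(3) l(2) t]
      by (subst set_integral_test_mult[OF t]) (simp add: left_diff_distrib)
  qed
  then have "AE x in lebesgue. \<forall>i\<in>UNIV. \<forall>j\<in>UNIV. x \<in> S \<longrightarrow> G x $ i $ j - H x $ i $ j = 0"
    by (intro AE_finite_allI finite)
  then show ?thesis by eventually_elim (auto simp: vec_eq_iff)
qed

text \<open>\<open>weak_gradient\<close> is an arbitrary choice, known only up to null sets. This is
  the bridge from it to an explicitly computed gradient inside energies and norms.\<close>

lemma weak_gradient_AE:
  fixes u :: "real^'n::finite \<Rightarrow> real^'m::finite"
  assumes "open S" "has_weak_gradient S u G"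
  shows "AE x in lebesgue. x \<in> S \<longrightarrow> weak_gradient S u x = G x"
  using weak_gradient_unique[OF assms(1) _ assms(2)] someI[of "has_weak_gradient S u", OF assms(2)]
  unfolding weak_gradient_def by blast

text \<open>Convolve \<open>\<psi>\<close> with the indicator of a large ball. Near the origin the
  result is the constant integral of \<open>\<psi>\<close>, so its derivative at 0 vanishes; that
  derivative is also the integral of the partial derivative of \<open>\<psi>\<close>.\<close>

lemma test_function_partial_integral:
  fixes \<psi> :: "real^'n::finite \<Rightarrow> real"
  assumes t: "test_function S \<psi>" shows "(LINT x|lebesgue. partial_deriv j \<psi> x) = 0"
proof -
  obtain K where K: "compact K" "\<And>x. x \<notin> K \<Longrightarrow> \<psi> x = 0"
    using test_function_support[OF t] by blast
  obtain K' where K': "compact K'" "\<And>x. x \<notin> K' \<Longrightarrow> partial_deriv j \<psi> x = 0"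
    using test_function_support[OF test_function_partial[OF t]] by blast
  have "bounded (K \<union> K')" using K K' by (auto intro: compact_imp_bounded)
  then obtain R where R: "\<And>x. x \<in> K \<union> K' \<Longrightarrow> norm x \<le> R" by (auto simp: bounded_iff)
  \<comment> \<open>If \<open>norm x < 1\<close> and \<open>norm (x - y)\<close> is at most
    \<open>\<bar>R\<bar>\<close>, then \<open>y\<close> lies in this ball, so \<open>g\<close> is 1
    wherever the kernel may be nonzero.\<close>
  define g where "g = (indicator (ball (0::real^'n) (\<bar>R\<bar> + 2)) :: _ \<Rightarrow> real)"
  have g: "integrable lebesgue g"
    using emeasure_bounded_finite[OF bounded_ball, of "0::real^'n" "\<bar>R\<bar> + 2"] by (simp add: g_def)
  have 1: "conv \<phi> g x = (LINT y|lebesgue. \<phi> y)"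
    if "continuous_on UNIV \<phi>" "\<And>y. \<bar>R\<bar> < norm y \<Longrightarrow> \<phi> y = 0" "norm x < 1" for \<phi> x
  proof -
    have "\<phi> (x - y) *\<^sub>R g y = \<phi> (x - y)" for y
    proof (cases "\<bar>R\<bar> < norm (x - y)")
      case False
      have "norm y \<le> norm x + norm (x - y)" using norm_triangle_ineq4[of x "x - y"] by simp
      then show ?thesis using False that(3) by (simp add: g_def)
    qed (use that(2) in simp)
    then show ?thesis using integral_lebesgue_reflect[OF that(1), of x] by (simp only: conv_def)
  qed
  have "\<psi> y = 0" if "\<bar>R\<bar> < norm y" for y using that R[of y] by (intro K(2)) auto
  then have "partial_deriv j (conv \<psi> g) 0 = 0"
    by (intro partial_deriv_locally_constant[of "ball 0 1" _ _ "LINT y|lebesgue. \<psi> y"]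
        1[OF test_function_continuous[OF t]]) auto
  moreover have "partial_deriv j \<psi> y = 0" if "\<bar>R\<bar> < norm y" for y using that R[of y] by (intro K'(2)) auto
  then have "conv (partial_deriv j \<psi>) g 0 = (LINT x|lebesgue. partial_deriv j \<psi> x)"
    by (intro 1 test_function_continuous[OF test_function_partial[OF t]]) auto
  ultimately show ?thesis by (simp add: partial_deriv_conv[OF t g])
qed

lemma has_weak_gradient_const:
  fixes a :: "real^'m::finite"
  shows "has_weak_gradient S (\<lambda>x::real^'n::finite. a) (\<lambda>x. 0)"
  unfolding has_weak_gradient_alt
proof (intro conjI allI impI)
  show "L1_loc S (\<lambda>x::real^'n. a)"
    unfolding L1_loc_def
  proof (intro allI impI)
    fix K :: "(real^'n) set" assume "compact K \<and> K \<subseteq> S"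
    then show "(\<lambda>x. a) absolutely_integrable_on K"
      using emeasure_bounded_finite[OF compact_imp_bounded, of K]
      by (auto simp: absolutely_integrable_on_indicator_iff compact_imp_closed intro!: integrable_scaleR_left integrable_real_indicator)
  qed
qed (auto simp: test_function_partial_integral L1_loc_integrable)

section \<open>Product rule and mollification of weak gradients\<close>

lemma integrable_matrix:
  fixes F :: "'a \<Rightarrow> real^'n::finite^'m::finite"
  assumes "\<And>i j. integrable M (\<lambda>x. F x $ i $ j)"
  shows "integrable M F"
proof -
  have eq: "F = (\<lambda>x. \<Sum>i\<in>UNIV. \<Sum>j\<in>UNIV. (F x $ i $ j) *\<^sub>R axis i (axis j 1))"
  proof
    fix x
    have "(\<Sum>j\<in>UNIV. (F x $ a $ j) *\<^sub>R axis a (axis j 1)) = axis a (F x $ a)" for a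
      by (simp add: vec_eq_iff axis_def if_distrib[of "\<lambda>v. v $ _"] if_distrib[of "\<lambda>v. _ * v"] cong: if_cong)
    then show "F x = (\<Sum>i\<in>UNIV. \<Sum>j\<in>UNIV. (F x $ i $ j) *\<^sub>R axis i (axis j 1))"
      by (simp add: vec_eq_iff axis_def if_distrib[of "\<lambda>v. v $ _"] cong: if_cong)
  qed
  show ?thesis
    by (subst eq) (intro Bochner_Integration.integrable_sum integrable_scaleR_left assms)
qed

text \<open>The rank-one term of the gradient of \<open>\<phi> u\<close>, with rows indexed by the
  components of the map as in \<open>weak_gradient\<close>.\<close>

definition outer_prod :: "real^'m::finite \<Rightarrow> real^'n::finite \<Rightarrow> real^'n^'m"
  where "outer_prod v w = (\<chi> i j. v $ i * w $ j)"

lemma norm_outer_prod: "norm (outer_prod v w) = norm v * norm w"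
proof -
  have "(norm (outer_prod v w))\<^sup>2 = (norm v * norm w)\<^sup>2"
    unfolding power_mult_distrib power2_norm_eq_inner
    by (simp add: inner_vec_def outer_prod_def sum_product sum_distrib_left sum_distrib_right mult_ac)
  then show ?thesis by simp
qed

definition gradient :: "(real^'n::finite \<Rightarrow> real) \<Rightarrow> real^'n \<Rightarrow> real^'n"
  where "gradient \<phi> x = (\<chi> j. partial_deriv j \<phi> x)"

text \<open>For \<open>\<psi>\<close> on the whole space, \<open>\<phi> * \<psi>\<close> is a test
  function on \<open>S\<close>, so the weak equation for \<open>u\<close> applies to it and the
  Leibniz rule sorts the terms. Hence the product has a weak gradient on the whole space although
  \<open>u\<close> has one only on \<open>S\<close>.\<close>

lemma has_weak_gradient_product:
  fixes u :: "real^'n::finite \<Rightarrow> real^'m::finite"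
  assumes u: "has_weak_gradient S u G" and t: "test_function S \<phi>"
  shows "has_weak_gradient UNIV (\<lambda>x. \<phi> x *\<^sub>R u x) (\<lambda>x. \<phi> x *\<^sub>R G x + outer_prod (u x) (gradient \<phi> x))"
    and "integrable lebesgue (\<lambda>x. \<phi> x *\<^sub>R u x)"
    and "integrable lebesgue (\<lambda>x. \<phi> x *\<^sub>R G x + outer_prod (u x) (gradient \<phi> x))"
proof -
  have l: "L1_loc S u" "L1_loc S G" using u by (auto simp: has_weak_gradient_def)
  show i1: "integrable lebesgue (\<lambda>x. \<phi> x *\<^sub>R u x)" by (rule integrable_test_mult[OF l(1) t])
  show i2: "integrable lebesgue (\<lambda>x. \<phi> x *\<^sub>R G x + outer_prod (u x) (gradient \<phi> x))"
  proof (intro Bochner_Integration.integrable_add integrable_test_mult[OF l(2) t] integrable_matrix)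
    show "integrable lebesgue (\<lambda>x. outer_prod (u x) (gradient \<phi> x) $ i $ j)" for i j
      using integrable_weak_test(1)[OF l t] by (simp add: outer_prod_def gradient_def)
  qed
  show "has_weak_gradient UNIV (\<lambda>x. \<phi> x *\<^sub>R u x) (\<lambda>x. \<phi> x *\<^sub>R G x + outer_prod (u x) (gradient \<phi> x))"
    unfolding has_weak_gradient_alt
  proof (intro conjI allI impI L1_loc_integrable i1 i2)
    fix \<psi> :: "real^'n \<Rightarrow> real" and i j assume \<psi>: "test_function UNIV \<psi>"
    have C: "C_k k \<psi>" "C_k k \<phi>" for k using \<psi> t by (auto simp: test_function_def)
    have p: "test_function S (\<lambda>x. \<phi> x * \<psi> x)" by (rule test_function_mult[OF t C(1)])
    have p1: "test_function S (\<lambda>x. \<phi> x * partial_deriv j \<psi> x)"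
      using test_function_partial[OF \<psi>] by (intro test_function_mult[OF t]) (auto simp: test_function_def)
    have p2: "test_function S (\<lambda>x. partial_deriv j \<phi> x * \<psi> x)"
      by (intro test_function_mult[OF test_function_partial[OF t]] C)
    have pd: "partial_deriv j (\<lambda>x. \<phi> x * \<psi> x) x = \<phi> x * partial_deriv j \<psi> x + partial_deriv j \<phi> x * \<psi> x" for x
      by (rule partial_deriv_mult[OF test_function_differentiable[OF t] test_function_differentiable[OF \<psi>]])
    have "(LINT x|lebesgue. u x $ i * partial_deriv j (\<lambda>x. \<phi> x * \<psi> x) x) = - (LINT x|lebesgue. G x $ i $ j * (\<phi> x * \<psi> x))"
      using u p unfolding has_weak_gradient_alt by blast
    then have "(LINT x|lebesgue. u x $ i * (\<phi> x * partial_deriv j \<psi> x)) + (LINT x|lebesgue. u x $ i * (partial_deriv j \<phi> x * \<psi> x))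
       = - (LINT x|lebesgue. G x $ i $ j * (\<phi> x * \<psi> x))"
      using integrable_weak_test(2)[OF l p1, of i] integrable_weak_test(2)[OF l p2, of i]
      by (simp add: pd distrib_left)
    moreover have "(LINT x|lebesgue. (\<phi> x *\<^sub>R G x + outer_prod (u x) (gradient \<phi> x)) $ i $ j * \<psi> x)
      = (LINT x|lebesgue. G x $ i $ j * (\<phi> x * \<psi> x)) + (LINT x|lebesgue. u x $ i * (partial_deriv j \<phi> x * \<psi> x))"
      using integrable_weak_test(3)[OF l p, of i j] integrable_weak_test(2)[OF l p2, of i]
      by (simp add: outer_prod_def gradient_def distrib_left mult_ac)
    ultimately show "(LINT x|lebesgue. (\<phi> x *\<^sub>R u x) $ i * partial_deriv j \<psi> x)
       = - (LINT x|lebesgue. (\<phi> x *\<^sub>R G x + outer_prod (u x) (gradient \<phi> x)) $ i $ j * \<psi> x)"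
      by (simp add: mult_ac)
  qed
qed

lemma conv_commute:
  fixes f g :: "real^'n::finite \<Rightarrow> real"
  assumes "continuous_on UNIV f" "continuous_on UNIV g"
  shows "conv f g = conv g f"
proof
  fix x
  have "continuous_on UNIV (\<lambda>y. f y * g (x - y))"
    by (intro continuous_intros assms(1) continuous_on_compose2[OF assms(2)]) auto
  from integral_lebesgue_reflect[OF this, of x] show "conv f g x = conv g f x"
    by (simp add: conv_def mult.commute)
qed

text \<open>Self-adjointness moves the mollifier onto the test function, the weak equation is used
  for the mollified test function, and self-adjointness moves it back.\<close>

lemma has_weak_gradient_conv:
  fixes v :: "real^'n::finite \<Rightarrow> real^'m::finite"
  assumes d: "d > 0" and v: "has_weak_gradient UNIV v H" and iv: "integrable lebesgue v" and iH: "integrable lebesgue H"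
    and K: "compact K" "\<And>x. x \<notin> K \<Longrightarrow> v x = 0" "\<And>x. x \<notin> K \<Longrightarrow> H x = 0"
  shows "has_weak_gradient UNIV (conv (mollifier d) v) (conv (mollifier d) H)"
  unfolding has_weak_gradient_alt
proof (intro conjI allI impI)
  note t = test_function_mollifier[OF d, where 'n='n]
  show "L1_loc UNIV (conv (mollifier d) v)"
    by (rule L1_loc_integrable[OF integrable_test_function[OF test_function_conv[OF d iv K(1,2) subset_UNIV]]])
  show "L1_loc UNIV (conv (mollifier d) H)"
    by (rule L1_loc_integrable[OF integrable_test_function[OF test_function_conv[OF d iH K(1,3) subset_UNIV]]])
  fix \<psi> :: "real^'n \<Rightarrow> real" and i j assume \<psi>: "test_function UNIV \<psi>"
  obtain L where L: "compact L" "\<And>x. x \<notin> L \<Longrightarrow> \<psi> x = 0"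
    using test_function_support[OF \<psi>] by blast
  have ivi: "integrable lebesgue (\<lambda>x. v x $ i)"
    by (rule integrable_bounded_linear[OF bounded_linear_vec_nth iv])
  have bl: "bounded_linear (\<lambda>X::real^'n^'m. X $ i $ j)"
    by (rule bounded_linear_compose[OF bounded_linear_vec_nth bounded_linear_vec_nth])
  have iHi: "integrable lebesgue (\<lambda>x. H x $ i $ j)" by (rule integrable_bounded_linear[OF bl iH])
  have tc: "test_function UNIV (conv (mollifier d) \<psi>)"
    by (rule test_function_conv[OF d integrable_test_function[OF \<psi>] L subset_UNIV])
  \<comment> \<open>Commuting the two factors lets the derivative fall on \<open>\<psi>\<close>
    instead of on the kernel.\<close>
  have pc: "conv (mollifier d) (partial_deriv j \<psi>) = partial_deriv j (conv (mollifier d) \<psi>)"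
    using conv_commute[OF test_function_continuous[OF t]] test_function_continuous[OF \<psi>]
      test_function_continuous[OF test_function_partial[OF \<psi>]]
      partial_deriv_conv[OF \<psi> integrable_test_function[OF t], of j] by metis
  have "(LINT x|lebesgue. conv (mollifier d) v x $ i * partial_deriv j \<psi> x)
      = (LINT x|lebesgue. conv (mollifier d) (\<lambda>y. v y $ i) x * partial_deriv j \<psi> x)"
    by (simp add: conv_bounded_linear[OF bounded_linear_vec_nth t iv])
  also have "\<dots> = (LINT x|lebesgue. v x $ i * partial_deriv j (conv (mollifier d) \<psi>) x)"
    by (subst conv_Fubini[OF t ivi test_function_partial[OF \<psi>] mollifier_even[OF d]]) (simp add: pc)
  also have "\<dots> = - (LINT x|lebesgue. H x $ i $ j * conv (mollifier d) \<psi> x)"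
    using v tc unfolding has_weak_gradient_alt by blast
  also have "\<dots> = - (LINT x|lebesgue. conv (mollifier d) (\<lambda>y. H y $ i $ j) x * \<psi> x)"
    by (subst conv_Fubini[OF t iHi \<psi> mollifier_even[OF d]]) simp
  also have "\<dots> = - (LINT x|lebesgue. conv (mollifier d) H x $ i $ j * \<psi> x)"
    by (simp add: conv_bounded_linear[OF bl t iH])
  finally show "(LINT x|lebesgue. conv (mollifier d) v x $ i * partial_deriv j \<psi> x)
    = - (LINT x|lebesgue. conv (mollifier d) H x $ i $ j * \<psi> x)" .
qed


section \<open>Compactly supported maps belong to \<open>W12_0\<close>\<close>

lemma L2_integrable:
  fixes f :: "real^'n::finite \<Rightarrow> 'b::euclidean_space"
  assumes [measurable]: "f \<in> borel_measurable lebesgue" and i: "integrable lebesgue (\<lambda>x. (norm (f x))\<^sup>2)"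
    and S[measurable]: "S \<in> sets lebesgue"
  shows "L2 S f"
  unfolding L2_def set_borel_measurable_def set_integrable_def
proof
  show "(\<lambda>x. indicat_real S x *\<^sub>R f x) \<in> borel_measurable lebesgue" by measurable
  show "integrable lebesgue (\<lambda>x. indicat_real S x *\<^sub>R (norm (f x))\<^sup>2)"
    by (rule integrable_mult_indicator[OF S i])
qed

text \<open>At scales \<open>d k \<le> \<delta>\<close> the mollifications of \<open>v\<close> are
  test functions in \<open>S\<close>, and their weak gradients are the mollifications of
  \<open>H\<close>. The W12 distance to \<open>v\<close> is thus controlled by two L2 distances,
  each tending to 0.\<close>

lemma W12_0_compact_support:
  fixes v :: "real^'n::finite \<Rightarrow> real^'m::finite"
  assumes S: "open S" and v: "has_weak_gradient UNIV v H"
    and iv: "integrable lebesgue v" and iH: "integrable lebesgue H"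
    and iv2: "integrable lebesgue (\<lambda>x. (norm (v x))\<^sup>2)" and iH2: "integrable lebesgue (\<lambda>x. (norm (H x))\<^sup>2)"
    and K: "compact K" "K \<subseteq> S" "\<And>x. x \<notin> K \<Longrightarrow> v x = 0" "\<And>x. x \<notin> K \<Longrightarrow> H x = 0"
  shows "W12_0 S v"
  unfolding W12_0_def
proof
  have Sm: "S \<in> sets lebesgue" using S by simp
  show "W12 S v" unfolding W12_def
    using L2_integrable[OF borel_measurable_integrable[OF iv] iv2 Sm]
      L2_integrable[OF borel_measurable_integrable[OF iH] iH2 Sm]
      has_weak_gradient_mono[OF v subset_UNIV] by blast
  obtain \<delta> where \<delta>: "\<delta> > 0" "(\<Union>x\<in>K. cball x \<delta>) \<subseteq> S"
    using compact_subset_open_imp_cball_epsilon_subset[OF K(1) S K(2)] by blast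
  define d where "d k = \<delta> / real (Suc (Suc k))" for k
  have d: "d k > 0" "d k \<le> \<delta>" for k using \<delta>(1) by (auto simp: d_def field_simps)
  let ?\<phi> = "\<lambda>k. conv (mollifier (d k)) v"
  have t: "test_function S (?\<phi> k)" for k
  proof (rule test_function_conv[OF d(1) iv K(1,3)])
    show "(\<Union>x\<in>K. cball x (d k)) \<subseteq> S"
      using \<delta>(2) d(2)[of k] by (meson UN_mono order_refl order_trans subset_cball)
  qed
  define a where "a k = (LINT x|lebesgue. (norm (?\<phi> k x - v x))\<^sup>2)" for k
  define b where "b k = (LINT x|lebesgue. (norm (conv (mollifier (d k)) H x - H x))\<^sup>2)" for k
  have d0: "filterlim d (at_right 0) sequentially"
    unfolding d_def by (rule tendsto_divide_Suc_Suc_at_right[OF \<delta>(1)])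
  have a: "a \<longlonglongrightarrow> 0" unfolding a_def
    by (rule filterlim_compose[OF conv_mollifier_L2(2)[OF iv iv2 K(1,3)] d0])
  have b: "b \<longlonglongrightarrow> 0" unfolding b_def
    by (rule filterlim_compose[OF conv_mollifier_L2(2)[OF iH iH2 K(1,4)] d0])
  have le: "W12_norm S (\<lambda>x. ?\<phi> k x - v x) \<le> sqrt (a k + b k)" for k
  proof -
    let ?w = "weak_gradient S (\<lambda>x. ?\<phi> k x - v x)"
    let ?D = "\<lambda>x. conv (mollifier (d k)) H x - H x"
    have wg: "has_weak_gradient S (\<lambda>x. ?\<phi> k x - v x) ?D"
      by (rule has_weak_gradient_mono[OF has_weak_gradient_diff[OF
            has_weak_gradient_conv[OF d(1) v iv iH K(1,3,4)] v] subset_UNIV])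
    have ai: "integrable lebesgue (\<lambda>x. (norm (?\<phi> k x - v x))\<^sup>2)"
      by (rule conv_mollifier_L2(1)[OF iv iv2 K(1,3) d(1)])
    have bi: "integrable lebesgue (\<lambda>x. (norm (?D x))\<^sup>2)"
      by (rule conv_mollifier_L2(1)[OF iH iH2 K(1,4) d(1)])
    have restrict: "(LINT x:S|lebesgue. f x) \<le> (LINT x|lebesgue. f x)"
      if "integrable lebesgue f" "\<And>x. 0 \<le> f x" for f :: "real^'n \<Rightarrow> real"
      unfolding set_lebesgue_integral_def
      by (intro integral_mono integrable_mult_indicator[OF Sm] that) (use that(2) in \<open>auto simp: indicator_def\<close>)
    \<comment> \<open>Nothing is known about the measurability of the chosen representative
      \<open>?w\<close>; it is inherited from the mollified gradient through this equality almost
      everywhere.\<close>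
    have ae: "AE x in lebesgue. indicator S x *\<^sub>R (norm (?D x))\<^sup>2 = indicator S x *\<^sub>R (norm (?w x))\<^sup>2"
      using weak_gradient_AE[OF S wg] by eventually_elim (auto simp: indicator_def)
    have m: "(\<lambda>x. indicator S x *\<^sub>R (norm (?D x))\<^sup>2) \<in> borel_measurable lebesgue"
      using integrable_mult_indicator[OF Sm bi] by (rule borel_measurable_integrable)
    have "(LINT x:S|lebesgue. (norm (?w x))\<^sup>2) = (LINT x:S|lebesgue. (norm (?D x))\<^sup>2)"
      unfolding set_lebesgue_integral_def
      by (rule integral_cong_AE[OF m borel_measurable_AE[OF m ae] ae, symmetric])
    then show ?thesis
      unfolding W12_norm_def a_def b_def
      using restrict[OF ai] restrict[OF bi] by (intro real_sqrt_le_mono) simp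
  qed
  have "(\<lambda>k. sqrt (a k + b k)) \<longlonglongrightarrow> sqrt (0 + 0)" by (intro tendsto_intros a b)
  then have lim: "(\<lambda>k. sqrt (a k + b k)) \<longlonglongrightarrow> 0" by simp
  have "(\<lambda>k. W12_norm S (\<lambda>x. ?\<phi> k x - v x)) \<longlonglongrightarrow> 0"
  proof (rule tendsto_sandwich[OF _ _ tendsto_const lim])
    show "\<forall>\<^sub>F k in sequentially. 0 \<le> W12_norm S (\<lambda>x. ?\<phi> k x - v x)"
      by (auto simp: W12_norm_def set_lebesgue_integral_def intro!: always_eventually integral_nonneg add_nonneg_nonneg)
    show "\<forall>\<^sub>F k in sequentially. W12_norm S (\<lambda>x. ?\<phi> k x - v x) \<le> sqrt (a k + b k)"
      using le by simp
  qed
  with t show "\<exists>\<phi>. (\<forall>k. test_function S (\<phi> k)) \<and> (\<lambda>k. W12_norm S (\<lambda>x. \<phi> k x - v x)) \<longlonglongrightarrow> 0"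
    by (intro exI[of _ ?\<phi>]) simp
qed


subsection \<open>Balls have Lipschitz boundary\<close>

text \<open>Both roots are at least \<open>r / 2\<close>, so their sum is at least \<open>r\<close>,
  hence at least \<open>a + b\<close>. Dividing the identity
  \<open>(x - y) * (x + y) = (b - a) * (a + b)\<close> by that sum gives Lipschitz constant
  1.\<close>

lemma abs_sqrt_diff_le:
  fixes a b r :: real
  assumes "0 < r" "0 \<le> a" "a \<le> r / 2" "0 \<le> b" "b \<le> r / 2"
  shows "\<bar>sqrt (r\<^sup>2 - a\<^sup>2) - sqrt (r\<^sup>2 - b\<^sup>2)\<bar> \<le> \<bar>a - b\<bar>"
proof -
  have *: "r / 2 \<le> sqrt (r\<^sup>2 - t\<^sup>2)" "t\<^sup>2 \<le> r\<^sup>2" if "0 \<le> t" "t \<le> r / 2" for t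
  proof -
    have "t\<^sup>2 \<le> (r / 2)\<^sup>2" using that by (intro power_mono) auto
    moreover have "(r / 2)\<^sup>2 = r\<^sup>2 / 4" by (simp add: power_divide)
    ultimately have "(r / 2)\<^sup>2 \<le> r\<^sup>2 - t\<^sup>2" "t\<^sup>2 \<le> r\<^sup>2"
      using zero_le_power2[of r] by linarith+
    then show "r / 2 \<le> sqrt (r\<^sup>2 - t\<^sup>2)" "t\<^sup>2 \<le> r\<^sup>2" by (blast intro: real_le_rsqrt)+
  qed
  define x y where "x = sqrt (r\<^sup>2 - a\<^sup>2)" and "y = sqrt (r\<^sup>2 - b\<^sup>2)"
  have xy: "r / 2 \<le> x" "r / 2 \<le> y" "x\<^sup>2 = r\<^sup>2 - a\<^sup>2" "y\<^sup>2 = r\<^sup>2 - b\<^sup>2"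
    using * assms by (auto simp: x_def y_def)
  have "(x - y) * (x + y) = (b - a) * (a + b)" using xy by (simp add: power2_eq_square algebra_simps)
  then have "\<bar>(x - y) * (x + y)\<bar> = \<bar>(b - a) * (a + b)\<bar>" by simp
  then have "\<bar>x - y\<bar> * (x + y) = \<bar>a - b\<bar> * (a + b)"
    using xy assms by (simp add: abs_mult abs_minus_commute)
  also have "\<dots> \<le> \<bar>a - b\<bar> * (x + y)" using xy assms by (intro mult_left_mono) auto
  finally show ?thesis using xy assms by (simp add: x_def y_def)
qed

lemma lipschitz_boundary_ball:
  fixes c :: "real^'n::finite"
  assumes r: "0 < r"
  shows "lipschitz_boundary (ball c r)"
  unfolding lipschitz_boundary_def
proof
  fix p assume "p \<in> frontier (ball c r)"
  then have p: "norm (c - p) = r" using r by (simp add: frontier_ball dist_norm)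
  define \<nu> where "\<nu> = (c - p) /\<^sub>R r"
  have \<nu>: "norm \<nu> = 1" "\<nu> \<bullet> \<nu> = 1" "c - p = r *\<^sub>R \<nu>" using p r by (simp_all add: \<nu>_def flip: power2_norm_eq_inner)
  define P where "P x = x - (x \<bullet> \<nu>) *\<^sub>R \<nu>" for x
  have P: "(norm (P x))\<^sup>2 = (norm x)\<^sup>2 - (x \<bullet> \<nu>)\<^sup>2" for x
    unfolding power2_norm_eq_inner P_def
    by (simp add: inner_simps \<nu>(2) inner_commute power2_eq_square)
  have Pd: "P x - P y = P (x - y)" for x y by (simp add: P_def inner_simps scaleR_diff_left)
  have Ple: "norm (P x) \<le> norm x" for x
    by (rule power2_le_imp_le) (simp_all add: P)
  \<comment> \<open>With \<open>\<nu>\<close> the inner normal at \<open>p\<close> and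
    \<open>P\<close> the projection along it, this is the hemisphere through \<open>p\<close>.
    Capping the distance at \<open>r / 2\<close> keeps the graph away from the steep equator, so it
    is 1-Lipschitz everywhere; on the ball of radius \<open>r / 2\<close> about \<open>p\<close> the
    cap is inactive.\<close>
  define \<gamma> where "\<gamma> y = c \<bullet> \<nu> - sqrt (r\<^sup>2 - (min (norm (y - P c)) (r / 2))\<^sup>2)" for y
  have "1-lipschitz_on {y. y \<bullet> \<nu> = 0} \<gamma>"
  proof (rule lipschitz_onI)
    fix x y
    have "dist (\<gamma> x) (\<gamma> y) \<le> \<bar>min (norm (x - P c)) (r / 2) - min (norm (y - P c)) (r / 2)\<bar>"
      using abs_sqrt_diff_le[OF r, of "min (norm (x - P c)) (r / 2)" "min (norm (y - P c)) (r / 2)"] r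
      by (simp add: \<gamma>_def dist_real_def abs_minus_commute)
    also have "\<dots> \<le> \<bar>norm (x - P c) - norm (y - P c)\<bar>" by linarith
    also have "\<dots> \<le> norm (x - y)" using norm_triangle_ineq3[of "x - P c" "y - P c"] by simp
    finally show "dist (\<gamma> x) (\<gamma> y) \<le> 1 * dist x y" by (simp add: dist_norm)
  qed simp
  moreover have "x \<in> ball c r \<longleftrightarrow> \<gamma> (x - (x \<bullet> \<nu>) *\<^sub>R \<nu>) < x \<bullet> \<nu>" if "x \<in> ball p (r / 2)" for x
  proof -
    have xp: "norm (x - p) < r / 2" using that by (simp add: dist_norm norm_minus_commute)
    have "P (c - p) = 0" by (simp add: \<nu>(3) P_def \<nu>(2))
    then have "P c = P p" using Pd[of c p] by simp
    then have "norm (P x - P c) < r / 2" using Ple[of "x - p"] xp by (simp add: Pd)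
    then have \<gamma>: "\<gamma> (P x) = c \<bullet> \<nu> - sqrt (r\<^sup>2 - (norm (P x - P c))\<^sup>2)" by (simp add: \<gamma>_def)
    have "c \<bullet> \<nu> - p \<bullet> \<nu> = r" using \<nu>(2,3) by (metis inner_diff_left inner_scaleR_left mult.right_neutral)
    moreover have "\<bar>(x - p) \<bullet> \<nu>\<bar> \<le> norm (x - p)" using Cauchy_Schwarz_ineq2[of "x - p" \<nu>] \<nu> by simp
    \<comment> \<open>Positivity places \<open>x\<close> on the side of the centre facing
      \<open>p\<close>, so comparing squares is the same as comparing with the root.\<close>
    ultimately have pos: "0 < c \<bullet> \<nu> - x \<bullet> \<nu>" using xp r by (simp add: inner_diff_left)
    have "x \<in> ball c r \<longleftrightarrow> (norm (x - c))\<^sup>2 < r\<^sup>2"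
      using r power_mono_iff[of r "norm (x - c)" 2] by (simp add: dist_norm norm_minus_commute flip: not_le)
    also have "\<dots> \<longleftrightarrow> (c \<bullet> \<nu> - x \<bullet> \<nu>)\<^sup>2 < r\<^sup>2 - (norm (P x - P c))\<^sup>2"
      using P[of "x - c"] by (auto simp: Pd inner_diff_left power2_commute[of "x \<bullet> \<nu>"])
    also have "\<dots> \<longleftrightarrow> c \<bullet> \<nu> - x \<bullet> \<nu> < sqrt (r\<^sup>2 - (norm (P x - P c))\<^sup>2)"
      using pos real_sqrt_less_iff[of "(c \<bullet> \<nu> - x \<bullet> \<nu>)\<^sup>2"] by simp
    also have "\<dots> \<longleftrightarrow> \<gamma> (P x) < x \<bullet> \<nu>" unfolding \<gamma> by linarith
    finally show ?thesis by (simp add: P_def)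
  qed
  ultimately show "\<exists>\<nu> \<gamma> L \<epsilon>. norm \<nu> = 1 \<and> L-lipschitz_on {y. y \<bullet> \<nu> = 0} \<gamma> \<and> 0 < \<epsilon> \<and>
      (\<forall>x\<in>ball p \<epsilon>. (x \<in> ball c r) = (\<gamma> (x - (x \<bullet> \<nu>) *\<^sub>R \<nu>) < x \<bullet> \<nu>))"
    using r \<nu>(1) by (intro exI[of _ \<nu>] exI[of _ \<gamma>] exI[of _ 1] exI[of _ "r / 2"]) auto
qed

subsection \<open>Energy estimates\<close>

lemma gradient_support:
  assumes "test_function S \<phi>"
  shows "\<exists>K. compact K \<and> K \<subseteq> S \<and> (\<forall>x. x \<notin> K \<longrightarrow> \<phi> x = 0 \<and> gradient \<phi> x = 0)"
proof -
  obtain K where K: "compact K" "K \<subseteq> S" "\<And>x. x \<notin> K \<Longrightarrow> \<phi> x = 0"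
    using test_function_support[OF assms] by blast
  have "partial_deriv j \<phi> x = 0" if "x \<notin> K" for x j
    using K that by (intro partial_deriv_locally_constant[of "-K" x \<phi> 0])
      (auto simp: compact_imp_closed open_Compl)
  then have "gradient \<phi> x = 0" if "x \<notin> K" for x using that by (simp add: gradient_def vec_eq_iff)
  with K show ?thesis by blast
qed

text \<open>Mollify the indicator of the ball of radius \<open>(s + t) / 2\<close> at scale
  \<open>(t - s) / 4\<close>: this ball has a margin of \<open>(t - s) / 2\<close> on either side,
  so the kernel reaches neither sphere. The order of quantifiers matters: \<open>C\<close> depends
  on the dimension alone.\<close>

lemma cutoff_exists:
  "\<exists>C>0. \<forall>(x0::real^'n::finite) s t. 0 < s \<and> s < t \<longrightarrow> (\<exists>\<phi>. test_function (ball x0 t) \<phi> \<and>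
    (\<forall>x. 0 \<le> \<phi> x \<and> \<phi> x \<le> 1) \<and> (\<forall>x\<in>ball x0 s. \<phi> x = 1) \<and> (\<forall>x. norm (gradient \<phi> x) \<le> C / (t - s)))"
proof -
  define D where "D j = (LINT x|lebesgue. \<bar>partial_deriv j (bump 0) (x::real^'n)\<bar>) / (LINT x|lebesgue. bump 0 (x::real^'n))" for j
  have D: "D j \<ge> 0" for j unfolding D_def using bump_integral_pos[where 'n='n] by (intro divide_nonneg_pos) auto
  \<comment> \<open>The 4 undoes the scale \<open>d = (t - s) / 4\<close>; the summand 1 makes
    \<open>C\<close> positive.\<close>
  define C where "C = 4 * (\<Sum>j\<in>UNIV. D j) + 1"
  have C: "C > 0" using D by (auto simp: C_def intro!: add_nonneg_pos sum_nonneg)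
  have "\<exists>\<phi>. test_function (ball x0 t) \<phi> \<and>
    (\<forall>x. 0 \<le> \<phi> x \<and> \<phi> x \<le> 1) \<and> (\<forall>x\<in>ball x0 s. \<phi> x = 1) \<and> (\<forall>x. norm (gradient \<phi> x) \<le> C / (t - s))"
    if st: "0 < s" "s < t" for x0 :: "real^'n" and s t
  proof -
    define d where "d = (t - s) / 4"
    have d: "d > 0" using st by (simp add: d_def)
    define B where "B = cball x0 ((s + t) / 2)"
    define g where "g = (indicator B :: real^'n \<Rightarrow> real)"
    have g: "integrable lebesgue g"
      using emeasure_bounded_finite[OF bounded_cball, of x0 "(s + t) / 2"] by (simp add: g_def B_def)
    have g1: "norm (g x) \<le> 1" for x by (simp add: g_def indicator_def)
    note m = test_function_mollifier[OF d, where 'n='n]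
    let ?\<phi> = "conv (mollifier d) g"
    have t: "test_function (ball x0 t) ?\<phi>"
    proof (rule test_function_conv[OF d g])
      show "compact B" by (simp add: B_def)
      show "g x = 0" if "x \<notin> B" for x using that by (simp add: g_def)
      show "(\<Union>x\<in>B. cball x d) \<subseteq> ball x0 t"
      proof clarsimp
        fix x y assume "x \<in> B" "dist x y \<le> d"
        then show "dist x0 y < t" using dist_triangle[of x0 y x] st by (auto simp: B_def d_def field_simps)
      qed
    qed
    moreover have "0 \<le> ?\<phi> x" for x
      unfolding conv_def by (intro Bochner_Integration.integral_nonneg) (auto simp: g_def mollifier_nonneg[OF d])
    moreover have "?\<phi> x \<le> 1" for x
      using conv_bound[OF m g g1, of x] by (simp add: mollifier_abs_integral[OF d])
    moreover have "?\<phi> x = 1" if x: "x \<in> ball x0 s" for x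
    proof -
      have "(\<lambda>y. mollifier d (x - y) *\<^sub>R g y) = (\<lambda>y. mollifier d (x - y))"
      proof
        fix y
        show "mollifier d (x - y) *\<^sub>R g y = mollifier d (x - y)"
        proof (cases "d \<le> norm (x - y)")
          case True
          then show ?thesis using mollifier_support[OF d True] by simp
        next
          case False
          then have "y \<in> B" using x dist_triangle[of x0 y x] st by (auto simp: B_def d_def dist_norm field_simps)
          then show ?thesis by (simp add: g_def)
        qed
      qed
      then show ?thesis using integrable_mollifier_shift(2)[OF d, of x] by (simp only: conv_def)
    qed
    moreover have "norm (gradient ?\<phi> x) \<le> C / (t - s)" for x
    proof -
      have "\<bar>partial_deriv j ?\<phi> x\<bar> \<le> D j / d" for j
        using conv_bound[OF test_function_partial[OF m] g g1, of j x] mollifier_partial_integral[OF d, of j]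
        by (simp add: partial_deriv_conv[OF m g] D_def)
      then have "(\<Sum>j\<in>UNIV. \<bar>gradient ?\<phi> x $ j\<bar>) \<le> (\<Sum>j\<in>UNIV. D j / d)"
        by (intro sum_mono) (simp add: gradient_def)
      then have "norm (gradient ?\<phi> x) \<le> (\<Sum>j\<in>UNIV. D j / d)"
        using norm_le_l1_cart[of "gradient ?\<phi> x"] by linarith
      also have "\<dots> = 4 * (\<Sum>j\<in>UNIV. D j) / (t - s)"
        by (simp add: d_def mult.commute flip: sum_distrib_right sum_divide_distrib)
      also have "\<dots> \<le> C / (t - s)" using st by (intro divide_right_mono) (auto simp: C_def)
      finally show ?thesis .
    qed
    ultimately show ?thesis by blast
  qed
  with C show ?thesis by blast
qed

lemma energy_eq:
  fixes u :: "real^'n::finite \<Rightarrow> real^'m::finite"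
  assumes "open S" "has_weak_gradient S u G"
  shows "energy W S u = (\<integral>\<^sup>+x\<in>S. ennreal ((norm (G x))\<^sup>2 / 2 + W (u x)) \<partial>lebesgue)"
  unfolding energy_def
  by (rule nn_integral_cong_AE, use weak_gradient_AE[OF assms] in eventually_elim) (auto simp: indicator_def)

text \<open>On the shell the gradient of the competitor is \<open>(1 - \<phi>) G\<close> plus a
  rank-one term of norm at most \<open>2 * M * D\<close>. Half of its square is therefore at most
  \<open>|G|^2 + 4 * M^2 * D^2\<close>, and \<open>|G|^2\<close> is twice the gradient part of the
  energy density. The competitor is a convex combination of \<open>u\<close> and \<open>a\<close>,
  so it stays where \<open>W\<close> is bounded by \<open>Wm\<close>.\<close>

lemma energy_comparison:
  fixes u :: "real^'n::finite \<Rightarrow> real^'m::finite"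
  assumes min: "minimizer W u" and uM: "AE x in lebesgue. norm (u x) \<le> M" and aM: "norm a \<le> M"
    and W: "W a = 0" "\<And>z. norm z \<le> M \<Longrightarrow> W z \<le> Wm" "\<And>z. 0 \<le> W z"
    and \<phi>: "test_function (ball x0 t) \<phi>" "\<And>x. 0 \<le> \<phi> x" "\<And>x. \<phi> x \<le> 1" "\<And>x. x \<in> ball x0 s \<Longrightarrow> \<phi> x = 1"
      "\<And>x. norm (gradient \<phi> x) \<le> D"
    and st: "0 < s" "s < t" "t \<le> R"
    and G: "has_weak_gradient (ball x0 R) u G" "L2 (ball x0 R) G" and u2: "L2 (ball x0 R) u"
  shows "(\<integral>\<^sup>+x\<in>ball x0 t. ennreal ((norm (G x))\<^sup>2 / 2 + W (u x)) \<partial>lebesgue)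
    \<le> (\<integral>\<^sup>+x\<in>ball x0 t - ball x0 s. ennreal (2 * ((norm (G x))\<^sup>2 / 2 + W (u x)) + (4 * M\<^sup>2 * D\<^sup>2 + Wm)) \<partial>lebesgue)"
proof -
  let ?B = "ball x0 t"
  have B: "?B \<subseteq> ball x0 R" using st by auto
  define v where "v x = \<phi> x *\<^sub>R (a - u x)" for x
  define H where "H x = \<phi> x *\<^sub>R (0 - G x) + outer_prod (a - u x) (gradient \<phi> x)" for x
  have Gt: "has_weak_gradient ?B u G" by (rule has_weak_gradient_mono[OF G(1) B])
  have ua: "has_weak_gradient ?B (\<lambda>x. a - u x) (\<lambda>x. 0 - G x)"
    by (rule has_weak_gradient_diff[OF has_weak_gradient_const Gt])
  note pr = has_weak_gradient_product[OF ua \<phi>(1), folded v_def H_def]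
  obtain K where K: "compact K" "K \<subseteq> ?B" "\<And>x. x \<notin> K \<Longrightarrow> \<phi> x = 0" "\<And>x. x \<notin> K \<Longrightarrow> gradient \<phi> x = 0"
    using gradient_support[OF \<phi>(1)] by blast
  have op0: "outer_prod w 0 = (0::real^'n^'m)" for w :: "real^'m" by (simp add: outer_prod_def vec_eq_iff)
  have vK: "v x = 0" "H x = 0" if "x \<notin> K" for x using K(3,4)[OF that] by (simp_all add: v_def H_def op0)
  have um: "u \<in> borel_measurable lebesgue"
    using min by (simp add: minimizer_def L_infinity_def set_borel_measurable_def)
  have vm[measurable]: "v \<in> borel_measurable lebesgue" and Hm[measurable]: "H \<in> borel_measurable lebesgue"
    using pr(2,3) by auto
  let ?I = "indicator (ball x0 R) :: real^'n \<Rightarrow> real"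
  have iu: "integrable lebesgue (\<lambda>x. ?I x * (norm (u x))\<^sup>2)" using u2 by (simp add: L2_def set_integrable_def)
  have iG: "integrable lebesgue (\<lambda>x. ?I x * (norm (G x))\<^sup>2)" using G(2) by (simp add: L2_def set_integrable_def)
  have iI: "integrable lebesgue ?I"
    using emeasure_bounded_finite[OF bounded_ball, of x0 R] by simp
  have \<phi>1: "(\<phi> x)\<^sup>2 \<le> 1" for x using \<phi>(2,3)[of x] by (simp add: abs_square_le_1)
  have g2: "(norm (gradient \<phi> x))\<^sup>2 \<le> D\<^sup>2" for x using \<phi>(5) by (intro power_mono) auto
  have au: "(norm (a - u x))\<^sup>2 \<le> 2 * (norm a)\<^sup>2 + 2 * (norm (u x))\<^sup>2" for x
    using norm_add_sq_le[of a "- u x"] by simp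
  have inK: "?I x = 1" if "x \<in> K" for x using that K(2) B by (auto simp: indicator_def)
  \<comment> \<open>The majorants carry the indicator of the ball of radius \<open>R\<close>, since
    square integrability of \<open>u\<close> and \<open>G\<close> is available there.\<close>
  have v2: "(norm (v x))\<^sup>2 \<le> 2 * (norm a)\<^sup>2 * ?I x + 2 * (?I x * (norm (u x))\<^sup>2)" for x
  proof (cases "x \<in> K")
    case True
    have "(norm (v x))\<^sup>2 = (\<phi> x)\<^sup>2 * (norm (a - u x))\<^sup>2" by (simp add: v_def power_mult_distrib)
    also have "\<dots> \<le> 1 * (norm (a - u x))\<^sup>2" by (intro mult_right_mono \<phi>1) auto
    also have "\<dots> \<le> 2 * (norm a)\<^sup>2 + 2 * (norm (u x))\<^sup>2" using au[of x] by simp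
    finally show ?thesis using inK[OF True] by simp
  qed (simp add: vK)
  have H2: "(norm (H x))\<^sup>2 \<le> 2 * (?I x * (norm (G x))\<^sup>2)
      + 2 * (D\<^sup>2 * (2 * (norm a)\<^sup>2 * ?I x + 2 * (?I x * (norm (u x))\<^sup>2)))" for x
  proof (cases "x \<in> K")
    case True
    have "(norm (H x))\<^sup>2 \<le> 2 * ((\<phi> x)\<^sup>2 * (norm (G x))\<^sup>2) + 2 * ((norm (gradient \<phi> x))\<^sup>2 * (norm (a - u x))\<^sup>2)"
      using norm_add_sq_le[of "\<phi> x *\<^sub>R (0 - G x)" "outer_prod (a - u x) (gradient \<phi> x)"]
      by (simp add: H_def norm_outer_prod power_mult_distrib mult.commute)
    also have "\<dots> \<le> 2 * (1 * (norm (G x))\<^sup>2) + 2 * (D\<^sup>2 * (2 * (norm a)\<^sup>2 + 2 * (norm (u x))\<^sup>2))"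
      by (intro add_mono mult_left_mono mult_mono \<phi>1 g2 au) auto
    finally show ?thesis using inK[OF True] by simp
  qed (simp add: vK)
  have iv2: "integrable lebesgue (\<lambda>x. (norm (v x))\<^sup>2)"
  proof (rule Bochner_Integration.integrable_bound)
    show "integrable lebesgue (\<lambda>x. 2 * (norm a)\<^sup>2 * ?I x + 2 * (?I x * (norm (u x))\<^sup>2))"
      using iu iI by simp
    show "AE x in lebesgue. norm ((norm (v x))\<^sup>2) \<le> norm (2 * (norm a)\<^sup>2 * ?I x + 2 * (?I x * (norm (u x))\<^sup>2))"
      using v2 by (auto intro!: AE_I2 order_trans[OF _ abs_ge_self])
  qed measurable
  have iH2: "integrable lebesgue (\<lambda>x. (norm (H x))\<^sup>2)"
  proof (rule Bochner_Integration.integrable_bound)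
    show "integrable lebesgue (\<lambda>x. 2 * (?I x * (norm (G x))\<^sup>2)
      + 2 * (D\<^sup>2 * (2 * (norm a)\<^sup>2 * ?I x + 2 * (?I x * (norm (u x))\<^sup>2))))"
      using iu iI iG by simp
    show "AE x in lebesgue. norm ((norm (H x))\<^sup>2) \<le> norm (2 * (?I x * (norm (G x))\<^sup>2)
      + 2 * (D\<^sup>2 * (2 * (norm a)\<^sup>2 * ?I x + 2 * (?I x * (norm (u x))\<^sup>2))))"
      using H2 by (auto intro!: AE_I2 order_trans[OF _ abs_ge_self])
  qed measurable
  have W0: "W12_0 ?B v"
    by (rule W12_0_compact_support[OF open_ball pr iv2 iH2 K(1,2) vK])
  have Linf: "L_infinity ?B v"
    unfolding L_infinity_def set_borel_measurable_def
  proof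
    show "(\<lambda>x. indicat_real ?B x *\<^sub>R v x) \<in> borel_measurable lebesgue"
      by (intro borel_measurable_scaleR borel_measurable_indicator vm) simp
    have "AE x in lebesgue. x \<in> ?B \<longrightarrow> norm (v x) \<le> 2 * M"
      using uM
    proof eventually_elim
      case (elim x)
      have "norm (v x) = \<phi> x * norm (a - u x)" using \<phi>(2) by (simp add: v_def)
      also have "\<dots> \<le> 1 * (M + M)"
        using \<phi>(2,3) elim aM norm_triangle_ineq4[of a "u x"] by (intro mult_mono) auto
      finally show ?case by simp
    qed
    then show "\<exists>K. AE x in lebesgue. x \<in> ?B \<longrightarrow> norm (v x) \<le> K" by blast
  qed
  have wv: "has_weak_gradient ?B (\<lambda>x. u x + v x) (\<lambda>x. G x + H x)"
    by (rule has_weak_gradient_add[OF Gt has_weak_gradient_mono[OF pr(1) subset_UNIV]])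
  have "energy W ?B u \<le> energy W ?B (\<lambda>x. u x + v x)"
    using min W0 Linf lipschitz_boundary_ball[of t x0] st unfolding minimizer_def by simp
  also have "\<dots> = (\<integral>\<^sup>+x\<in>?B. ennreal ((norm (G x + H x))\<^sup>2 / 2 + W (u x + v x)) \<partial>lebesgue)"
    by (rule energy_eq[OF open_ball wv])
  also have "\<dots> \<le> (\<integral>\<^sup>+x\<in>?B - ball x0 s. ennreal (2 * ((norm (G x))\<^sup>2 / 2 + W (u x)) + (4 * M\<^sup>2 * D\<^sup>2 + Wm)) \<partial>lebesgue)"
  proof (rule nn_integral_mono_AE, use uM in eventually_elim)
    case (elim x)
    consider "x \<in> ball x0 s" | "x \<in> ?B - ball x0 s" | "x \<notin> ?B" by blast
    then show ?case
    proof cases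
      case 1
      have "partial_deriv j \<phi> x = 0" for j
        by (rule partial_deriv_locally_constant[OF open_ball 1 \<phi>(4)])
      then have "gradient \<phi> x = 0" by (simp add: gradient_def vec_eq_iff)
      then have "G x + H x = 0" "u x + v x = a" using \<phi>(4)[OF 1] by (simp_all add: H_def v_def op0)
      then show ?thesis using W(1) by simp
    next
      case 2
      have "G x + H x = (1 - \<phi> x) *\<^sub>R G x + outer_prod (a - u x) (gradient \<phi> x)"
        by (simp add: H_def scaleR_diff_left)
      then have "(norm (G x + H x))\<^sup>2 \<le> 2 * ((1 - \<phi> x)\<^sup>2 * (norm (G x))\<^sup>2) + 2 * ((norm (a - u x))\<^sup>2 * (norm (gradient \<phi> x))\<^sup>2)"
        using norm_add_sq_le[of "(1 - \<phi> x) *\<^sub>R G x" "outer_prod (a - u x) (gradient \<phi> x)"]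
        by (simp add: norm_outer_prod power_mult_distrib)
      also have "\<dots> \<le> 2 * (1 * (norm (G x))\<^sup>2) + 2 * ((2 * M)\<^sup>2 * D\<^sup>2)"
      proof (intro add_mono mult_left_mono mult_mono g2)
        show "(1 - \<phi> x)\<^sup>2 \<le> 1" using \<phi>(2,3)[of x] by (simp add: abs_square_le_1)
        show "(norm (a - u x))\<^sup>2 \<le> (2 * M)\<^sup>2"
          using elim aM norm_triangle_ineq4[of a "u x"] by (intro power_mono) auto
      qed auto
      finally have 1: "(norm (G x + H x))\<^sup>2 / 2 \<le> (norm (G x))\<^sup>2 + 4 * M\<^sup>2 * D\<^sup>2" by (simp add: power_mult_distrib)
      have "u x + v x = (1 - \<phi> x) *\<^sub>R u x + \<phi> x *\<^sub>R a" by (simp add: v_def algebra_simps)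
      then have "norm (u x + v x) \<le> (1 - \<phi> x) * norm (u x) + \<phi> x * norm a"
        using norm_triangle_ineq[of "(1 - \<phi> x) *\<^sub>R u x" "\<phi> x *\<^sub>R a"] \<phi>(2,3)[of x] by simp
      also have "\<dots> \<le> (1 - \<phi> x) * M + \<phi> x * M"
        using elim aM \<phi>(2,3)[of x] by (intro add_mono mult_left_mono) auto
      finally have "W (u x + v x) \<le> Wm" by (intro W(2)) (simp add: algebra_simps)
      \<comment> \<open>The term \<open>2 * W (u x)\<close> is added by nonnegativity, which turns
        the right side into a multiple of the full energy density of \<open>u\<close>.\<close>
      then have "(norm (G x + H x))\<^sup>2 / 2 + W (u x + v x) \<le> 2 * ((norm (G x))\<^sup>2 / 2 + W (u x)) + (4 * M\<^sup>2 * D\<^sup>2 + Wm)"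
        using 1 W(3)[of "u x"] by simp
      then show ?thesis using 2 by (auto intro: ennreal_leI)
    next
      case 3
      then show ?thesis by simp
    qed
  qed
  finally show ?thesis by (simp only: energy_eq[OF open_ball Gt])
qed

section \<open>Hole filling and iteration over radii\<close>

lemma hole_iteration:
  fixes F :: "nat \<Rightarrow> real"
  assumes F: "\<And>i. 2 * F i \<le> F (Suc i) + K * (16 / 9) ^ i" and C: "\<And>i. F i \<le> C" and K: "0 \<le> K"
  shows "F 0 \<le> 9 / 2 * K"
proof (rule ccontr)
  assume "\<not> F 0 \<le> 9 / 2 * K"
  \<comment> \<open>The subtracted sequence solves the recursion with equality: its coefficient is
    \<open>K / (2 - 16 / 9)\<close>. What remains at least doubles at each step, so a positive start
    contradicts the bound \<open>C\<close>.\<close>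
  define A where "A i = F i - 9 / 2 * K * (16 / 9) ^ i" for i
  have A0: "A 0 > 0" using \<open>\<not> F 0 \<le> 9 / 2 * K\<close> by (simp add: A_def)
  have A: "2 * A i \<le> A (Suc i)" for i using F[of i] by (simp add: A_def algebra_simps)
  have pow: "2 ^ i * A 0 \<le> A i" for i
  proof (induction i)
    case (Suc i)
    then show ?case using A[of i] by simp
  qed simp
  obtain i where "C / A 0 < 2 ^ i" using real_arch_pow[of 2 "C / A 0"] by auto
  then have "C < 2 ^ i * A 0" using A0 by (simp add: pos_divide_less_eq)
  also have "\<dots> \<le> A i" by (rule pow)
  also have "\<dots> \<le> F i" using K by (simp add: A_def)
  finally show False using C[of i] by simp
qed

lemma power_shell_le:
  fixes r :: real
  assumes "0 \<le> r" shows "(r + 1) ^ n - r ^ n \<le> n * (r + 1) ^ (n - 1)"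
proof (induction n)
  case (Suc n)
  have "(r + 1) ^ Suc n - r ^ Suc n = (r + 1) * ((r + 1) ^ n - r ^ n) + r ^ n"
    by (simp add: algebra_simps)
  also have "\<dots> \<le> (r + 1) * (n * (r + 1) ^ (n - 1)) + (r + 1) ^ n"
    using Suc assms by (intro add_mono mult_left_mono power_mono) auto
  also have "\<dots> = Suc n * (r + 1) ^ n" by (cases n) (simp_all add: algebra_simps)
  finally show ?case by simp
qed simp

text \<open>The exponent n - 1 originates here, from the difference of two n-th powers at distance
  1; \<open>1 \<le> r\<close> turns \<open>r + 1\<close> into \<open>2 * r\<close>.\<close>

lemma shell_measure_le:
  fixes x0 :: "real^'n::finite"
  assumes "1 \<le> r"
  shows "measure lebesgue (ball x0 (r + 1) - ball x0 r)
    \<le> unit_ball_vol (CARD('n)) * CARD('n) * 2 ^ (CARD('n) - 1) * r ^ (CARD('n) - 1)"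
proof -
  let ?n = "CARD('n)"
  have "measure lebesgue (ball x0 (r + 1) - ball x0 r) = measure lebesgue (ball x0 (r + 1)) - measure lebesgue (ball x0 r)"
    by (rule measurable_measure_Diff) (auto simp: lmeasurable_ball)
  also have "\<dots> = unit_ball_vol ?n * ((r + 1) ^ ?n - r ^ ?n)"
    using assms by (simp add: content_ball right_diff_distrib)
  also have "\<dots> \<le> unit_ball_vol ?n * (?n * (2 * r) ^ (?n - 1))"
  proof (rule mult_left_mono)
    have "(r + 1) ^ ?n - r ^ ?n \<le> ?n * (r + 1) ^ (?n - 1)" using assms by (intro power_shell_le) simp
    also have "\<dots> \<le> ?n * (2 * r) ^ (?n - 1)" using assms by (intro mult_left_mono power_mono) auto
    finally show "(r + 1) ^ ?n - r ^ ?n \<le> ?n * (2 * r) ^ (?n - 1)" .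
  qed simp
  finally show ?thesis by (simp add: power_mult_distrib mult_ac)
qed

text \<open>The shell energy equals the energy on the larger ball minus that on the smaller one, so
  adding the latter to both sides fills the hole. This subtraction is legitimate because the energy
  density is integrable, which allows the passage from \<open>ennreal\<close> to real
  integrals.\<close>

lemma hole_filling:
  fixes u :: "real^'n::finite \<Rightarrow> real^'m::finite"
  assumes min: "minimizer W u" and uM: "AE x in lebesgue. norm (u x) \<le> M" and aM: "norm a \<le> M"
    and W: "W a = 0" "\<And>z. norm z \<le> M \<Longrightarrow> W z \<le> Wm" "\<And>z. 0 \<le> W z"
    and \<phi>: "test_function (ball x0 t) \<phi>" "\<And>x. 0 \<le> \<phi> x" "\<And>x. \<phi> x \<le> 1" "\<And>x. x \<in> ball x0 s \<Longrightarrow> \<phi> x = 1"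
      "\<And>x. norm (gradient \<phi> x) \<le> D"
    and st: "0 < s" "s < t" "t \<le> R"
    and G: "has_weak_gradient (ball x0 R) u G" "L2 (ball x0 R) G" and u2: "L2 (ball x0 R) u"
    and E: "\<And>x. E x = (norm (G x))\<^sup>2 / 2 + W (u x)" "integrable lebesgue (\<lambda>x. indicator (ball x0 R) x * E x)"
  shows "2 * (LINT x|lebesgue. indicator (ball x0 s) x * E x)
    \<le> (LINT x|lebesgue. indicator (ball x0 t) x * E x) + (4 * M\<^sup>2 * D\<^sup>2 + Wm) * measure lebesgue (ball x0 t - ball x0 s)"
proof -
  define L where "L = 4 * M\<^sup>2 * D\<^sup>2 + Wm"
  have Wm: "0 \<le> Wm" using W(2)[OF aM] W(3)[of a] by simp
  have L: "0 \<le> L" using Wm by (simp add: L_def)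
  have E0: "0 \<le> E x" for x using W(3)[of "u x"] by (simp add: E(1))
  have Ei: "integrable lebesgue (\<lambda>x. indicator S x * E x)" if "S \<in> sets lebesgue" "S \<subseteq> ball x0 R" for S
  proof -
    have "(\<lambda>x. indicator S x * E x) = (\<lambda>x. indicator S x *\<^sub>R (indicator (ball x0 R) x * E x))"
      using that(2) by (intro ext) (auto simp: indicator_def)
    then show ?thesis using integrable_mult_indicator[OF that(1) E(2)] by simp
  qed
  let ?S = "ball x0 t - ball x0 s"
  have it: "integrable lebesgue (\<lambda>x. indicator (ball x0 t) x * E x)"
    and i2: "integrable lebesgue (\<lambda>x. indicator (ball x0 s) x * E x)"
    and iS: "integrable lebesgue (\<lambda>x. indicator ?S x * E x)"
    using st by (auto intro!: Ei)
  have sh: "(LINT x|lebesgue. indicator ?S x * E x)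
      = (LINT x|lebesgue. indicator (ball x0 t) x * E x) - (LINT x|lebesgue. indicator (ball x0 s) x * E x)"
    using st by (subst Bochner_Integration.integral_diff[OF it i2, symmetric])
      (auto intro!: Bochner_Integration.integral_cong simp: indicator_def)
  have S: "emeasure lebesgue ?S < \<infinity>"
    using emeasure_bounded_finite[of ?S] by (simp add: bounded_diff)
  have iSL: "integrable lebesgue (\<lambda>x. 2 * (indicator ?S x * E x) + L * indicator ?S x)"
    using iS S by (intro Bochner_Integration.integrable_add integrable_mult_right integrable_real_indicator) auto
  have "ennreal (LINT x|lebesgue. indicator (ball x0 t) x * E x) = (\<integral>\<^sup>+x\<in>ball x0 t. ennreal (E x) \<partial>lebesgue)"
    using E0 by (subst nn_integral_eq_integral[OF it, symmetric])
      (auto intro!: nn_integral_cong simp: indicator_def)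
  also have "\<dots> \<le> (\<integral>\<^sup>+x\<in>?S. ennreal (2 * E x + L) \<partial>lebesgue)"
    unfolding E(1) L_def by (rule energy_comparison[OF min uM aM W \<phi> st G u2])
  also have "\<dots> = ennreal (LINT x|lebesgue. 2 * (indicator ?S x * E x) + L * indicator ?S x)"
    using E0 L by (subst nn_integral_eq_integral[OF iSL, symmetric])
      (auto intro!: nn_integral_cong simp: indicator_def)
  also have "(LINT x|lebesgue. 2 * (indicator ?S x * E x) + L * indicator ?S x)
      = 2 * (LINT x|lebesgue. indicator ?S x * E x) + L * measure lebesgue ?S"
    using iS S by (subst Bochner_Integration.integral_add) auto
  finally have "(LINT x|lebesgue. indicator (ball x0 t) x * E x)
      \<le> 2 * (LINT x|lebesgue. indicator ?S x * E x) + L * measure lebesgue ?S"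
    using L E0 by (subst (asm) ennreal_le_iff) (auto intro!: add_nonneg_nonneg mult_nonneg_nonneg Bochner_Integration.integral_nonneg)
  then show ?thesis unfolding sh L_def by simp
qed

text \<open>Hole filling along the radii \<open>r + 1 - (3/4)\<^sup>i\<close>, whose gaps stay inside the unit shell.\<close>

lemma energy_growth:
  fixes u :: "real^'n::finite \<Rightarrow> real^'m::finite"
  assumes min: "minimizer W u" and uM: "AE x in lebesgue. norm (u x) \<le> M" and aM: "norm a \<le> M"
    and W: "W a = 0" "\<And>z. norm z \<le> M \<Longrightarrow> W z \<le> Wm" "\<And>z. 0 \<le> W z" and Wb: "W \<in> borel_measurable borel"
    and C: "0 < C" "\<And>(x0::real^'n) s t. 0 < s \<Longrightarrow> s < t \<Longrightarrow> \<exists>\<phi>. test_function (ball x0 t) \<phi> \<and>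
      (\<forall>x. 0 \<le> \<phi> x \<and> \<phi> x \<le> 1) \<and> (\<forall>x\<in>ball x0 s. \<phi> x = 1) \<and> (\<forall>x. norm (gradient \<phi> x) \<le> C / (t - s))"
    and r: "1 \<le> r"
  shows "energy W (ball x0 r) u \<le> ennreal (9 / 2 * ((64 * M\<^sup>2 * C\<^sup>2 + Wm) *
    (unit_ball_vol (CARD('n)) * CARD('n) * 2 ^ (CARD('n) - 1) * r ^ (CARD('n) - 1))))"
proof -
  let ?R = "r + 1"
  have "W12 (ball x0 ?R) u" using min by (simp add: minimizer_def W12_loc_def)
  then obtain G where G: "has_weak_gradient (ball x0 ?R) u G" "L2 (ball x0 ?R) G" and u2: "L2 (ball x0 ?R) u"
    by (auto simp: W12_def)
  have Wm: "0 \<le> Wm" using W(2)[OF aM] W(3)[of a] by simp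
  have um: "u \<in> borel_measurable lebesgue"
    using min by (simp add: minimizer_def L_infinity_def set_borel_measurable_def)
  define E where "E x = (norm (G x))\<^sup>2 / 2 + W (u x)" for x
  have E0: "0 \<le> E x" for x using W(3)[of "u x"] by (simp add: E_def)
  let ?I = "indicator (ball x0 ?R) :: real^'n \<Rightarrow> real"
  have Im[measurable]: "?I \<in> borel_measurable lebesgue" by (intro borel_measurable_indicator) simp
  \<comment> \<open>The gradient part is finite by local square integrability, the potential part
    because \<open>W\<close> is bounded by \<open>Wm\<close> on the values of \<open>u\<close>. Both
    the subtraction in \<open>hole_filling\<close> and the a priori bound in
    \<open>hole_iteration\<close> rest on this.\<close>
  have iE: "integrable lebesgue (\<lambda>x. ?I x * E x)"
  proof -
    have 1: "integrable lebesgue (\<lambda>x. ?I x * (norm (G x))\<^sup>2)" using G(2) by (simp add: L2_def set_integrable_def)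
    have 2: "integrable lebesgue (\<lambda>x. ?I x * W (u x))"
    proof (rule Bochner_Integration.integrable_bound[where f="\<lambda>x. Wm * ?I x"])
      show "integrable lebesgue (\<lambda>x. Wm * ?I x)"
        using emeasure_bounded_finite[OF bounded_ball, of x0 ?R] by (intro integrable_mult_right integrable_real_indicator) auto
      show "(\<lambda>x. ?I x * W (u x)) \<in> borel_measurable lebesgue"
        by (intro borel_measurable_times Im measurable_compose[OF um Wb])
      show "AE x in lebesgue. norm (?I x * W (u x)) \<le> norm (Wm * ?I x)"
        using uM by eventually_elim (use W Wm in \<open>auto simp: indicator_def\<close>)
    qed
    have "(\<lambda>x. ?I x * E x) = (\<lambda>x. (?I x * (norm (G x))\<^sup>2) / 2 + ?I x * W (u x))"
      by (rule ext) (simp add: E_def distrib_left)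
    then show ?thesis using 1 2 by simp
  qed
  \<comment> \<open>The sequence starts at \<open>r\<close> and increases to \<open>r + 1\<close>
    with gaps \<open>(3 / 4) ^ i / 4\<close>. Any ratio whose inverse square is below 2 would serve;
    here it is 16/9.\<close>
  define t where "t i = r + 1 - (3 / 4 :: real) ^ i" for i
  have t0: "t 0 = r" by (simp add: t_def)
  have td: "t (Suc i) - t i = (3 / 4) ^ i / 4" for i by (simp add: t_def)
  have tlt: "t i < t (Suc i)" for i using td[of i] by (smt (verit) divide_pos_pos zero_less_power)
  have tr: "r \<le> t i" "t i \<le> ?R" for i by (simp_all add: t_def power_le_one)
  define F where "F i = (LINT x|lebesgue. indicator (ball x0 (t i)) x * E x)" for i
  define V where "V = unit_ball_vol (CARD('n)) * CARD('n) * 2 ^ (CARD('n) - 1) * r ^ (CARD('n) - 1)"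
  have V: "measure lebesgue (ball x0 ?R - ball x0 r) \<le> V" unfolding V_def by (rule shell_measure_le[OF r])
  then have V0: "0 \<le> V" using measure_nonneg order_trans by blast
  have Ei: "integrable lebesgue (\<lambda>x. indicator (ball x0 (t i)) x * E x)" for i
  proof -
    have "(\<lambda>x. indicator (ball x0 (t i)) x * E x) = (\<lambda>x. indicator (ball x0 (t i)) x *\<^sub>R (?I x * E x))"
      using tr(2)[of i] by (intro ext) (auto simp: indicator_def)
    then show ?thesis using integrable_mult_indicator[OF _ iE, of "ball x0 (t i)"] by simp
  qed
  have "F 0 \<le> 9 / 2 * ((64 * M\<^sup>2 * C\<^sup>2 + Wm) * V)"
  proof (rule hole_iteration)
    fix i
    have "0 < t i" using tr(1)[of i] r by simp
    then obtain \<phi> where \<phi>: "test_function (ball x0 (t (Suc i))) \<phi>" "\<And>x. 0 \<le> \<phi> x" "\<And>x. \<phi> x \<le> 1"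
        "\<And>x. x \<in> ball x0 (t i) \<Longrightarrow> \<phi> x = 1" "\<And>x. norm (gradient \<phi> x) \<le> C / (t (Suc i) - t i)"
      using C(2)[OF _ tlt[of i], of x0] by blast
    let ?D = "C / (t (Suc i) - t i)"
    have h: "2 * F i \<le> F (Suc i) + (4 * M\<^sup>2 * ?D\<^sup>2 + Wm) * measure lebesgue (ball x0 (t (Suc i)) - ball x0 (t i))"
      unfolding F_def
      by (rule hole_filling[OF min uM aM W \<phi> \<open>0 < t i\<close> tlt tr(2) G u2 E_def iE])
    \<comment> \<open>The inverse gap contributes 4, so \<open>4 * M^2 * (4 * C)^2\<close> is the
      constant \<open>64 * M^2 * C^2\<close>.\<close>
    have "?D = 4 * C * (4 / 3) ^ i" by (simp add: td power_divide)
    then have "?D\<^sup>2 = (4 * C)\<^sup>2 * ((4 / 3)\<^sup>2) ^ i" by (simp only: power_mult_distrib) (simp add: power_mult[symmetric] mult.commute)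
    then have D: "4 * M\<^sup>2 * ?D\<^sup>2 = 64 * M\<^sup>2 * C\<^sup>2 * (16 / 9) ^ i" by (simp add: power_mult_distrib power_divide)
    have q: "1 \<le> (16 / 9 :: real) ^ i" by (rule one_le_power) simp
    \<comment> \<open>Estimating each thin shell by the whole unit shell is crude, but it makes
      \<open>V\<close> the same for all \<open>i\<close>.\<close>
    have "measure lebesgue (ball x0 (t (Suc i)) - ball x0 (t i)) \<le> measure lebesgue (ball x0 ?R - ball x0 r)"
      by (intro measure_mono_fmeasurable Diff_mono subset_ball tr fmeasurable.Diff lmeasurable_ball) simp
    then have m: "measure lebesgue (ball x0 (t (Suc i)) - ball x0 (t i)) \<le> V" using V by simp
    have "(4 * M\<^sup>2 * ?D\<^sup>2 + Wm) * measure lebesgue (ball x0 (t (Suc i)) - ball x0 (t i))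
        \<le> ((64 * M\<^sup>2 * C\<^sup>2 + Wm) * (16 / 9) ^ i) * V"
    proof (rule mult_mono[OF _ m])
      have "Wm * 1 \<le> Wm * (16 / 9) ^ i" using q Wm by (intro mult_left_mono)
      then show "4 * M\<^sup>2 * ?D\<^sup>2 + Wm \<le> (64 * M\<^sup>2 * C\<^sup>2 + Wm) * (16 / 9) ^ i" unfolding D by (simp add: distrib_right)
      show "0 \<le> (64 * M\<^sup>2 * C\<^sup>2 + Wm) * (16 / 9) ^ i" using Wm by simp
    qed simp
    with h show "2 * F i \<le> F (Suc i) + (64 * M\<^sup>2 * C\<^sup>2 + Wm) * V * (16 / 9) ^ i" by (simp add: mult_ac)
  next
    fix i
    \<comment> \<open>The a priori bound may depend on \<open>u\<close>, the centre and
      \<open>r\<close>: the iteration uses it without letting it enter the final constant.\<close>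
    show "F i \<le> (LINT x|lebesgue. ?I x * E x)" unfolding F_def
      using tr(2)[of i] E0 by (intro integral_mono Ei iE) (auto simp: indicator_def)
  qed (use Wm V0 in simp)
  moreover have "energy W (ball x0 r) u = ennreal (F 0)"
  proof -
    have "energy W (ball x0 r) u = (\<integral>\<^sup>+x\<in>ball x0 r. ennreal (E x) \<partial>lebesgue)"
      unfolding E_def by (rule energy_eq[OF open_ball has_weak_gradient_mono[OF G(1)]]) auto
    also have "\<dots> = ennreal (F 0)"
      using E0 Ei[of 0] unfolding F_def t0
      by (subst nn_integral_eq_integral[symmetric]) (auto intro!: nn_integral_cong simp: indicator_def)
    finally show ?thesis .
  qed
  ultimately show ?thesis by (simp add: V_def ennreal_leI)
qed

theorem lemma2p2:
  fixes A :: "(real^'m::finite) set" and W :: "real^'m \<Rightarrow> real" and \<alpha> M :: real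
  assumes "finite A" and "2 \<le> card A"
    and "0 \<le> \<alpha>" and "\<alpha> < 2"
    and "0 < \<alpha> \<Longrightarrow> H1 \<alpha> A W"
    and "\<alpha> = 0 \<Longrightarrow> W = indicator (- A)"
    and "0 < Liminf at_infinity (\<lambda>z. ereal (W z))"
  shows "\<exists>C\<^sub>0 > 0. \<exists>r\<^sub>0 > 0. \<forall>u :: real^'n::finite \<Rightarrow> real^'m.
    minimizer W u \<and> (AE x in lebesgue. norm (u x) < M) \<longrightarrow>
      (\<forall>x\<^sub>0 r. r\<^sub>0 < r \<longrightarrow>
        energy W (ball x\<^sub>0 r) u \<le> ennreal (C\<^sub>0 * r ^ (CARD('n) - 1)))"
proof -
  obtain a where a: "a \<in> A" using assms(2) by (metis card.empty ex_in_conv not_numeral_le_zero)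
  \<comment> \<open>A ball about 0 containing both the zero \<open>a\<close> and almost all values
    of \<open>u\<close>; its radius depends only on \<open>M\<close> and the chosen
    \<open>a\<close>, not on \<open>u\<close>.\<close>
  define M' where "M' = max M (norm a)"
  \<comment> \<open>The two kinds of potential are brought to common terms. For
    \<open>\<alpha> = 0\<close> measurability holds because the finite set \<open>A\<close> is
    closed, and the bound is 1; otherwise both follow from continuity and compactness of the closed
    ball.\<close>
  have "W a = 0 \<and> (\<forall>z. 0 \<le> W z) \<and> W \<in> borel_measurable borel \<and> (\<exists>b. \<forall>z. norm z \<le> M' \<longrightarrow> W z \<le> b)"
  proof (cases "\<alpha> = 0")
    case True
    then have W: "W = indicator (- A)" by (rule assms(6))
    have "- A \<in> sets borel" using assms(1) by (simp add: finite_imp_closed borel_closed)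
    then have "W \<in> borel_measurable borel" unfolding W by simp
    then show ?thesis using a by (auto simp: W indicator_def intro!: exI[of _ 1])
  next
    case False
    then have "H1 \<alpha> A W" using assms(3,5) by simp
    then have W: "continuous_on UNIV W" "\<And>z. 0 \<le> W z" "{z. W z = 0} = A" by (auto simp: H1_def)
    have "compact (W ` cball 0 M')"
      using W(1) by (intro compact_continuous_image continuous_on_subset[OF W(1)]) auto
    then obtain b where b: "\<And>y. y \<in> W ` cball 0 M' \<Longrightarrow> norm y \<le> b"
      using compact_imp_bounded bounded_iff by metis
    have "W z \<le> b" if "norm z \<le> M'" for z
      using b[of "W z"] that abs_ge_self[of "W z"] by force
    then show ?thesis using W a borel_measurable_continuous_onI[OF W(1)] by blast
  qed
  then obtain b where W: "W a = 0" "\<And>z. 0 \<le> W z" "W \<in> borel_measurable borel"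
      "\<And>z. norm z \<le> M' \<Longrightarrow> W z \<le> b"
    by blast
  obtain C where C: "0 < C" "\<And>(x0::real^'n) s t. 0 < s \<Longrightarrow> s < t \<Longrightarrow> \<exists>\<phi>. test_function (ball x0 t) \<phi> \<and>
      (\<forall>x. 0 \<le> \<phi> x \<and> \<phi> x \<le> 1) \<and> (\<forall>x\<in>ball x0 s. \<phi> x = 1) \<and> (\<forall>x. norm (gradient \<phi> x) \<le> C / (t - s))"
    using cutoff_exists[where 'n='n] by blast
  define C0 where "C0 = 9 / 2 * ((64 * M'\<^sup>2 * C\<^sup>2 + b) * (unit_ball_vol (CARD('n)) * CARD('n) * 2 ^ (CARD('n) - 1)))"
  have aM: "norm a \<le> M'" by (simp add: M'_def)
  have b: "0 \<le> b" using W(1) W(4)[OF aM] by simp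
  have C0: "0 \<le> C0" using b by (auto simp: C0_def intro!: mult_nonneg_nonneg add_nonneg_nonneg)
  \<comment> \<open>\<open>C0\<close> was fixed before \<open>u\<close>, the centre and
    \<open>r\<close>. Adding 1 makes the constant strictly positive, and the threshold 1 for the
    radius is the one required by the shell estimate.\<close>
  have "energy W (ball x0 r) u \<le> ennreal ((C0 + 1) * r ^ (CARD('n) - 1))"
    if u: "minimizer W u" "AE x in lebesgue. norm (u x) < M" and r: "1 < r"
    for u :: "real^'n \<Rightarrow> real^'m" and x0 r
  proof -
    have "AE x in lebesgue. norm (u x) \<le> M'" using u(2) by eventually_elim (simp add: M'_def)
    then have "energy W (ball x0 r) u \<le> ennreal (9 / 2 * ((64 * M'\<^sup>2 * C\<^sup>2 + b) *
        (unit_ball_vol (CARD('n)) * CARD('n) * 2 ^ (CARD('n) - 1) * r ^ (CARD('n) - 1))))"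
      using energy_growth[OF u(1) _ aM W(1,4,2,3) C] r by simp
    also have "\<dots> = ennreal (C0 * r ^ (CARD('n) - 1))" by (simp add: C0_def mult_ac)
    also have "\<dots> \<le> ennreal ((C0 + 1) * r ^ (CARD('n) - 1))"
      using r by (intro ennreal_leI mult_right_mono) auto
    finally show ?thesis .
  qed
  then show ?thesis using C0 by (intro exI[of _ "C0 + 1"] exI[of _ 1] conjI) auto
qed

end
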